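(* Let $\{\zeta(t),t\in\mathbb{R}\}$ be a periodically correlated stochastic process with period $T$ such that the generated stationary sequence $\{\zeta_j,j\in\mathbb{Z}\}$ has spectral density $f(\lambda)$ which satisfies the minimality condition $\int_{-\pi}^{\pi}\mathrm{Tr}\,[(f(\lambda))^{-1}]\,d\lambda<\infty$ and admits the canonical factorization $$f(\lambda)=P(\lambda)P^*(\lambda),\qquad P(\lambda)=\sum_{u=0}^\infty d(u)e^{-iu\lambda},\qquad d(u)=\{d_{km}(u)\}_{k=\overline{1,\infty}}^{m=\overline{1,M}} .$$ Let the coefficients $\{\vec a_j,\ j=0,1,\dots\}$ that determine the functional $A^e\zeta=\int_0^{\infty}a(t)\zeta(t)\,dt$ satisfy $$\sum_{j=0}^\infty\|\vec a_j\|<\infty,\qquad \sum_{j=0}^\infty(j+1)\|\vec a_j\|^2<\infty .$$ Let $A(e^{i\lambda})=\sum_{j=0}^\infty\vec a_je^{ij\lambda}$, $S(e^{i\lambda})=\sum_{l=0}^\infty(Ad)_le^{il\lambda}$, $(Ad)_l=\sum_{j=l}^\infty\vec a_j^\top d(j-l)$ for $l\ge0$, $\|Ad\|^2=\sum_{l=0}^\infty\|(Ad)_l\|^2$, and let the matrix function $Q(\lambda)=\{q_{mk}(\lambda)\}_{m=\overline{1,M}}^{k=\overline{1,\infty}}$ satisfy $Q(\lambda)P(\lambda)=I_M$. Then the spectral characteristic $h(f)$ and the mean square error $\Delta(f)$ of the optimal linear estimate of $A^e\zeta$ based on observations of the process $\zeta(t)$ at points of time $t<0$ are given by $$h^\top(f)=A^\top(e^{i\lambda})-S(e^{i\lambda})Q(\lambda),\qquad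 \Delta(f)=\|Ad\|^2 ,$$ and the optimal linear estimate is $$\hat A^e\zeta=\int_{-\pi}^{\pi}h^\top(e^{i\lambda})\,Z^{\zeta}(d\lambda)=\int_{-\pi}^{\pi}\sum_{k=1}^\infty h_k(e^{i\lambda})\,Z_k^{\zeta}(d\lambda)$$ with $h=h(f)$.
   Context: Periodically correlated (PC) process: a mean square continuous process $\zeta:\mathbb{R}\to H=L_2(\Omega,F,P)$ with $E\zeta(t)=0$ whose correlation function $K(t,s)=E\zeta(t)\overline{\zeta(s)}$ satisfies $K(t,s)=K(t+T,s+T)$ for all $t,s\in\mathbb{R}$ and a fixed $T>0$. Generated stationary sequence: $\zeta_j(u)=\zeta(u+jT)$, $u\in[0,T)$, $j\in\mathbb{Z}$. With the orthonormal basis $\tilde e_k(u)=T^{-1/2}\exp\{2\pi i(-1)^k[k/2]u/T\}$, $k=1,2,\dots$, of $L_2([0,T))$ put $\zeta_{kj}=\langle\zeta_j,\tilde e_k\rangle=\int_0^T\zeta_j(v)\overline{\tilde e_k(v)}\,dv$ and identify $\zeta_j$ with the vector $\vec\zeta_j=(\zeta_{kj},k=1,2,\dots)^\top$. The sequence is stationary: $E\zeta_{kl}\overline{\zeta_{nj}}=\langle R_\zeta(l-j)e_k,e_n\rangle$, where $\{e_k\}$ is the basis of $\ell_2$ and $R_\zeta(j)$ are operators in $\ell_2$; $P_\zeta=\sum_kE|\zeta_{kj}|^2<\infty$. It has spectral density $f(\lambda)=\{f_{kn}(\lambda)\}_{k,n=1}^\infty$, a positive operator-valued function in $\ell_2$,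 $\lambda\in[-\pi,\pi)$, if $\langle R_\zeta(j)e_k,e_n\rangle=\frac1{2\pi}\int_{-\pi}^\pi e^{ij\lambda}\langle f(\lambda)e_k,e_n\rangle d\lambda$; $f(\lambda)$ is a.e. trace class. Canonical factorization: let $H_\zeta(n)$ be the closed linear span in $H$ of $\{\zeta_{kj},k\ge1,j\le n\}$. The sequence is regular if $\bigcap_nH_\zeta(n)=\{0\}$. A regular sequence has the canonical moving average representation $\zeta_{kj}=\sum_{u=-\infty}^{j}\sum_{m=1}^{M}d_{km}(j-u)\varepsilon_m(u)$, where $\varepsilon_m(u)$, $m=1,\dots,M$, $u\in\mathbb{Z}$, are mutually orthogonal sequences in $H$ with orthonormal values, $M$ is the multiplicity of $\{\zeta_j\}$, $\sum_{u\ge0}\sum_k\sum_m|d_{km}(u)|^2=P_\zeta$, and (canonicity) $H_\zeta(n)$ is the closed span of $\{\varepsilon_m(u),u\le n,\ 1\le m\le M\}$. The matrices $d(u)$ in the canonical factorization of $f$ are the coefficients of this representation. $I_M$ is the $M\times M$ identity. Functional: $\int_0^\infty|a(t)|dt<\infty$; $a_j(u)=a(u+jT)$, $u\in[0,T)$; $\vec a_j=(a_{kj},k=1,2,\dots)^\top$ is the vector of Fourier coefficients taken in the order $(\langle a_j,\tilde e_1\rangle,\langle a_j,\tilde e_3\rangle,\langle a_j,\tilde e_2\rangle,\dots,\langle a_j,\tilde e_{2k+1}\rangle,\langle a_j,\tilde e_{2k}\rangle,\dots)^\top$, so that $A^e\zeta=\sum_{j=0}^\infty\vec a_j^\top\vec\zeta_j$;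 $\|\vec a_j\|^2=\sum_k|a_{kj}|^2$. Linear estimates: $L_2(f)$ is the Hilbert space of vector functions $b(\lambda)=\{b_k(\lambda)\}_{k=1}^\infty$ with $\int_{-\pi}^\pi b^\top(\lambda)f(\lambda)\overline{b(\lambda)}d\lambda<\infty$. $L_2^{-}(f)$ is the closed subspace generated by $e^{ij\lambda}\delta_k$, $j<0$, $k\ge1$, where $\delta_k=\{\delta_{kn}\}_{n=1}^\infty$. $Z^{\zeta}=\{Z_k^{\zeta}\}_{k=1}^\infty$ is the orthogonal stochastic measure of $\{\zeta_j\}$. A linear estimate based on observations at $t<0$ is $\int_{-\pi}^\pi h^\top(e^{i\lambda})Z^{\zeta}(d\lambda)$ with spectral characteristic $h\in L_2^{-}(f)$; its mean square error is $\Delta(h;f)=E|A^e\zeta-\hat A^e\zeta|^2=\frac1{2\pi}\int_{-\pi}^{\pi}[A-h]^\top f\,\overline{[A-h]}\,d\lambda$. The spectral characteristic $h(f)$ of the optimal estimate minimizes $\Delta(h;f)$ over $h\in L_2^{-}(f)$, and $\Delta(f)=\Delta(h(f);f)$.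
   Formalization: In the minimality condition the inverse of f(λ) is read as the Moore–Penrose inverse (the inverse on the range), since a trace-class f(λ) in ℓ₂ cannot have a two-sided inverse of finite trace. *)

theory Defs
  imports "HOL-Probability.Probability"
begin

text \<open>
  Conventions. Vectors, infinite matrices and bases are indexed from 0: index \<open>k\<close> here is index
  \<open>k + 1\<close> in the usual notation \<open>k = 1, 2, \<dots>\<close>. The multiplicity \<open>M\<close> ranges over
  \<open>{0, 1, 2, \<dots>, \<infinity>}\<close>, so the second index of the matrices \<open>d(u)\<close> runs over
  \<open>{m. enat m < M}\<close>. Functions of the frequency are functions of a real variable \<open>x\<close>, only
  their values on \<open>[-\<pi>, \<pi>)\<close> matter, and \<open>e\<^sup>i\<^sup>x\<close> is \<open>cis x\<close>. Elements of
  \<open>H = L\<^sub>2(\<Omega>)\<close> are represented by square integrable functions; all notions below are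
  insensitive to the choice of the representative.
\<close>

definition sq_integrable :: "'w measure \<Rightarrow> ('w \<Rightarrow> complex) \<Rightarrow> bool" where
  "sq_integrable \<Omega> X \<longleftrightarrow> X \<in> borel_measurable \<Omega> \<and> integrable \<Omega> (\<lambda>w. (cmod (X w))\<^sup>2)"

definition ms_inner :: "'w measure \<Rightarrow> ('w \<Rightarrow> complex) \<Rightarrow> ('w \<Rightarrow> complex) \<Rightarrow> complex" where
  "ms_inner \<Omega> X Y = (LINT w|\<Omega>. X w * cnj (Y w))"

definition ms_norm2 :: "'w measure \<Rightarrow> ('w \<Rightarrow> complex) \<Rightarrow> real" where
  "ms_norm2 \<Omega> X = (LINT w|\<Omega>. (cmod (X w))\<^sup>2)"

definition closed_span :: "'w measure \<Rightarrow> ('w \<Rightarrow> complex) set \<Rightarrow> ('w \<Rightarrow> complex) set" where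
  "closed_span \<Omega> G = {Y. sq_integrable \<Omega> Y \<and>
     (\<forall>e>0. \<exists>F c. finite F \<and> F \<subseteq> G \<and> ms_norm2 \<Omega> (\<lambda>w. Y w - (\<Sum>X\<in>F. c X * X w)) < e)}"

definition simple_ms :: "(real set \<times> ('w \<Rightarrow> complex)) list \<Rightarrow> real \<Rightarrow> 'w \<Rightarrow> complex" where
  "simple_ms xs t w = (\<Sum>(B, X)\<leftarrow>xs. indicator B t * X w)"

definition simple_ms_integral :: "(real set \<times> ('w \<Rightarrow> complex)) list \<Rightarrow> 'w \<Rightarrow> complex" where
  "simple_ms_integral xs w = (\<Sum>(B, X)\<leftarrow>xs. complex_of_real (measure lborel B) * X w)"

text \<open>
  The integral over the real line of an \<open>H\<close>-valued function, in the sense of Bochner. This is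
  \<^const>\<open>has_bochner_integral\<close> with the norm of the codomain replaced by the norm of
  \<open>L\<^sub>2(\<Omega>)\<close>, which is not available as a type.
\<close>
definition has_ms_integral :: "'w measure \<Rightarrow> (real \<Rightarrow> 'w \<Rightarrow> complex) \<Rightarrow> ('w \<Rightarrow> complex) \<Rightarrow> bool" where
  "has_ms_integral \<Omega> X I \<longleftrightarrow> sq_integrable \<Omega> I \<and> (\<forall>t. sq_integrable \<Omega> (X t)) \<and>
     (\<exists>xs :: nat \<Rightarrow> (real set \<times> ('w \<Rightarrow> complex)) list.
        (\<forall>r. \<forall>(B, Y)\<in>set (xs r). B \<in> sets lborel \<and> emeasure lborel B < \<infinity> \<and> sq_integrable \<Omega> Y) \<and>
        (\<forall>r. (\<lambda>t. ms_norm2 \<Omega> (\<lambda>w. X t w - simple_ms (xs r) t w)) \<in> borel_measurable lborel) \<and>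
        (\<lambda>r. \<integral>\<^sup>+t. ennreal (sqrt (ms_norm2 \<Omega> (\<lambda>w. X t w - simple_ms (xs r) t w))) \<partial>lborel)
           \<longlonglongrightarrow> 0 \<and>
        (\<lambda>r. ms_norm2 \<Omega> (\<lambda>w. I w - simple_ms_integral (xs r) w)) \<longlonglongrightarrow> 0)"

definition pc_process :: "'w measure \<Rightarrow> real \<Rightarrow> (real \<Rightarrow> 'w \<Rightarrow> complex) \<Rightarrow> bool" where
  "pc_process \<Omega> T \<zeta> \<longleftrightarrow>
     (\<forall>t. sq_integrable \<Omega> (\<zeta> t)) \<and>
     (\<forall>t. (LINT w|\<Omega>. \<zeta> t w) = 0) \<and>
     (\<forall>t. ((\<lambda>s. ms_norm2 \<Omega> (\<lambda>w. \<zeta> s w - \<zeta> t w)) \<longlongrightarrow> 0) (at t)) \<and>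
     (\<forall>t s. ms_inner \<Omega> (\<zeta> t) (\<zeta> s) = ms_inner \<Omega> (\<zeta> (t + T)) (\<zeta> (s + T)))"

definition basis_fn :: "real \<Rightarrow> nat \<Rightarrow> real \<Rightarrow> complex" where
  "basis_fn T k u = complex_of_real (1 / sqrt T) *
     cis (2 * pi * ((- 1) ^ (k + 1) * real ((k + 1) div 2)) * u / T)"

definition generated_sequence ::
    "'w measure \<Rightarrow> real \<Rightarrow> (real \<Rightarrow> 'w \<Rightarrow> complex) \<Rightarrow> (nat \<Rightarrow> int \<Rightarrow> 'w \<Rightarrow> complex) \<Rightarrow> bool" where
  "generated_sequence \<Omega> T \<zeta> z \<longleftrightarrow>
     (\<forall>k j. has_ms_integral \<Omega>
        (\<lambda>v w. indicator {0..<T} v * (\<zeta> (v + of_int j * T) w * cnj (basis_fn T k v))) (z k j))"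

text \<open>
  \<open>coef_perm\<close> keeps the first coordinate and swaps the \<open>2k\<close>-th and the \<open>(2k+1)\<close>-st one
  (counted from 1), that is, it exchanges the basis functions of frequency \<open>k\<close> and \<open>-k\<close>.
\<close>
definition coef_perm :: "nat \<Rightarrow> nat" where
  "coef_perm k = (if k = 0 then 0 else if odd k then k + 1 else k - 1)"

definition avec :: "real \<Rightarrow> (real \<Rightarrow> complex) \<Rightarrow> nat \<Rightarrow> nat \<Rightarrow> complex" where
  "avec T a j k = (LINT v:{0..<T}|lborel. a (v + of_nat j * T) * cnj (basis_fn T (coef_perm k) v))"

definition in_l2 :: "(nat \<Rightarrow> complex) \<Rightarrow> bool" where
  "in_l2 b \<longleftrightarrow> summable (\<lambda>k. (cmod (b k))\<^sup>2)"

definition l2_norm :: "(nat \<Rightarrow> complex) \<Rightarrow> real" where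
  "l2_norm b = sqrt (\<Sum>k. (cmod (b k))\<^sup>2)"

text \<open>
  A matrix that is positive with summable diagonal is the matrix of a positive trace class operator
  in \<open>\<ell>\<^sub>2\<close>.
\<close>
definition pos_trace_class :: "(nat \<Rightarrow> nat \<Rightarrow> complex) \<Rightarrow> bool" where
  "pos_trace_class F \<longleftrightarrow>
     (\<forall>N b. (\<Sum>k<N. \<Sum>n<N. b k * F k n * cnj (b n)) \<in> \<real>\<^sub>\<ge>\<^sub>0) \<and> summable (\<lambda>k. F k k)"

definition mat_trace :: "(nat \<Rightarrow> nat \<Rightarrow> complex) \<Rightarrow> complex" where
  "mat_trace F = (\<Sum>k. F k k)"

definition mat_mult :: "(nat \<Rightarrow> nat \<Rightarrow> complex) \<Rightarrow> (nat \<Rightarrow> nat \<Rightarrow> complex) \<Rightarrow> nat \<Rightarrow> nat \<Rightarrow> complex" where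
  "mat_mult F G i j = (\<Sum>k. F i k * G k j)"

definition hermitian :: "(nat \<Rightarrow> nat \<Rightarrow> complex) \<Rightarrow> bool" where
  "hermitian F \<longleftrightarrow> (\<forall>i j. F i j = cnj (F j i))"

text \<open>
  The inverse of \<open>f(x)\<close> is understood as the Moore--Penrose inverse, i.e. the inverse on the
  range. A positive trace class operator on the infinite-dimensional space \<open>\<ell>\<^sub>2\<close> never has a
  two-sided inverse of finite trace; with a factorization \<open>f = P P\<^sup>*\<close> through \<open>M\<close> columns
  the operator has rank at most \<open>M\<close>. A two-sided inverse would be a special case.
\<close>
definition mp_inverse :: "(nat \<Rightarrow> nat \<Rightarrow> complex) \<Rightarrow> (nat \<Rightarrow> nat \<Rightarrow> complex) \<Rightarrow> bool" where
  "mp_inverse F G \<longleftrightarrow>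
     mat_mult (mat_mult F G) F = F \<and> mat_mult (mat_mult G F) G = G \<and>
     hermitian (mat_mult F G) \<and> hermitian (mat_mult G F)"

text \<open>
  The inverse of a positive operator is positive, and finiteness of the integral of its trace forces
  it to be trace class almost everywhere.
\<close>
definition minimality :: "(real \<Rightarrow> nat \<Rightarrow> nat \<Rightarrow> complex) \<Rightarrow> bool" where
  "minimality f \<longleftrightarrow> (\<exists>G.
     (AE x in lborel. x \<in> {-pi..<pi} \<longrightarrow> pos_trace_class (G x) \<and> mp_inverse (f x) (G x)) \<and>
     set_integrable lborel {-pi..<pi} (\<lambda>x. mat_trace (G x)))"

text \<open>
  The entry \<open>f x k n\<close> stands for \<open>\<langle>f(x) e\<^sub>k, e\<^sub>n\<rangle>\<close>, so that the covariance of
  \<open>\<zeta>\<^sub>k\<^sub>l\<close> and \<open>\<zeta>\<^sub>n\<^sub>j\<close> is \<open>\<langle>R(l - j) e\<^sub>k, e\<^sub>n\<rangle>\<close>; this is the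
  convention for which the quadratic form \<open>b\<^sup>T f b\<close> (with the last factor conjugated) is the
  variance of \<open>\<integral> b\<^sup>T dZ\<close>.
\<close>
definition spectral_density ::
    "'w measure \<Rightarrow> (nat \<Rightarrow> int \<Rightarrow> 'w \<Rightarrow> complex) \<Rightarrow> (real \<Rightarrow> nat \<Rightarrow> nat \<Rightarrow> complex) \<Rightarrow> bool" where
  "spectral_density \<Omega> z f \<longleftrightarrow>
     (\<forall>k n. (\<lambda>x. f x k n) \<in> borel_measurable lborel) \<and>
     (AE x in lborel. x \<in> {-pi..<pi} \<longrightarrow> pos_trace_class (f x)) \<and>
     (\<forall>k n. set_integrable lborel {-pi..<pi} (\<lambda>x. f x k n)) \<and>
     (\<forall>k n l j. ms_inner \<Omega> (z k l) (z n j) =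
        complex_of_real (1 / (2 * pi)) *
          (LINT x:{-pi..<pi}|lborel. cis (of_int (l - j) * x) * f x k n))"

definition fourier_L2 :: "(nat \<Rightarrow> complex) \<Rightarrow> int \<Rightarrow> (real \<Rightarrow> complex) \<Rightarrow> bool" where
  \<comment> \<open>\<open>g(x) = \<Sum>\<^sub>u c(u) exp(i \<sigma> u x)\<close>, the series converging in \<open>L\<^sub>2([-\<pi>, \<pi>))\<close>\<close>
  "fourier_L2 c \<sigma> g \<longleftrightarrow> g \<in> borel_measurable lborel \<and>
     (\<lambda>N. \<integral>\<^sup>+x\<in>{-pi..<pi}.
        ennreal ((cmod (g x - (\<Sum>u<N. c u * cis (of_int \<sigma> * of_nat u * x))))\<^sup>2) \<partial>lborel) \<longlonglongrightarrow> 0"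

text \<open>
  The canonical moving average representation. The series for \<open>z k j\<close> converges in mean square
  along finite subsets of its index set. By the last clause the \<open>\<epsilon> m 0\<close> form an orthonormal
  basis of the orthogonal complement of \<open>H(-1)\<close> in \<open>H(0)\<close>, so \<open>M\<close> is the multiplicity
  of the sequence; regularity is a consequence as well.
\<close>
definition canonical_moving_average ::
    "'w measure \<Rightarrow> (nat \<Rightarrow> int \<Rightarrow> 'w \<Rightarrow> complex) \<Rightarrow> enat \<Rightarrow> (nat \<Rightarrow> nat \<Rightarrow> nat \<Rightarrow> complex) \<Rightarrow>
     (nat \<Rightarrow> int \<Rightarrow> 'w \<Rightarrow> complex) \<Rightarrow> bool" where
  "canonical_moving_average \<Omega> z M d \<epsilon> \<longleftrightarrow>
     (\<forall>m u. enat m < M \<longrightarrow> sq_integrable \<Omega> (\<epsilon> m u)) \<and>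
     (\<forall>m n u v. enat m < M \<longrightarrow> enat n < M \<longrightarrow>
        ms_inner \<Omega> (\<epsilon> m u) (\<epsilon> n v) = (if m = n \<and> u = v then 1 else 0)) \<and>
     (\<forall>k j. ((\<lambda>F. ms_norm2 \<Omega> (\<lambda>w. z k j w - (\<Sum>(u, m)\<in>F. d (nat (j - u)) k m * \<epsilon> m u w))) \<longlongrightarrow> 0)
        (finite_subsets_at_top ({..j} \<times> {m. enat m < M}))) \<and>
     (\<lambda>k. ms_norm2 \<Omega> (z k 0)) summable_on UNIV \<and>
     ((\<lambda>(u, k, m). (cmod (d u k m))\<^sup>2) has_sum (\<Sum>\<^sub>\<infinity>k. ms_norm2 \<Omega> (z k 0)))
        (UNIV \<times> UNIV \<times> {m. enat m < M}) \<and>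
     (\<forall>n. closed_span \<Omega> {z k j |k j. j \<le> n} = closed_span \<Omega> {\<epsilon> m u |m u. enat m < M \<and> u \<le> n})"

definition canonical_factorization ::
    "'w measure \<Rightarrow> (nat \<Rightarrow> int \<Rightarrow> 'w \<Rightarrow> complex) \<Rightarrow> (real \<Rightarrow> nat \<Rightarrow> nat \<Rightarrow> complex) \<Rightarrow> enat \<Rightarrow>
     (nat \<Rightarrow> nat \<Rightarrow> nat \<Rightarrow> complex) \<Rightarrow> (real \<Rightarrow> nat \<Rightarrow> nat \<Rightarrow> complex) \<Rightarrow> bool" where
  "canonical_factorization \<Omega> z f M d P \<longleftrightarrow>
     (\<exists>\<epsilon>. canonical_moving_average \<Omega> z M d \<epsilon>) \<and>
     (\<forall>k m. enat m < M \<longrightarrow> fourier_L2 (\<lambda>u. d u k m) (- 1) (\<lambda>x. P x k m)) \<and>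
     (AE x in lborel. x \<in> {-pi..<pi} \<longrightarrow>
        (\<forall>k n. ((\<lambda>m. P x k m * cnj (P x n m)) has_sum f x k n) {m. enat m < M}))"

text \<open>
  The quadratic form \<open>b\<^sup>T F b\<close> (last factor conjugated) as the matrix product
  \<open>(b\<^sup>T F) b\<close>; it is infinite if one of the series diverges.
\<close>
definition quad_form :: "(nat \<Rightarrow> nat \<Rightarrow> complex) \<Rightarrow> (nat \<Rightarrow> complex) \<Rightarrow> ennreal" where
  "quad_form F b =
     (if (\<forall>n. summable (\<lambda>k. b k * F k n)) \<and> summable (\<lambda>n. (\<Sum>k. b k * F k n) * cnj (b n))
      then ennreal (Re (\<Sum>n. (\<Sum>k. b k * F k n) * cnj (b n))) else \<infinity>)"

definition L2f_norm2 :: "(real \<Rightarrow> nat \<Rightarrow> nat \<Rightarrow> complex) \<Rightarrow> (real \<Rightarrow> nat \<Rightarrow> complex) \<Rightarrow> ennreal" where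
  "L2f_norm2 f b = (\<integral>\<^sup>+x\<in>{-pi..<pi}. quad_form (f x) (b x) \<partial>lborel)"

definition L2f :: "(real \<Rightarrow> nat \<Rightarrow> nat \<Rightarrow> complex) \<Rightarrow> (real \<Rightarrow> nat \<Rightarrow> complex) set" where
  "L2f f = {b. (\<forall>k. (\<lambda>x. b x k) \<in> borel_measurable lborel) \<and> L2f_norm2 f b < \<infinity>}"

definition trig_vec :: "(int \<times> nat) set \<Rightarrow> (int \<times> nat \<Rightarrow> complex) \<Rightarrow> real \<Rightarrow> nat \<Rightarrow> complex" where
  "trig_vec F c x k = (\<Sum>(j, n)\<in>F. if n = k then c (j, n) * cis (of_int j * x) else 0)"

definition L2f_minus :: "(real \<Rightarrow> nat \<Rightarrow> nat \<Rightarrow> complex) \<Rightarrow> (real \<Rightarrow> nat \<Rightarrow> complex) set" where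
  "L2f_minus f = {h \<in> L2f f. \<forall>e>0. \<exists>F c. finite F \<and> F \<subseteq> {..<0} \<times> UNIV \<and>
     L2f_norm2 f (\<lambda>x k. h x k - trig_vec F c x k) < e}"

definition simple_vec :: "(real set \<times> nat \<times> complex) list \<Rightarrow> real \<Rightarrow> nat \<Rightarrow> complex" where
  "simple_vec xs x k = (\<Sum>(B, n, c)\<leftarrow>xs. if n = k then c * indicator B x else 0)"

definition simple_stoch_integral ::
    "(nat \<Rightarrow> real set \<Rightarrow> 'w \<Rightarrow> complex) \<Rightarrow> (real set \<times> nat \<times> complex) list \<Rightarrow> 'w \<Rightarrow> complex" where
  "simple_stoch_integral Z xs w = (\<Sum>(B, n, c)\<leftarrow>xs. c * Z n B w)"

text \<open>
  \<open>I = \<integral> b\<^sup>T(x) Z(dx) = \<integral> \<Sum>\<^sub>k b\<^sub>k(x) Z\<^sub>k(dx)\<close>, as the mean square limit of integrals of simple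
  functions that converge to \<open>b\<close> in \<open>L\<^sub>2(f)\<close>.
\<close>
definition has_stoch_integral ::
    "'w measure \<Rightarrow> (real \<Rightarrow> nat \<Rightarrow> nat \<Rightarrow> complex) \<Rightarrow> (nat \<Rightarrow> real set \<Rightarrow> 'w \<Rightarrow> complex) \<Rightarrow>
     (real \<Rightarrow> nat \<Rightarrow> complex) \<Rightarrow> ('w \<Rightarrow> complex) \<Rightarrow> bool" where
  "has_stoch_integral \<Omega> f Z b I \<longleftrightarrow> sq_integrable \<Omega> I \<and> b \<in> L2f f \<and>
     (\<exists>xs :: nat \<Rightarrow> (real set \<times> nat \<times> complex) list.
        (\<forall>r. \<forall>(B, n, c)\<in>set (xs r). B \<in> sets borel \<and> B \<subseteq> {-pi..<pi}) \<and>
        (\<lambda>r. L2f_norm2 f (\<lambda>x k. b x k - simple_vec (xs r) x k)) \<longlonglongrightarrow> 0 \<and>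
        (\<lambda>r. ms_norm2 \<Omega> (\<lambda>w. I w - simple_stoch_integral Z (xs r) w)) \<longlonglongrightarrow> 0)"

text \<open>
  The orthogonal stochastic measure of the sequence: its covariance structure (which implies
  orthogonality and additivity in mean square) and the spectral representation
  \<open>z\<^sub>k\<^sub>j = \<integral> exp(i j x) Z\<^sub>k(dx)\<close>.
\<close>
definition stochastic_measure ::
    "'w measure \<Rightarrow> (nat \<Rightarrow> int \<Rightarrow> 'w \<Rightarrow> complex) \<Rightarrow> (real \<Rightarrow> nat \<Rightarrow> nat \<Rightarrow> complex) \<Rightarrow>
     (nat \<Rightarrow> real set \<Rightarrow> 'w \<Rightarrow> complex) \<Rightarrow> bool" where
  "stochastic_measure \<Omega> z f Z \<longleftrightarrow>
     (\<forall>k. \<forall>B\<in>sets borel. B \<subseteq> {-pi..<pi} \<longrightarrow> sq_integrable \<Omega> (Z k B)) \<and>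
     (\<forall>k n. \<forall>B\<in>sets borel. \<forall>C\<in>sets borel. B \<subseteq> {-pi..<pi} \<longrightarrow> C \<subseteq> {-pi..<pi} \<longrightarrow>
        ms_inner \<Omega> (Z k B) (Z n C) =
          complex_of_real (1 / (2 * pi)) * (LINT x:B \<inter> C|lborel. f x k n)) \<and>
     (\<forall>k j. has_stoch_integral \<Omega> f Z (\<lambda>x n. if n = k then cis (of_int j * x) else 0) (z k j))"

definition linear_estimate ::
    "'w measure \<Rightarrow> (real \<Rightarrow> nat \<Rightarrow> nat \<Rightarrow> complex) \<Rightarrow> (nat \<Rightarrow> real set \<Rightarrow> 'w \<Rightarrow> complex) \<Rightarrow>
     (real \<Rightarrow> nat \<Rightarrow> complex) \<Rightarrow> ('w \<Rightarrow> complex) \<Rightarrow> bool" where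
  "linear_estimate \<Omega> f Z h Y \<longleftrightarrow> h \<in> L2f_minus f \<and> has_stoch_integral \<Omega> f Z h Y"

definition optimal_linear_estimate ::
    "'w measure \<Rightarrow> (real \<Rightarrow> nat \<Rightarrow> nat \<Rightarrow> complex) \<Rightarrow> (nat \<Rightarrow> real set \<Rightarrow> 'w \<Rightarrow> complex) \<Rightarrow>
     ('w \<Rightarrow> complex) \<Rightarrow> ('w \<Rightarrow> complex) \<Rightarrow> bool" where
  "optimal_linear_estimate \<Omega> f Z X Y \<longleftrightarrow> (\<exists>h. linear_estimate \<Omega> f Z h Y) \<and>
     (\<forall>g Y'. linear_estimate \<Omega> f Z g Y' \<longrightarrow>
        ms_norm2 \<Omega> (\<lambda>w. X w - Y w) \<le> ms_norm2 \<Omega> (\<lambda>w. X w - Y' w))"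

text \<open>\<open>mse f A h\<close> is \<open>\<Delta>(h; f)\<close>, written in the spectral domain.\<close>
definition mse ::
    "(real \<Rightarrow> nat \<Rightarrow> nat \<Rightarrow> complex) \<Rightarrow> (real \<Rightarrow> nat \<Rightarrow> complex) \<Rightarrow> (real \<Rightarrow> nat \<Rightarrow> complex) \<Rightarrow> ennreal" where
  "mse f A h = ennreal (1 / (2 * pi)) * L2f_norm2 f (\<lambda>x k. A x k - h x k)"

definition spectral_characteristic ::
    "(real \<Rightarrow> nat \<Rightarrow> nat \<Rightarrow> complex) \<Rightarrow> (real \<Rightarrow> nat \<Rightarrow> complex) \<Rightarrow> (real \<Rightarrow> nat \<Rightarrow> complex) \<Rightarrow> bool" where
  "spectral_characteristic f A h \<longleftrightarrow> h \<in> L2f_minus f \<and> (\<forall>g\<in>L2f_minus f. mse f A h \<le> mse f A g)"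

definition A_fun :: "real \<Rightarrow> (real \<Rightarrow> complex) \<Rightarrow> real \<Rightarrow> nat \<Rightarrow> complex" where
  "A_fun T a x k = (\<Sum>j. avec T a j k * cis (of_nat j * x))"

definition Ad :: "real \<Rightarrow> (real \<Rightarrow> complex) \<Rightarrow> (nat \<Rightarrow> nat \<Rightarrow> nat \<Rightarrow> complex) \<Rightarrow> nat \<Rightarrow> nat \<Rightarrow> complex" where
  \<comment> \<open>\<open>\<Sum>\<^sub>j\<^sub>\<ge>\<^sub>l a\<^sub>j\<^sup>T d(j - l)\<close>, summed over \<open>u = j - l\<close>\<close>
  "Ad T a d l m = (\<Sum>u. \<Sum>k. avec T a (l + u) k * d u k m)"

definition Ad_norm2 :: "real \<Rightarrow> (real \<Rightarrow> complex) \<Rightarrow> (nat \<Rightarrow> nat \<Rightarrow> nat \<Rightarrow> complex) \<Rightarrow> enat \<Rightarrow> nat \<Rightarrow> real" where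
  "Ad_norm2 T a d M l = (\<Sum>\<^sub>\<infinity>m\<in>{m. enat m < M}. (cmod (Ad T a d l m))\<^sup>2)"

end

theory Submission
  imports Defs
begin

text \<open>
  With \<open>Q P = I\<close>, the map \<open>b \<mapsto> b\<^sup>T P\<close> is an isometry of \<open>L\<^sub>2(f)\<close> into the space of
  square integrable \<open>M\<close>-vector functions of the frequency, and canonicity of the factorization says
  that the past, spanned by the functions \<open>e\<^sup>i\<^sup>j\<^sup>x \<delta>\<^sub>k\<close> with \<open>j < 0\<close>, is mapped onto a dense
  subspace of the functions whose frequencies are all negative. The image \<open>A\<^sup>T P\<close> of the functional
  has a part \<open>S\<close> with nonnegative frequencies and a part with negative frequencies; the former is
  orthogonal to the past and the latter is the image of \<open>A\<^sup>T - S Q\<close>. Hence \<open>A\<^sup>T - S Q\<close> is the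
  projection of \<open>A\<close> onto the past and the error is the squared norm of \<open>S\<close>. The minimality
  condition forces \<open>f\<close> to have finite rank almost everywhere, so that \<open>M\<close> is finite.
  That the functional itself corresponds to \<open>A\<close> is tested against an arbitrary \<open>W\<close> in
  \<open>L\<^sub>2(\<Omega>)\<close>, where it is a Parseval identity for an integrable function with square summable
  Fourier coefficients and a continuous one.
\<close>

section \<open>Square integrable functions\<close>

text \<open>Finiteness of \<open>M\<close> has to come first. The norm of
  \<open>L\<^sub>2(f)\<close> is an iterated series in coordinates, and its convergence speaks of
  \<open>b^T f\<close>, not of \<open>b^T P\<close>. With finitely many columns and a left inverse,
  the conjugated rows of \<open>P\<close> span all \<open>M\<close>-vectors, so convergence of
  \<open>b^T f\<close> forces that of \<open>b^T P\<close>; only then is the isometry defined on all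
  of \<open>L\<^sub>2(f)\<close>. Elements of \<open>L\<^sub>2\<close> are functions rather than
  classes, so the Hilbert space facts are stated for an arbitrary measure. They serve
  \<open>\<Omega>\<close>, the normalised interval of frequencies and \<open>M\<close> copies of
  that interval. Distances pass between these spaces through equality of Gram matrices. The limits
  on the frequency side rest on one pointwise bound: by Cauchy--Schwarz every square partial sum of
  \<open>A^T P\<close> in a channel is at most the sum of the norms of the \<open>a_j\<close> times
  the norm of that column of \<open>P\<close>, and the square of the latter is integrable because
  the variances of the coordinates are summable.\<close>

lemma borel_measurable_cnj [measurable]: "cnj \<in> borel_measurable borel"
  by (intro borel_measurable_continuous_onI continuous_intros)

lemma sq_integrable_mult_cnj:
  assumes "sq_integrable M X" "sq_integrable M Y"
  shows "integrable M (\<lambda>w. X w * cnj (Y w))"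
proof (rule Bochner_Integration.integrable_bound)
  show "integrable M (\<lambda>w. (cmod (X w))\<^sup>2 + (cmod (Y w))\<^sup>2)"
    using assms by (auto simp: sq_integrable_def)
  have [measurable]: "X \<in> borel_measurable M" "Y \<in> borel_measurable M"
    using assms by (auto simp: sq_integrable_def)
  show "(\<lambda>w. X w * cnj (Y w)) \<in> borel_measurable M" by measurable
  have "cmod (X w) * cmod (Y w) \<le> (cmod (X w))\<^sup>2 + (cmod (Y w))\<^sup>2" for w
    using sum_squares_bound[of "cmod (X w)" "cmod (Y w)"]
      mult_nonneg_nonneg[OF norm_ge_zero[of "X w"] norm_ge_zero[of "Y w"]]
    by (simp only: mult.assoc)
  then show "AE w in M. norm (X w * cnj (Y w)) \<le> norm ((cmod (X w))\<^sup>2 + (cmod (Y w))\<^sup>2)"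
    by (simp add: norm_mult)
qed

lemma sq_integrable_zero [simp]: "sq_integrable M (\<lambda>w. 0)"
  by (simp add: sq_integrable_def)

lemma sq_integrable_add:
  assumes "sq_integrable M X" "sq_integrable M Y"
  shows "sq_integrable M (\<lambda>w. X w + Y w)"
proof -
  have [measurable]: "X \<in> borel_measurable M" "Y \<in> borel_measurable M"
    using assms by (auto simp: sq_integrable_def)
  have "integrable M (\<lambda>w. (cmod (X w + Y w))\<^sup>2)"
  proof (rule Bochner_Integration.integrable_bound)
    show "integrable M (\<lambda>w. 2 * (cmod (X w))\<^sup>2 + 2 * (cmod (Y w))\<^sup>2)"
      using assms by (auto simp: sq_integrable_def)
    have "(cmod (X w + Y w))\<^sup>2 \<le> 2 * (cmod (X w))\<^sup>2 + 2 * (cmod (Y w))\<^sup>2" for w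
    proof -
      have "(cmod (X w + Y w))\<^sup>2 \<le> (cmod (X w) + cmod (Y w))\<^sup>2"
        by (simp add: norm_triangle_ineq power_mono)
      then show ?thesis
        using sum_squares_bound[of "cmod (X w)" "cmod (Y w)"] by (simp add: power2_sum)
    qed
    then show "AE w in M. norm ((cmod (X w + Y w))\<^sup>2) \<le> norm (2 * (cmod (X w))\<^sup>2 + 2 * (cmod (Y w))\<^sup>2)"
      by simp
  qed simp
  then show ?thesis by (simp add: sq_integrable_def)
qed

lemma sq_integrable_cmult:
  assumes "sq_integrable M X" shows "sq_integrable M (\<lambda>w. c * X w)"
  using assms by (auto simp: sq_integrable_def norm_mult power_mult_distrib)

lemma sq_integrable_diff:
  assumes "sq_integrable M X" "sq_integrable M Y"
  shows "sq_integrable M (\<lambda>w. X w - Y w)"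
  using sq_integrable_add[OF assms(1) sq_integrable_cmult[OF assms(2), of "-1"]] by simp

lemma sq_integrable_sum:
  assumes "\<And>i. i \<in> I \<Longrightarrow> sq_integrable M (X i)"
  shows "sq_integrable M (\<lambda>w. \<Sum>i\<in>I. X i w)"
  using assms by (induction I rule: infinite_finite_induct) (auto intro: sq_integrable_add)

lemma sq_integrable_bounded_mult:
  assumes "sq_integrable M X" "g \<in> borel_measurable M" "\<And>w. cmod (g w) \<le> C"
  shows "sq_integrable M (\<lambda>w. g w * X w)"
proof -
  have [measurable]: "X \<in> borel_measurable M" "g \<in> borel_measurable M"
    using assms by (auto simp: sq_integrable_def)
  have "integrable M (\<lambda>w. (cmod (g w * X w))\<^sup>2)"
  proof (rule Bochner_Integration.integrable_bound)
    show "integrable M (\<lambda>w. C\<^sup>2 * (cmod (X w))\<^sup>2)"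
      using assms by (auto simp: sq_integrable_def)
    have "(cmod (g w))\<^sup>2 \<le> C\<^sup>2" for w
      by (rule power_mono) (use assms(3) in auto)
    then show "AE w in M. norm ((cmod (g w * X w))\<^sup>2) \<le> norm (C\<^sup>2 * (cmod (X w))\<^sup>2)"
      by (simp add: norm_mult power_mult_distrib mult_right_mono)
  qed simp
  then show ?thesis by (simp add: sq_integrable_def)
qed

lemma (in finite_measure) sq_integrable_bounded:
  assumes "g \<in> borel_measurable M" "\<And>w. cmod (g w) \<le> C"
  shows "sq_integrable M g"
  using sq_integrable_bounded_mult[of M "\<lambda>w. 1" g C] assms by (simp add: sq_integrable_def)

lemma sq_integrable_cong_AE:
  assumes "sq_integrable M X" "Y \<in> borel_measurable M" "AE w in M. X w = Y w"
  shows "sq_integrable M Y"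
proof -
  have "integrable M (\<lambda>w. (cmod (X w))\<^sup>2) \<longleftrightarrow> integrable M (\<lambda>w. (cmod (Y w))\<^sup>2)"
    using assms by (intro integrable_cong_AE) (auto simp: sq_integrable_def)
  then show ?thesis using assms by (simp add: sq_integrable_def)
qed

lemma ms_norm2_cong_AE:
  assumes "AE w in M. X w = Y w" "X \<in> borel_measurable M" "Y \<in> borel_measurable M"
  shows "ms_norm2 M X = ms_norm2 M Y"
  unfolding ms_norm2_def using assms by (intro integral_cong_AE) auto

lemma ms_norm2_nonneg [simp]: "0 \<le> ms_norm2 M X"
  by (simp add: ms_norm2_def)

lemma nn_integral_cmod_sq:
  "sq_integrable M X \<Longrightarrow> (\<integral>\<^sup>+w. ennreal ((cmod (X w))\<^sup>2) \<partial>M) = ennreal (ms_norm2 M X)"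
  unfolding ms_norm2_def sq_integrable_def by (intro nn_integral_eq_integral) auto

lemma sq_integrableI_nn:
  assumes "X \<in> borel_measurable M" "(\<integral>\<^sup>+w. ennreal ((cmod (X w))\<^sup>2) \<partial>M) < \<infinity>"
  shows "sq_integrable M X"
  using assms unfolding sq_integrable_def by (auto intro!: integrableI_bounded)

lemma ms_inner_self: "ms_inner M X X = complex_of_real (ms_norm2 M X)"
  unfolding ms_inner_def ms_norm2_def complex_norm_square[symmetric] integral_complex_of_real ..

lemma ms_inner_cnj: "ms_inner M Y X = cnj (ms_inner M X Y)"
  by (simp add: ms_inner_def Bochner_Integration.integral_cnj[symmetric] mult.commute)

lemma ms_inner_cmult_left: "ms_inner M (\<lambda>w. c * X w) Y = c * ms_inner M X Y"
  by (simp add: ms_inner_def mult.assoc)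

lemma ms_inner_cmult_right: "ms_inner M X (\<lambda>w. c * Y w) = cnj c * ms_inner M X Y"
  by (simp add: ms_inner_def mult.left_commute)

lemma ms_inner_zero [simp]: "ms_inner M (\<lambda>w. 0) Y = 0" "ms_inner M X (\<lambda>w. 0) = 0"
  by (simp_all add: ms_inner_def)

lemma ms_inner_add_left:
  assumes "sq_integrable M X" "sq_integrable M Y" "sq_integrable M W"
  shows "ms_inner M (\<lambda>w. X w + Y w) W = ms_inner M X W + ms_inner M Y W"
  using assms by (simp add: ms_inner_def distrib_right sq_integrable_mult_cnj)

lemma ms_inner_add_right:
  assumes "sq_integrable M X" "sq_integrable M Y" "sq_integrable M W"
  shows "ms_inner M W (\<lambda>w. X w + Y w) = ms_inner M W X + ms_inner M W Y"
  using assms by (simp add: ms_inner_def distrib_left sq_integrable_mult_cnj)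

lemma ms_inner_diff_left:
  assumes "sq_integrable M X" "sq_integrable M Y" "sq_integrable M W"
  shows "ms_inner M (\<lambda>w. X w - Y w) W = ms_inner M X W - ms_inner M Y W"
  using assms by (simp add: ms_inner_def left_diff_distrib sq_integrable_mult_cnj)

lemma ms_inner_diff_right:
  assumes "sq_integrable M X" "sq_integrable M Y" "sq_integrable M W"
  shows "ms_inner M W (\<lambda>w. X w - Y w) = ms_inner M W X - ms_inner M W Y"
  using assms by (simp add: ms_inner_def right_diff_distrib sq_integrable_mult_cnj)

lemma ms_inner_sum_left:
  assumes "\<And>i. i \<in> I \<Longrightarrow> sq_integrable M (X i)" "sq_integrable M W"
  shows "ms_inner M (\<lambda>w. \<Sum>i\<in>I. X i w) W = (\<Sum>i\<in>I. ms_inner M (X i) W)"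
  using assms
  by (induction I rule: infinite_finite_induct) (auto simp: ms_inner_add_left sq_integrable_sum)

lemma ms_inner_sum_right:
  assumes "\<And>i. i \<in> I \<Longrightarrow> sq_integrable M (X i)" "sq_integrable M W"
  shows "ms_inner M W (\<lambda>w. \<Sum>i\<in>I. X i w) = (\<Sum>i\<in>I. ms_inner M W (X i))"
  using assms
  by (induction I rule: infinite_finite_induct) (auto simp: ms_inner_add_right sq_integrable_sum)

lemma ms_norm2_cmult: "ms_norm2 M (\<lambda>w. c * X w) = (cmod c)\<^sup>2 * ms_norm2 M X"
  by (simp add: ms_norm2_def norm_mult power_mult_distrib)

lemma ms_norm2_zero [simp]: "ms_norm2 M (\<lambda>w. 0) = 0"
  by (simp add: ms_norm2_def)

lemma ms_norm2_minus_commute: "ms_norm2 M (\<lambda>w. X w - Y w) = ms_norm2 M (\<lambda>w. Y w - X w)"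
  by (simp add: ms_norm2_def norm_minus_commute)

lemma ms_norm2_diff_expand:
  assumes "sq_integrable M X" "sq_integrable M Y"
  shows "ms_norm2 M (\<lambda>w. X w - Y w) = ms_norm2 M X - 2 * Re (ms_inner M X Y) + ms_norm2 M Y"
proof -
  have "complex_of_real (ms_norm2 M (\<lambda>w. X w - Y w)) =
      ms_inner M X X - ms_inner M X Y - (ms_inner M Y X - ms_inner M Y Y)"
    using assms by (simp add: ms_inner_self[symmetric] ms_inner_diff_left ms_inner_diff_right sq_integrable_diff)
  then show ?thesis
    by (auto simp: ms_inner_self ms_inner_cnj[of M Y X] complex_eq_iff)
qed

lemma ms_norm2_add_expand:
  assumes "sq_integrable M X" "sq_integrable M Y"
  shows "ms_norm2 M (\<lambda>w. X w + Y w) = ms_norm2 M X + 2 * Re (ms_inner M X Y) + ms_norm2 M Y"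
proof -
  have "complex_of_real (ms_norm2 M (\<lambda>w. X w + Y w)) =
      ms_inner M X X + ms_inner M X Y + (ms_inner M Y X + ms_inner M Y Y)"
    using assms by (simp add: ms_inner_self[symmetric] ms_inner_add_left ms_inner_add_right sq_integrable_add)
  then show ?thesis
    by (auto simp: ms_inner_self ms_inner_cnj[of M Y X] complex_eq_iff)
qed

lemma ms_Cauchy_Schwarz:
  assumes "sq_integrable M X" "sq_integrable M Y"
  shows "(cmod (ms_inner M X Y))\<^sup>2 \<le> ms_norm2 M X * ms_norm2 M Y"
proof -
  define p where "p = ms_inner M X Y"
  \<comment> \<open>The factor \<open>p\<close> in the multiplier of \<open>Y\<close> turns the
    cross term into the real number \<open>t |p|^2\<close>, so a real quadratic in \<open>t\<close>
    remains.\<close>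
  have quad: "0 \<le> ms_norm2 M X - 2 * t * (cmod p)\<^sup>2 + t\<^sup>2 * (cmod p)\<^sup>2 * ms_norm2 M Y" for t :: real
  proof -
    have "0 \<le> ms_norm2 M (\<lambda>w. X w - (of_real t * p) * Y w)" by simp
    also have "\<dots> = ms_norm2 M X - 2 * Re (cnj (of_real t * p) * p) + (cmod (of_real t * p))\<^sup>2 * ms_norm2 M Y"
      using assms by (simp add: ms_norm2_diff_expand sq_integrable_cmult ms_norm2_cmult
          ms_inner_cmult_right p_def)
    also have "cnj (of_real t * p) * p = of_real (t * (cmod p)\<^sup>2)"
      by (simp only: complex_cnj_mult complex_cnj_complex_of_real of_real_mult complex_norm_square ac_simps)
    finally show ?thesis by (simp add: norm_mult power_mult_distrib)
  qed
  show ?thesis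
  proof (cases "ms_norm2 M Y = 0")
    case True
    have "p = 0"
    proof (rule ccontr)
      assume "p \<noteq> 0"
      then have "0 < (cmod p)\<^sup>2" by simp
      \<comment> \<open>For a null \<open>Y\<close> the quadratic is affine in \<open>t\<close>;
        this \<open>t\<close> would make it negative.\<close>
      moreover have "0 \<le> ms_norm2 M X - 2 * ((ms_norm2 M X + 1) / (cmod p)\<^sup>2) * (cmod p)\<^sup>2"
        using quad[of "(ms_norm2 M X + 1) / (cmod p)\<^sup>2"] True by simp
      ultimately have "0 \<le> ms_norm2 M X - 2 * (ms_norm2 M X + 1)" by simp
      then show False using ms_norm2_nonneg[of M X] by (simp add: algebra_simps)
    qed
    then show ?thesis by (simp add: p_def)
  next
    case False
    then have pos: "0 < ms_norm2 M Y" using ms_norm2_nonneg[of M Y] by linarith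
    have "0 \<le> ms_norm2 M X - (cmod p)\<^sup>2 / ms_norm2 M Y"
      using quad[of "1 / ms_norm2 M Y"] pos by (simp add: power2_eq_square field_simps)
    then show ?thesis using pos by (simp add: p_def field_simps)
  qed
qed

lemma ms_inner_le:
  assumes "sq_integrable M X" "sq_integrable M Y"
  shows "cmod (ms_inner M X Y) \<le> sqrt (ms_norm2 M X) * sqrt (ms_norm2 M Y)"
  using real_sqrt_le_mono[OF ms_Cauchy_Schwarz[OF assms]] by (simp add: real_sqrt_mult)

lemma ms_norm_triangle:
  assumes "sq_integrable M X" "sq_integrable M Y"
  shows "sqrt (ms_norm2 M (\<lambda>w. X w + Y w)) \<le> sqrt (ms_norm2 M X) + sqrt (ms_norm2 M Y)"
proof (rule real_le_lsqrt)
  have "Re (ms_inner M X Y) \<le> sqrt (ms_norm2 M X) * sqrt (ms_norm2 M Y)"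
    using ms_inner_le[OF assms] complex_Re_le_cmod order_trans by blast
  then show "ms_norm2 M (\<lambda>w. X w + Y w) \<le> (sqrt (ms_norm2 M X) + sqrt (ms_norm2 M Y))\<^sup>2"
    using assms by (simp add: ms_norm2_add_expand power2_sum)
qed simp

lemma ms_norm_diff_le:
  assumes "sq_integrable M X" "sq_integrable M Y" "sq_integrable M W"
  shows "sqrt (ms_norm2 M (\<lambda>w. X w - W w)) \<le>
    sqrt (ms_norm2 M (\<lambda>w. X w - Y w)) + sqrt (ms_norm2 M (\<lambda>w. Y w - W w))"
  using ms_norm_triangle[OF sq_integrable_diff[OF assms(1,2)] sq_integrable_diff[OF assms(2,3)]] by simp

lemma ms_norm2_add_le:
  assumes "sq_integrable M X" "sq_integrable M Y"
  shows "ms_norm2 M (\<lambda>w. X w + Y w) \<le> 2 * ms_norm2 M X + 2 * ms_norm2 M Y"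
proof -
  have "0 \<le> ms_norm2 M (\<lambda>w. X w - Y w)" by simp
  then show ?thesis
    unfolding ms_norm2_diff_expand[OF assms] ms_norm2_add_expand[OF assms] by linarith
qed

text \<open>A general filter, since limits occur along sequences, along finite subsets of an index
  set and at a point of the time axis.\<close>

abbreviation ms_tendsto :: "'w measure \<Rightarrow> ('i \<Rightarrow> 'w \<Rightarrow> complex) \<Rightarrow> ('w \<Rightarrow> complex) \<Rightarrow> 'i filter \<Rightarrow> bool" where
  "ms_tendsto M X Y F \<equiv> ((\<lambda>r. ms_norm2 M (\<lambda>w. Y w - X r w)) \<longlongrightarrow> 0) F"

lemma ms_tendsto_add:
  assumes "ms_tendsto M X Y F" "ms_tendsto M X' Y' F"
    and "\<And>r. sq_integrable M (X r)" "\<And>r. sq_integrable M (X' r)" "sq_integrable M Y" "sq_integrable M Y'"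
  shows "ms_tendsto M (\<lambda>r w. X r w + X' r w) (\<lambda>w. Y w + Y' w) F"
proof (rule tendsto_sandwich[OF always_eventually always_eventually tendsto_const])
  show "((\<lambda>r. 2 * ms_norm2 M (\<lambda>w. Y w - X r w) + 2 * ms_norm2 M (\<lambda>w. Y' w - X' r w)) \<longlongrightarrow> 0) F"
    using tendsto_add[OF tendsto_mult_left[OF assms(1), of 2] tendsto_mult_left[OF assms(2), of 2]] by simp
  show "\<forall>r. ms_norm2 M (\<lambda>w. Y w + Y' w - (X r w + X' r w))
      \<le> 2 * ms_norm2 M (\<lambda>w. Y w - X r w) + 2 * ms_norm2 M (\<lambda>w. Y' w - X' r w)"
  proof
    fix r
    show "ms_norm2 M (\<lambda>w. Y w + Y' w - (X r w + X' r w))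
      \<le> 2 * ms_norm2 M (\<lambda>w. Y w - X r w) + 2 * ms_norm2 M (\<lambda>w. Y' w - X' r w)"
      using ms_norm2_add_le[of M "\<lambda>w. Y w - X r w" "\<lambda>w. Y' w - X' r w"] assms(3-)
      by (simp add: algebra_simps sq_integrable_diff)
  qed
qed simp

lemma ms_tendsto_cmult:
  assumes "ms_tendsto M X Y F"
  shows "ms_tendsto M (\<lambda>r w. c * X r w) (\<lambda>w. c * Y w) F"
  using tendsto_mult_left[OF assms, of "(cmod c)\<^sup>2"]
  by (simp add: right_diff_distrib[symmetric] ms_norm2_cmult)

lemma ms_tendsto_inner:
  assumes "ms_tendsto M X Y F" "\<And>r. sq_integrable M (X r)" "sq_integrable M Y" "sq_integrable M W"
  shows "((\<lambda>r. ms_inner M (X r) W) \<longlongrightarrow> ms_inner M Y W) F"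
proof (rule Lim_transform2[OF tendsto_const])
  show "((\<lambda>r. ms_inner M Y W - ms_inner M (X r) W) \<longlongrightarrow> 0) F"
  proof (rule Lim_null_comparison[OF always_eventually])
    show "\<forall>r. norm (ms_inner M Y W - ms_inner M (X r) W)
        \<le> sqrt (ms_norm2 M (\<lambda>w. Y w - X r w)) * sqrt (ms_norm2 M W)"
      using assms by (auto simp: ms_inner_diff_left[symmetric] intro!: ms_inner_le sq_integrable_diff)
    show "((\<lambda>r. sqrt (ms_norm2 M (\<lambda>w. Y w - X r w)) * sqrt (ms_norm2 M W)) \<longlongrightarrow> 0) F"
      using tendsto_mult_right[OF tendsto_real_sqrt[OF assms(1)], of "sqrt (ms_norm2 M W)"] by simp
  qed
qed

lemma ms_tendsto_norm2:
  assumes "ms_tendsto M X Y F" "\<And>r. sq_integrable M (X r)" "sq_integrable M Y"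
  shows "((\<lambda>r. ms_norm2 M (X r)) \<longlongrightarrow> ms_norm2 M Y) F"
proof -
  have "((\<lambda>r. sqrt (ms_norm2 M (X r))) \<longlongrightarrow> sqrt (ms_norm2 M Y)) F"
  proof (rule Lim_transform2[OF tendsto_const])
    show "((\<lambda>r. sqrt (ms_norm2 M Y) - sqrt (ms_norm2 M (X r))) \<longlongrightarrow> 0) F"
    proof (rule Lim_null_comparison[OF always_eventually])
      show "((\<lambda>r. sqrt (ms_norm2 M (\<lambda>w. Y w - X r w))) \<longlongrightarrow> 0) F"
        using tendsto_real_sqrt[OF assms(1)] by simp
      show "\<forall>r. norm (sqrt (ms_norm2 M Y) - sqrt (ms_norm2 M (X r))) \<le> sqrt (ms_norm2 M (\<lambda>w. Y w - X r w))"
      proof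
        fix r
        show "norm (sqrt (ms_norm2 M Y) - sqrt (ms_norm2 M (X r))) \<le> sqrt (ms_norm2 M (\<lambda>w. Y w - X r w))"
          using ms_norm_diff_le[OF assms(3) assms(2)[of r] sq_integrable_zero]
            ms_norm_diff_le[OF assms(2)[of r] assms(3) sq_integrable_zero]
          by (simp add: ms_norm2_minus_commute[of M "X r" Y])
      qed
    qed
  qed
  from tendsto_power[OF this, of 2] show ?thesis by simp
qed

text \<open>Riesz--Fischer. A subsequence with consecutive squared distances below
  \<open>(1/4)^k\<close> converges almost everywhere, and Fatou's lemma transfers the Cauchy
  estimate of the whole sequence to the limit.\<close>

lemma ms_complete:
  fixes X :: "nat \<Rightarrow> 'w \<Rightarrow> complex"
  assumes sq: "\<And>n. sq_integrable M (X n)"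
    and cauchy: "\<And>e. e > 0 \<Longrightarrow> \<exists>N. \<forall>m\<ge>N. \<forall>n\<ge>N. ms_norm2 M (\<lambda>w. X m w - X n w) < e"
  shows "\<exists>Y. sq_integrable M Y \<and> ms_tendsto M X Y sequentially"
proof -
  have [measurable]: "X n \<in> borel_measurable M" for n using sq by (auto simp: sq_integrable_def)
  have "\<exists>N. \<forall>m\<ge>N. \<forall>n\<ge>N. ms_norm2 M (\<lambda>w. X m w - X n w) < (1/4) ^ k" for k :: nat
    by (rule cauchy) simp
  then obtain N where N: "\<And>k m n. m \<ge> N k \<Longrightarrow> n \<ge> N k \<Longrightarrow> ms_norm2 M (\<lambda>w. X m w - X n w) < (1/4) ^ k"
    by metis
  \<comment> \<open>The sum makes \<open>r\<close> increasing and at least \<open>N k\<close>; the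
    summand \<open>k\<close> makes it tend to infinity.\<close>
  define r where "r k = (\<Sum>i\<le>k. N i) + k" for k
  have rN: "N k \<le> r k" for k
    unfolding r_def using member_le_sum[of k "{..k}" N] by simp
  have rmono: "r k \<le> r (Suc k)" for k by (simp add: r_def)
  have rge: "k \<le> r k" for k by (simp add: r_def)
  define D where "D k w = cmod (X (r (Suc k)) w - X (r k) w)" for k w
  have Dmeas [measurable]: "D k \<in> borel_measurable M" for k unfolding D_def by measurable
  have Dint: "(\<integral>\<^sup>+w. ennreal ((D k w)\<^sup>2) \<partial>M) \<le> ennreal ((1/4) ^ k)" for k
    unfolding D_def
    by (subst nn_integral_cmod_sq[OF sq_integrable_diff[OF sq sq]])
       (intro ennreal_leI less_imp_le N order_trans[OF rN rmono] rN)
  \<comment> \<open>The weight \<open>2^k\<close> keeps the integrals summable, since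
    \<open>2^k (1/4)^k = (1/2)^k\<close>. It also controls the increments themselves:
    \<open>t <= 1 + t^2\<close> with \<open>t = 2^k D\<close> gives
    \<open>D <= (1/2)^k + 2^k D^2\<close>.\<close>
  have "(\<integral>\<^sup>+w. (\<Sum>k. ennreal (2 ^ k * (D k w)\<^sup>2)) \<partial>M) = (\<Sum>k. \<integral>\<^sup>+w. ennreal (2 ^ k * (D k w)\<^sup>2) \<partial>M)"
    by (intro nn_integral_suminf) simp
  also have "\<dots> = (\<Sum>k. ennreal (2 ^ k) * (\<integral>\<^sup>+w. ennreal ((D k w)\<^sup>2) \<partial>M))"
    by (simp add: ennreal_mult nn_integral_cmult)
  also have "\<dots> \<le> (\<Sum>k. ennreal (2 ^ k) * ennreal ((1/4) ^ k))"
    by (intro suminf_le mult_left_mono Dint) auto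
  also have "\<dots> = (\<Sum>k. ennreal ((1/2) ^ k))"
    by (intro suminf_cong) (simp add: ennreal_mult[symmetric] power_mult_distrib[symmetric])
  also have "\<dots> < \<infinity>"
    by (subst suminf_ennreal2) (auto intro: summable_geometric)
  finally have "AE w in M. (\<Sum>k. ennreal (2 ^ k * (D k w)\<^sup>2)) \<noteq> \<infinity>"
    by (intro nn_integral_noteq_infinite) auto
  then have conv: "AE w in M. convergent (\<lambda>k. X (r k) w)"
  proof eventually_elim
    case (elim w)
    have s1: "summable (\<lambda>k. 2 ^ k * (D k w)\<^sup>2)"
      using elim by (intro summable_suminf_not_top) auto
    have "summable (\<lambda>k. D k w)"
    proof (rule summable_comparison_test')
      show "summable (\<lambda>k. (1/2) ^ k + 2 ^ k * (D k w)\<^sup>2)"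
        by (intro summable_add s1 summable_geometric) simp
      fix k :: nat
      have "2 * (1 * (2 ^ k * D k w)) \<le> 1 + (2 ^ k * D k w)\<^sup>2"
        using sum_squares_bound[of 1 "2 ^ k * D k w"] by simp
      moreover have "0 \<le> D k w" "0 \<le> 2 ^ k * D k w" by (simp_all add: D_def)
      ultimately have "2 ^ k * D k w \<le> 1 + (2 ^ k * D k w)\<^sup>2"
        unfolding mult_1 by argo
      then have "2 ^ k * D k w \<le> 2 ^ k * ((1/2) ^ k + 2 ^ k * (D k w)\<^sup>2)"
        by (simp add: power2_eq_square algebra_simps power_one_over)
      then show "norm (D k w) \<le> (1/2) ^ k + 2 ^ k * (D k w)\<^sup>2"
        using \<open>0 \<le> D k w\<close> by simp
    qed
    then have "summable (\<lambda>k. X (r (Suc k)) w - X (r k) w)"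
      unfolding D_def by (rule summable_norm_cancel)
    then have "convergent (\<lambda>n. \<Sum>k<n. (X (r (Suc k)) w - X (r k) w))"
      by (simp add: summable_iff_convergent)
    then have "convergent (\<lambda>n. (X (r n) w - X (r 0) w) + X (r 0) w)"
      by (subst (asm) sum_lessThan_telescope) (rule convergent_add[OF _ convergent_const])
    then show ?case by simp
  qed
  define Y where "Y w = lim (\<lambda>k. X (r k) w)" for w
  have [measurable]: "Y \<in> borel_measurable M" unfolding Y_def by measurable
  have lim: "AE w in M. (\<lambda>k. X (r k) w) \<longlonglongrightarrow> Y w"
    using conv by eventually_elim (simp add: Y_def convergent_LIMSEQ_iff)
  have bound: "(\<integral>\<^sup>+w. ennreal ((cmod (Y w - X n w))\<^sup>2) \<partial>M) \<le> ennreal ((1/4) ^ k)" if n: "n \<ge> N k" for n k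
  proof -
    have "(\<integral>\<^sup>+w. ennreal ((cmod (Y w - X n w))\<^sup>2) \<partial>M) =
        (\<integral>\<^sup>+w. liminf (\<lambda>i. ennreal ((cmod (X (r i) w - X n w))\<^sup>2)) \<partial>M)"
    proof (rule nn_integral_cong_AE)
      show "AE w in M. ennreal ((cmod (Y w - X n w))\<^sup>2) = liminf (\<lambda>i. ennreal ((cmod (X (r i) w - X n w))\<^sup>2))"
        using lim
      proof eventually_elim
        case (elim w)
        have "(\<lambda>i. ennreal ((cmod (X (r i) w - X n w))\<^sup>2)) \<longlonglongrightarrow> ennreal ((cmod (Y w - X n w))\<^sup>2)"
          by (intro tendsto_ennrealI tendsto_intros elim)
        then show ?case by (rule lim_imp_Liminf[OF sequentially_bot, symmetric])
      qed
    qed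
    also have "\<dots> \<le> liminf (\<lambda>i. \<integral>\<^sup>+w. ennreal ((cmod (X (r i) w - X n w))\<^sup>2) \<partial>M)"
      by (rule nn_integral_liminf) measurable
    also have "\<dots> \<le> liminf (\<lambda>i. ennreal ((1/4) ^ k))"
    proof (rule Liminf_mono)
      show "\<forall>\<^sub>F i in sequentially. (\<integral>\<^sup>+w. ennreal ((cmod (X (r i) w - X n w))\<^sup>2) \<partial>M) \<le> ennreal ((1/4) ^ k)"
        unfolding eventually_sequentially
      proof (intro exI allI impI)
        fix i assume "N k \<le> i"
        then have "ms_norm2 M (\<lambda>w. X (r i) w - X n w) < (1/4) ^ k"
          using N n rge[of i] by simp
        then show "(\<integral>\<^sup>+w. ennreal ((cmod (X (r i) w - X n w))\<^sup>2) \<partial>M) \<le> ennreal ((1/4) ^ k)"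
          by (subst nn_integral_cmod_sq[OF sq_integrable_diff[OF sq sq]]) (simp add: ennreal_leI)
      qed
    qed
    finally show ?thesis by (simp add: Liminf_const)
  qed
  have sqd: "sq_integrable M (\<lambda>w. Y w - X n w)" if "n \<ge> N 0" for n
    by (intro sq_integrableI_nn le_less_trans[OF bound[OF that]]) auto
  have sqY: "sq_integrable M Y"
    using sq_integrable_add[OF sqd[OF order_refl] sq[of "N 0"]] by simp
  have "ms_tendsto M X Y sequentially"
  proof (rule LIMSEQ_I)
    fix e :: real assume "0 < e"
    then obtain k :: nat where k: "(1/4) ^ k < e"
      using real_arch_pow_inv[of e "1/4"] by auto
    show "\<exists>n0. \<forall>n\<ge>n0. norm (ms_norm2 M (\<lambda>w. Y w - X n w) - 0) < e"
    proof (intro exI allI impI)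
      fix n assume "N k \<le> n"
      then have "ennreal (ms_norm2 M (\<lambda>w. Y w - X n w)) \<le> ennreal ((1/4) ^ k)"
        using bound[of k n] by (simp add: nn_integral_cmod_sq sq_integrable_diff[OF sqY sq])
      then show "norm (ms_norm2 M (\<lambda>w. Y w - X n w) - 0) < e"
        using k by (simp add: ennreal_le_iff)
    qed
  qed
  with sqY show ?thesis by blast
qed

subsection \<open>Closed spans\<close>

lemma closed_span_sq: "Y \<in> closed_span M G \<Longrightarrow> sq_integrable M Y"
  by (simp add: closed_span_def)

lemma closed_span_approx:
  assumes "Y \<in> closed_span M G" "e > 0"
  obtains F c where "finite F" "F \<subseteq> G" "ms_norm2 M (\<lambda>w. Y w - (\<Sum>X\<in>F. c X * X w)) < e"
proof -
  have "\<exists>F c. finite F \<and> F \<subseteq> G \<and> ms_norm2 M (\<lambda>w. Y w - (\<Sum>X\<in>F. c X * X w)) < e"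
    using assms by (simp add: closed_span_def)
  then show thesis by (elim exE conjE) (rule that)
qed

lemma closed_span_base:
  assumes "X \<in> G" "sq_integrable M X" shows "X \<in> closed_span M G"
  unfolding closed_span_def
proof (intro CollectI conjI allI impI assms(2))
  fix e :: real assume "e > 0"
  then show "\<exists>F c. finite F \<and> F \<subseteq> G \<and> ms_norm2 M (\<lambda>w. X w - (\<Sum>X\<in>F. c X * X w)) < e"
    using assms(1) by (intro exI[of _ "{X}"] exI[of _ "\<lambda>_. 1"]) simp
qed

lemma closed_span_mono:
  assumes "G \<subseteq> H" shows "closed_span M G \<subseteq> closed_span M H"
proof
  fix Y assume Y: "Y \<in> closed_span M G"
  show "Y \<in> closed_span M H"
    unfolding closed_span_def
  proof (intro CollectI conjI allI impI closed_span_sq[OF Y])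
    fix e :: real assume "e > 0"
    from closed_span_approx[OF Y this] obtain F c
      where "finite F" "F \<subseteq> G" "ms_norm2 M (\<lambda>w. Y w - (\<Sum>X\<in>F. c X * X w)) < e" .
    then show "\<exists>F c. finite F \<and> F \<subseteq> H \<and> ms_norm2 M (\<lambda>w. Y w - (\<Sum>X\<in>F. c X * X w)) < e"
      using assms by (intro exI[of _ F] exI[of _ c]) simp
  qed
qed

lemma closed_span_lincomb:
  assumes G: "\<And>X. X \<in> G \<Longrightarrow> sq_integrable M X" and F: "finite F" "F \<subseteq> G"
  shows "sq_integrable M (\<lambda>w. \<Sum>X\<in>F. c X * X w)"
  using assms by (intro sq_integrable_sum sq_integrable_cmult) auto

lemma closed_span_add:
  assumes G: "\<And>X. X \<in> G \<Longrightarrow> sq_integrable M X"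
    and Y: "Y \<in> closed_span M G" "Y' \<in> closed_span M G"
  shows "(\<lambda>w. Y w + Y' w) \<in> closed_span M G"
  unfolding closed_span_def
proof (intro CollectI conjI allI impI)
  show "sq_integrable M (\<lambda>w. Y w + Y' w)"
    using Y by (intro sq_integrable_add closed_span_sq)
  fix e :: real assume "e > 0"
  \<comment> \<open>Squared norms only satisfy \<open>|x + y|^2 <= 2 |x|^2 + 2 |y|^2\<close>, hence
    quarters of \<open>e\<close>.\<close>
  then have "e / 4 > 0" by simp
  from closed_span_approx[OF Y(1) this] obtain F c
    where F: "finite F" "F \<subseteq> G" "ms_norm2 M (\<lambda>w. Y w - (\<Sum>X\<in>F. c X * X w)) < e / 4" .
  from closed_span_approx[OF Y(2) \<open>e / 4 > 0\<close>] obtain F' c'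
    where F': "finite F'" "F' \<subseteq> G" "ms_norm2 M (\<lambda>w. Y' w - (\<Sum>X\<in>F'. c' X * X w)) < e / 4" .
  \<comment> \<open>Combinations are indexed by the vectors themselves, so a vector that occurs in
    both sets receives the sum of its two coefficients.\<close>
  define b where "b X = (if X \<in> F then c X else 0) + (if X \<in> F' then c' X else 0)" for X
  have b: "(\<Sum>X\<in>F \<union> F'. b X * X w) = (\<Sum>X\<in>F. c X * X w) + (\<Sum>X\<in>F'. c' X * X w)" for w
  proof -
    have "(\<Sum>X\<in>F \<union> F'. b X * X w) = (\<Sum>X\<in>F \<union> F'. if X \<in> F then c X * X w else 0)
        + (\<Sum>X\<in>F \<union> F'. if X \<in> F' then c' X * X w else 0)"
      unfolding sum.distrib[symmetric] by (intro sum.cong) (auto simp: b_def algebra_simps)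
    also have "\<dots> = (\<Sum>X\<in>F. c X * X w) + (\<Sum>X\<in>F'. c' X * X w)"
      by (intro arg_cong2[of _ _ _ _ "(+)"] sum.mono_neutral_cong_right) (use F(1) F'(1) in auto)
    finally show ?thesis .
  qed
  have "ms_norm2 M (\<lambda>w. Y w + Y' w - (\<Sum>X\<in>F \<union> F'. b X * X w)) =
      ms_norm2 M (\<lambda>w. (Y w - (\<Sum>X\<in>F. c X * X w)) + (Y' w - (\<Sum>X\<in>F'. c' X * X w)))"
    unfolding b add_diff_add ..
  also have "\<dots> \<le> 2 * ms_norm2 M (\<lambda>w. Y w - (\<Sum>X\<in>F. c X * X w)) + 2 * ms_norm2 M (\<lambda>w. Y' w - (\<Sum>X\<in>F'. c' X * X w))"
    by (intro ms_norm2_add_le sq_integrable_diff closed_span_lincomb[where G=G] G closed_span_sq[OF Y(1)]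
        closed_span_sq[OF Y(2)] F(1,2) F'(1,2))
  also have "\<dots> < e" using F F' by linarith
  finally show "\<exists>F c. finite F \<and> F \<subseteq> G \<and> ms_norm2 M (\<lambda>w. Y w + Y' w - (\<Sum>X\<in>F. c X * X w)) < e"
    using F F' by (intro exI[of _ "F \<union> F'"] exI[of _ b]) auto
qed

lemma closed_span_cmult:
  assumes Y: "Y \<in> closed_span M G"
  shows "(\<lambda>w. a * Y w) \<in> closed_span M G"
  unfolding closed_span_def
proof (intro CollectI conjI allI impI)
  show "sq_integrable M (\<lambda>w. a * Y w)"
    using Y by (intro sq_integrable_cmult closed_span_sq)
  fix e :: real assume "e > 0"
  \<comment> \<open>The added 1 allows division by \<open>k\<close> even if
    \<open>a = 0\<close>.\<close>
  define k where "k = (cmod a)\<^sup>2 + 1"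
  have k: "k > 0" "(cmod a)\<^sup>2 < k" by (auto simp: k_def add_nonneg_pos)
  then have "e / k > 0" using \<open>e > 0\<close> by simp
  from closed_span_approx[OF Y this] obtain F c
    where F: "finite F" "F \<subseteq> G" "ms_norm2 M (\<lambda>w. Y w - (\<Sum>X\<in>F. c X * X w)) < e / k" .
  have "ms_norm2 M (\<lambda>w. a * Y w - (\<Sum>X\<in>F. a * c X * X w)) = (cmod a)\<^sup>2 * ms_norm2 M (\<lambda>w. Y w - (\<Sum>X\<in>F. c X * X w))"
    by (simp add: ms_norm2_cmult[symmetric] right_diff_distrib sum_distrib_left mult.assoc)
  also have "\<dots> \<le> k * ms_norm2 M (\<lambda>w. Y w - (\<Sum>X\<in>F. c X * X w))"
    using k by (intro mult_right_mono) auto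
  also have "\<dots> < e" using F k by (simp add: field_simps)
  finally show "\<exists>F c. finite F \<and> F \<subseteq> G \<and> ms_norm2 M (\<lambda>w. a * Y w - (\<Sum>X\<in>F. c X * X w)) < e"
    using F by (intro exI[of _ F] exI[of _ "\<lambda>X. a * c X"]) auto
qed

lemma closed_span_zero: "(\<lambda>w. 0) \<in> closed_span M G"
proof -
  have "\<exists>F c. finite F \<and> F \<subseteq> G \<and> ms_norm2 M (\<lambda>w. 0 - (\<Sum>X\<in>F. c X * X w)) < e" if "e > 0" for e
    using that by (intro exI[of _ "{}"]) simp
  then show ?thesis by (simp add: closed_span_def)
qed

lemma closed_span_sum:
  assumes G: "\<And>X. X \<in> G \<Longrightarrow> sq_integrable M X"
    and Y: "\<And>i. i \<in> I \<Longrightarrow> Y i \<in> closed_span M G"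
  shows "(\<lambda>w. \<Sum>i\<in>I. Y i w) \<in> closed_span M G"
  using Y
proof (induction I rule: infinite_finite_induct)
  case (insert i I)
  then show ?case using closed_span_add[where M=M and G=G and Y="Y i"] G by simp
qed (simp_all add: closed_span_zero)

lemma closed_span_closed:
  assumes G: "\<And>X. X \<in> G \<Longrightarrow> sq_integrable M X"
    and Y: "sq_integrable M Y"
    and approx: "\<And>e. e > 0 \<Longrightarrow> \<exists>X\<in>closed_span M G. ms_norm2 M (\<lambda>w. Y w - X w) < e"
  shows "Y \<in> closed_span M G"
  unfolding closed_span_def
proof (intro CollectI conjI allI impI Y)
  fix e :: real assume "e > 0"
  then have e4: "e / 4 > 0" by simp
  from approx[OF e4] obtain X where X: "X \<in> closed_span M G" "ms_norm2 M (\<lambda>w. Y w - X w) < e / 4" by blast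
  from closed_span_approx[OF X(1) e4] obtain F c
    where F: "finite F" "F \<subseteq> G" "ms_norm2 M (\<lambda>w. X w - (\<Sum>X\<in>F. c X * X w)) < e / 4" .
  have "ms_norm2 M (\<lambda>w. Y w - (\<Sum>X\<in>F. c X * X w)) =
      ms_norm2 M (\<lambda>w. (Y w - X w) + (X w - (\<Sum>X\<in>F. c X * X w)))" by simp
  also have "\<dots> \<le> 2 * ms_norm2 M (\<lambda>w. Y w - X w) + 2 * ms_norm2 M (\<lambda>w. X w - (\<Sum>X\<in>F. c X * X w))"
    by (intro ms_norm2_add_le sq_integrable_diff closed_span_lincomb[where G=G] G closed_span_sq[OF X(1)] Y F(1,2))
  also have "\<dots> < e" using X F by linarith
  finally show "\<exists>F c. finite F \<and> F \<subseteq> G \<and> ms_norm2 M (\<lambda>w. Y w - (\<Sum>X\<in>F. c X * X w)) < e"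
    using F by (intro exI[of _ F] exI[of _ c]) simp
qed

lemma closed_span_subset:
  assumes "\<And>X. X \<in> H \<Longrightarrow> sq_integrable M X" and "\<And>X. X \<in> G \<Longrightarrow> X \<in> closed_span M H"
  shows "closed_span M G \<subseteq> closed_span M H"
proof
  fix Y assume Y: "Y \<in> closed_span M G"
  show "Y \<in> closed_span M H"
  proof (rule closed_span_closed[where G=H, OF _ closed_span_sq[OF Y]])
    show "sq_integrable M X" if "X \<in> H" for X using that by (rule assms(1))
    fix e :: real assume "e > 0"
    from closed_span_approx[OF Y this] obtain F c
      where F: "finite F" "F \<subseteq> G" "ms_norm2 M (\<lambda>w. Y w - (\<Sum>X\<in>F. c X * X w)) < e" .
    then show "\<exists>X\<in>closed_span M H. ms_norm2 M (\<lambda>w. Y w - X w) < e"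
      by (intro bexI[of _ "\<lambda>w. \<Sum>X\<in>F. c X * X w"] closed_span_sum closed_span_cmult assms(1)
          assms(2) subsetD[OF F(2)])
  qed
qed

lemma closed_span_limit:
  assumes "\<And>X. X \<in> G \<Longrightarrow> sq_integrable M X" "\<And>r. X r \<in> closed_span M G" "sq_integrable M Y"
    and "ms_tendsto M X Y F" "F \<noteq> bot"
  shows "Y \<in> closed_span M G"
proof (rule closed_span_closed[where G=G, OF _ assms(3)])
  show "sq_integrable M X" if "X \<in> G" for X using that by (rule assms(1))
  fix e :: real assume "e > 0"
  then have "\<forall>\<^sub>F r in F. ms_norm2 M (\<lambda>w. Y w - X r w) < e"
    using order_tendstoD(2)[OF assms(4)] by simp
  from eventually_happens'[OF assms(5) this] obtain r where "ms_norm2 M (\<lambda>w. Y w - X r w) < e" ..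
  then show "\<exists>X\<in>closed_span M G. ms_norm2 M (\<lambda>w. Y w - X w) < e"
    using assms(2)[of r] by (rule bexI[of _ "X r"])
qed

text \<open>Subtracting a combination of \<open>G\<close> from \<open>Y\<close> does not change the
  inner product with \<open>W\<close>, so Cauchy--Schwarz bounds it by the distance of
  \<open>Y\<close> from such combinations, which is arbitrarily small.\<close>

lemma closed_span_orthogonal:
  assumes G: "\<And>X. X \<in> G \<Longrightarrow> sq_integrable M X" and W: "sq_integrable M W"
    and orth: "\<And>X. X \<in> G \<Longrightarrow> ms_inner M X W = 0" and Y: "Y \<in> closed_span M G"
  shows "ms_inner M Y W = 0"
proof -
  have bound: "(cmod (ms_inner M Y W))\<^sup>2 \<le> e * ms_norm2 M W" if "e > 0" for e
  proof -
    from closed_span_approx[OF Y that] obtain F c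
      where F: "finite F" "F \<subseteq> G" "ms_norm2 M (\<lambda>w. Y w - (\<Sum>X\<in>F. c X * X w)) < e" .
    let ?L = "\<lambda>w. \<Sum>X\<in>F. c X * X w"
    have sqF: "sq_integrable M (\<lambda>w. c X * X w)" if "X \<in> F" for X
      using that F G by (intro sq_integrable_cmult) auto
    have "ms_inner M ?L W = (\<Sum>X\<in>F. c X * ms_inner M X W)"
      by (simp add: ms_inner_sum_left sqF W ms_inner_cmult_left)
    also have "\<dots> = 0" using F orth by (intro sum.neutral) auto
    finally have "ms_inner M Y W = ms_inner M (\<lambda>w. Y w - ?L w) W"
      using Y W sqF by (simp add: ms_inner_diff_left closed_span_sq sq_integrable_sum)
    then have "(cmod (ms_inner M Y W))\<^sup>2 \<le> ms_norm2 M (\<lambda>w. Y w - ?L w) * ms_norm2 M W"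
      using ms_Cauchy_Schwarz[OF sq_integrable_diff[OF closed_span_sq[OF Y] sq_integrable_sum[OF sqF]] W] by simp
    also have "\<dots> \<le> e * ms_norm2 M W"
      using F by (intro mult_right_mono) auto
    finally show ?thesis .
  qed
  have "(cmod (ms_inner M Y W))\<^sup>2 \<le> 0 + e" if "e > 0" for e
  proof -
    have "(cmod (ms_inner M Y W))\<^sup>2 \<le> (e / (ms_norm2 M W + 1)) * ms_norm2 M W"
      using that by (intro bound divide_pos_pos add_nonneg_pos) auto
    also have "\<dots> \<le> e"
      using that ms_norm2_nonneg[of M W] by (simp add: divide_le_eq mult_left_mono add_nonneg_pos)
    finally show ?thesis by simp
  qed
  then have "(cmod (ms_inner M Y W))\<^sup>2 \<le> 0" by (rule field_le_epsilon)
  then show ?thesis by simp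
qed

section \<open>Finite orthonormal systems\<close>

lemma orthonormal_combination_norm2:
  assumes "finite I" "\<And>i. i \<in> I \<Longrightarrow> sq_integrable M (e i)"
    and "\<And>i j. i \<in> I \<Longrightarrow> j \<in> I \<Longrightarrow> ms_inner M (e i) (e j) = (if i = j then 1 else 0)"
  shows "ms_norm2 M (\<lambda>w. \<Sum>i\<in>I. c i * e i w) = (\<Sum>i\<in>I. (cmod (c i))\<^sup>2)"
proof -
  have "complex_of_real (ms_norm2 M (\<lambda>w. \<Sum>i\<in>I. c i * e i w)) =
      (\<Sum>i\<in>I. \<Sum>j\<in>I. c i * (cnj (c j) * ms_inner M (e i) (e j)))"
    using assms(2) unfolding ms_inner_self[symmetric]
    by (simp add: ms_inner_sum_left ms_inner_sum_right sq_integrable_sum sq_integrable_cmult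
        ms_inner_cmult_left ms_inner_cmult_right sum_distrib_left)
  also have "\<dots> = (\<Sum>i\<in>I. \<Sum>j\<in>I. if i = j then c i * cnj (c i) else 0)"
    using assms(3) by (intro sum.cong) auto
  also have "\<dots> = (\<Sum>i\<in>I. c i * cnj (c i))"
    using assms(1) by simp
  also have "\<dots> = complex_of_real (\<Sum>i\<in>I. (cmod (c i))\<^sup>2)"
    unfolding of_real_sum complex_norm_square ..
  finally show ?thesis by (simp only: of_real_eq_iff)
qed

lemma ms_Bessel:
  assumes "finite I" "\<And>i. i \<in> I \<Longrightarrow> sq_integrable M (e i)" "sq_integrable M X"
    and "\<And>i j. i \<in> I \<Longrightarrow> j \<in> I \<Longrightarrow> ms_inner M (e i) (e j) = (if i = j then 1 else 0)"
  shows "(\<Sum>i\<in>I. (cmod (ms_inner M X (e i)))\<^sup>2) \<le> ms_norm2 M X"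
proof -
  let ?c = "\<lambda>i. ms_inner M X (e i)"
  let ?L = "\<lambda>w. \<Sum>i\<in>I. ?c i * e i w"
  have "ms_inner M X ?L = (\<Sum>i\<in>I. ms_inner M X (\<lambda>w. ?c i * e i w))"
    using assms(2,3) by (intro ms_inner_sum_right sq_integrable_cmult)
  also have "\<dots> = (\<Sum>i\<in>I. ?c i * cnj (?c i))"
    unfolding ms_inner_cmult_right by (simp only: mult.commute)
  also have "\<dots> = complex_of_real (\<Sum>i\<in>I. (cmod (?c i))\<^sup>2)"
    unfolding of_real_sum complex_norm_square ..
  finally have "Re (ms_inner M X ?L) = (\<Sum>i\<in>I. (cmod (?c i))\<^sup>2)" by simp
  moreover have "0 \<le> ms_norm2 M (\<lambda>w. X w - ?L w)" by simp
  moreover have "ms_norm2 M ?L = (\<Sum>i\<in>I. (cmod (?c i))\<^sup>2)"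
    using assms by (intro orthonormal_combination_norm2)
  moreover have "sq_integrable M ?L"
    using assms by (intro sq_integrable_sum sq_integrable_cmult)
  ultimately show ?thesis
    using ms_norm2_diff_expand[OF assms(3)] by simp
qed

section \<open>Infinite matrices\<close>

text \<open>Gaussian elimination, by induction on the number of equations: either the last equation
  is void, or it contains some unknown \<open>p\<close> with a nonzero coefficient, which is then
  eliminated from the others.\<close>

lemma underdetermined_system:
  fixes v :: "nat \<Rightarrow> nat \<Rightarrow> complex"
  assumes "finite I" "K < card I"
  shows "\<exists>c. (\<exists>m\<in>I. c m \<noteq> 0) \<and> (\<forall>i<K. (\<Sum>m\<in>I. c m * v m i) = 0)"
  using assms
proof (induction K arbitrary: I v)
  case 0
  then have "I \<noteq> {}" by auto
  then show ?case by (intro exI[of _ "\<lambda>_. 1"]) auto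
next
  case (Suc K)
  show ?case
  proof (cases "\<forall>m\<in>I. v m K = 0")
    case True
    from Suc.IH[of I v] Suc.prems obtain c
      where c: "\<exists>m\<in>I. c m \<noteq> 0" "\<And>i. i < K \<Longrightarrow> (\<Sum>m\<in>I. c m * v m i) = 0" by auto
    have "(\<Sum>m\<in>I. c m * v m i) = 0" if "i < Suc K" for i
      using c(2)[of i] True that by (cases "i = K") auto
    with c(1) show ?thesis by blast
  next
    case False
    then obtain p where p: "p \<in> I" "v p K \<noteq> 0" by blast
    \<comment> \<open>The system after elimination of the unknown \<open>p\<close>. The number
      \<open>s\<close> below is the value of that unknown forced by equation
      \<open>K\<close>.\<close>
    define v' where "v' m i = v m i - v m K / v p K * v p i" for m i
    have "K < card (I - {p})" using p Suc.prems by simp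
    from Suc.IH[OF _ this, of v'] Suc.prems obtain c
      where c: "\<exists>m\<in>I - {p}. c m \<noteq> 0" "\<And>i. i < K \<Longrightarrow> (\<Sum>m\<in>I - {p}. c m * v' m i) = 0" by auto
    define s where "s = - (\<Sum>m\<in>I - {p}. c m * (v m K / v p K))"
    have "(\<Sum>m\<in>I. (c(p := s)) m * v m i) = 0" if "i < Suc K" for i
    proof -
      have "(\<Sum>m\<in>I. (c(p := s)) m * v m i) = s * v p i + (\<Sum>m\<in>I - {p}. c m * v m i)"
        using Suc.prems p by (subst sum.remove[of I p]) (auto intro!: sum.cong)
      also have "\<dots> = (\<Sum>m\<in>I - {p}. c m * v' m i)"
        unfolding s_def v'_def
        by (simp add: sum_distrib_right right_diff_distrib sum_subtractf mult.assoc)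
      also have "\<dots> = 0"
        using c(2)[of i] that p by (cases "i = K") (auto simp: v'_def)
      finally show ?thesis .
    qed
    moreover have "\<exists>m\<in>I. (c(p := s)) m \<noteq> 0" using c(1) by auto
    ultimately show ?thesis by blast
  qed
qed

section \<open>Positive trace class matrices\<close>

lemma pos_trace_class_nonneg:
  "pos_trace_class F \<Longrightarrow> (\<Sum>k<N. \<Sum>n<N. b k * F k n * cnj (b n)) \<in> \<real>\<^sub>\<ge>\<^sub>0"
  by (simp add: pos_trace_class_def)

text \<open>Positivity tested on a vector supported on the two coordinates \<open>k\<close> and
  \<open>n\<close>.\<close>

lemma pos_trace_class_form:
  assumes "pos_trace_class F" "k \<noteq> n"
  shows "x * cnj x * F k k + x * cnj y * F k n + y * cnj x * F n k + y * cnj y * F n n \<in> \<real>\<^sub>\<ge>\<^sub>0"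
proof -
  define b where "b i = (if i = k then x else 0) + (if i = n then y else 0)" for i
  let ?N = "Suc (max k n)"
  have eq: "(\<Sum>i<?N. b i * g i) = x * g k + y * g n" for g :: "nat \<Rightarrow> complex"
  proof -
    have "(\<Sum>i<?N. b i * g i) = (\<Sum>i<?N. (if i = k then x * g i else 0) + (if i = n then y * g i else 0))"
      by (intro sum.cong) (auto simp: b_def distrib_right)
    then show ?thesis unfolding sum.distrib sum.delta[OF finite_lessThan] by (simp add: less_Suc_eq_le)
  qed
  have eq': "(\<Sum>i<?N. g i * cnj (b i)) = g k * cnj x + g n * cnj y" for g :: "nat \<Rightarrow> complex"
    using arg_cong[OF eq[of "\<lambda>i. cnj (g i)"], of cnj] by (simp add: mult.commute)
  have "(\<Sum>i<?N. \<Sum>j<?N. b i * F i j * cnj (b j)) \<in> \<real>\<^sub>\<ge>\<^sub>0"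
    by (rule pos_trace_class_nonneg[OF assms(1)])
  also have "(\<Sum>i<?N. \<Sum>j<?N. b i * F i j * cnj (b j)) = (\<Sum>i<?N. b i * (F i k * cnj x + F i n * cnj y))"
    unfolding eq' by (simp add: algebra_simps)
  also have "\<dots> = x * (F k k * cnj x + F k n * cnj y) + y * (F n k * cnj x + F n n * cnj y)"
    by (rule eq)
  finally show ?thesis by (simp add: algebra_simps)
qed

lemma pos_trace_class_diag: "pos_trace_class F \<Longrightarrow> F k k \<in> \<real>\<^sub>\<ge>\<^sub>0"
  using pos_trace_class_form[of F k "Suc k" 1 0] by simp

text \<open>The principal minor of order two is nonnegative; this is Cauchy--Schwarz for the form of
  \<open>F\<close>.\<close>

lemma pos_trace_class_bound:
  assumes F: "pos_trace_class F"
  shows "cmod (F k n) \<le> sqrt (Re (F k k)) * sqrt (Re (F n n))"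
proof (cases "k = n")
  case True
  have "0 \<le> Re (F k k)" "Im (F k k) = 0"
    using pos_trace_class_diag[OF F, of k] by (auto simp: complex_nonneg_Reals_iff)
  then show ?thesis using True by (simp add: cmod_eq_Re)
next
  case False
  define a where "a = Re (F k k)"
  define d where "d = Re (F n n)"
  define p where "p = F k n"
  define u where "u = cmod p"
  have a: "F k k = of_real a" "0 \<le> a" and d: "F n n = of_real d" "0 \<le> d"
    using pos_trace_class_diag[OF F] by (auto simp: complex_nonneg_Reals_iff a_def d_def complex_eq_iff)
  note form = pos_trace_class_form[OF F False, unfolded complex_nonneg_Reals_iff, folded p_def]
  \<comment> \<open>Hermitian symmetry is a consequence of positivity over the complex numbers: the
    test vectors \<open>(1, 1)\<close> and \<open>(1, \<i>)\<close> have real values.\<close>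
  have q: "F n k = cnj p"
    using form[of 1 1] form[of 1 \<i>] a d by (auto simp: complex_eq_iff)
  have ge: "0 \<le> t\<^sup>2 * a - 2 * t * u + d" if "p \<noteq> 0" for t
  proof -
    \<comment> \<open>A number of modulus one that rotates both off-diagonal terms to
      \<open>- u\<close>.\<close>
    define s where "s = - p / of_real u"
    have u: "u \<noteq> 0" "p * cnj p = (of_real u)\<^sup>2" using that complex_norm_square[of p] by (simp_all add: u_def)
    have s: "cnj s * p = - of_real u" "s * cnj p = - of_real u" "s * cnj s = 1"
      using u by (auto simp: s_def power2_eq_square field_simps)
    have "0 \<le> Re (of_real t * cnj (of_real t) * of_real a + of_real t * (cnj s * p)
        + cnj (of_real t) * (s * cnj p) + s * cnj s * of_real d)"
      using form[of "of_real t" s] by (simp add: q a d mult_ac)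
    then show ?thesis unfolding s by (simp add: power2_eq_square algebra_simps)
  qed
  have "u\<^sup>2 \<le> a * d"
  proof (cases "p = 0")
    case True then show ?thesis using a d by (simp add: u_def)
  next
    case False
    then have u: "u > 0" by (simp add: u_def)
    show ?thesis
    proof (cases "a = 0")
      case True
      \<comment> \<open>If \<open>a = 0\<close>, the form is affine in \<open>t\<close> and takes
        the value \<open>-1\<close> at this \<open>t\<close>. For \<open>a > 0\<close> its minimum
        is at \<open>u / a\<close>.\<close>
      have "2 * ((d + 1) / (2 * u)) * u = d + 1" using u by simp
      then have False using ge[OF False, of "(d + 1) / (2 * u)"] True by simp
      then show ?thesis ..
    next
      case False
      with a have "a > 0" by simp
      with ge[OF \<open>p \<noteq> 0\<close>, of "u / a"] show ?thesis by (simp add: power2_eq_square field_simps)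
    qed
  qed
  then have "sqrt (u\<^sup>2) \<le> sqrt (a * d)" by (rule real_sqrt_le_mono)
  then show ?thesis by (simp add: u_def p_def a_def d_def real_sqrt_mult)
qed

lemma pos_trace_class_summable:
  assumes "pos_trace_class F"
  shows "summable (\<lambda>k. (sqrt (Re (F k k)))\<^sup>2)"
proof -
  have "summable (\<lambda>k. Re (F k k))"
    using assms by (intro summable_Re) (simp add: pos_trace_class_def)
  moreover have "0 \<le> Re (F k k)" for k
    using pos_trace_class_diag[OF assms, of k] by (simp add: complex_nonneg_Reals_iff)
  ultimately show ?thesis by simp
qed

lemma has_sum_finite_sum:
  fixes g :: "'i \<Rightarrow> 'a \<Rightarrow> complex"
  assumes "\<And>i. i \<in> I \<Longrightarrow> (g i has_sum s i) A"
  shows "((\<lambda>x. \<Sum>i\<in>I. g i x) has_sum (\<Sum>i\<in>I. s i)) A"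
  using assms by (induction I rule: infinite_finite_induct) (simp_all add: has_sum_add)

lemma summable_mult_squares:
  fixes \<phi> \<psi> :: "nat \<Rightarrow> real"
  assumes "summable (\<lambda>k. (\<phi> k)\<^sup>2)" "summable (\<lambda>k. (\<psi> k)\<^sup>2)"
  shows "summable (\<lambda>k. \<bar>\<phi> k\<bar> * \<bar>\<psi> k\<bar>)"
proof (rule summable_comparison_test'[OF summable_add[OF assms]])
  fix k
  show "norm (\<bar>\<phi> k\<bar> * \<bar>\<psi> k\<bar>) \<le> (\<phi> k)\<^sup>2 + (\<psi> k)\<^sup>2"
    using sum_squares_bound[of "\<bar>\<phi> k\<bar>" "\<bar>\<psi> k\<bar>"] mult_nonneg_nonneg[OF abs_ge_zero[of "\<phi> k"] abs_ge_zero[of "\<psi> k"]]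
    unfolding real_norm_def abs_mult abs_abs power2_abs mult.assoc by argo
qed

text \<open>
  With \<open>E = F G\<close>, the columns of the factor \<open>P\<close> are fixed by \<open>E\<close>. Since the entries of
  \<open>E\<close> are dominated by a summable product \<open>C \<phi>\<^sub>i \<psi>\<^sub>k\<close>, a vector that is fixed by
  \<open>E\<close> and whose first \<open>K\<close> coordinates vanish is zero once \<open>K\<close> is large. Hence at most
  \<open>K\<close> columns of \<open>P\<close> are linearly independent.
\<close>
lemma finite_factor_of_trace_class_inverse:
  fixes F G P Q :: "nat \<Rightarrow> nat \<Rightarrow> complex" and J :: "nat set"
  assumes F: "pos_trace_class F" and G: "pos_trace_class G"
    and FGF: "mat_mult (mat_mult F G) F = F"
    and fac: "\<And>k n. ((\<lambda>m. P k m * cnj (P n m)) has_sum F k n) J"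
    and left_inverse: "\<And>m n. m \<in> J \<Longrightarrow> n \<in> J \<Longrightarrow> (\<lambda>k. Q m k * P k n) sums (if m = n then 1 else 0)"
  shows "finite J"
proof -
  define \<phi> where "\<phi> k = sqrt (Re (F k k))" for k
  define \<psi> where "\<psi> k = sqrt (Re (G k k))" for k
  define E where "E = mat_mult F G"
  have \<phi>0: "0 \<le> \<phi> k" and \<psi>0: "0 \<le> \<psi> k" for k
    using pos_trace_class_diag[OF F, of k] pos_trace_class_diag[OF G, of k]
    by (auto simp: \<phi>_def \<psi>_def complex_nonneg_Reals_iff)
  have Fb: "cmod (F k n) \<le> \<phi> k * \<phi> n" and Gb: "cmod (G k n) \<le> \<psi> k * \<psi> n" for k n
    unfolding \<phi>_def \<psi>_def by (intro pos_trace_class_bound F G)+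
  have s2: "summable (\<lambda>k. (\<phi> k)\<^sup>2)" "summable (\<lambda>k. (\<psi> k)\<^sup>2)"
    unfolding \<phi>_def \<psi>_def by (intro pos_trace_class_summable F G)+
  have sfp: "summable (\<lambda>k. \<phi> k * \<psi> k)"
    using summable_mult_squares[OF s2] \<phi>0 \<psi>0 by simp
  define C where "C = (\<Sum>k. \<phi> k * \<psi> k)"
  have C0: "0 \<le> C" unfolding C_def by (intro suminf_nonneg sfp mult_nonneg_nonneg \<phi>0 \<psi>0)
  have Eb: "cmod (E i j) \<le> C * \<phi> i * \<psi> j" for i j
  proof -
    have s: "summable (\<lambda>k. (\<phi> i * \<psi> j) * (\<phi> k * \<psi> k))"
      by (intro summable_mult sfp)
    have b: "norm (F i k * G k j) \<le> (\<phi> i * \<psi> j) * (\<phi> k * \<psi> k)" for k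
      using mult_mono[OF Fb[of i k] Gb[of k j]] \<phi>0 by (simp add: norm_mult mult_ac)
    have "cmod (E i j) \<le> (\<Sum>k. (\<phi> i * \<psi> j) * (\<phi> k * \<psi> k))"
      unfolding E_def mat_mult_def by (rule norm_suminf_le[OF b s])
    also have "\<dots> = C * \<phi> i * \<psi> j" by (simp add: suminf_mult[OF sfp] C_def)
    finally show ?thesis .
  qed
  have Pb: "cmod (P k m) \<le> \<phi> k" if "m \<in> J" for k m
  proof -
    have "((\<lambda>m. Re (P k m * cnj (P k m))) has_sum Re (F k k)) J"
      by (rule has_sum_Re[OF fac])
    then have "((\<lambda>m. (cmod (P k m))\<^sup>2) has_sum Re (F k k)) J"
      by (simp add: complex_norm_square[symmetric] del: of_real_power)
    then have "(\<Sum>m\<in>{m}. (cmod (P k m))\<^sup>2) \<le> Re (F k k)"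
      using that by (intro finite_sum_le_has_sum) auto
    then show ?thesis unfolding \<phi>_def by (intro real_le_rsqrt) simp
  qed
  have EP: "(\<lambda>k. E i k * P k m) sums P i m" if m: "m \<in> J" for i m
  proof -
    \<comment> \<open>Row \<open>i\<close> of \<open>I - E\<close>. It annihilates \<open>F\<close>
      because \<open>E F = F\<close>. The squared modulus of the truncated pairing of
      \<open>r\<close> with column \<open>m\<close> is one nonnegative term in the truncated
      quadratic form of \<open>F\<close> at \<open>r\<close>, so it suffices that this form tends to
      zero.\<close>
    define r where "r k = (if k = i then 1 else 0) - E i k" for k
    have rF: "(\<lambda>k. r k * F k n) sums 0" for n
    proof -
      have "summable (\<lambda>k. E i k * F k n)"
      proof (rule summable_comparison_test'[where N=0])
        show "summable (\<lambda>k. (C * \<phi> i * \<phi> n) * (\<phi> k * \<psi> k))" by (intro summable_mult sfp)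
        fix k show "norm (E i k * F k n) \<le> (C * \<phi> i * \<phi> n) * (\<phi> k * \<psi> k)"
          using mult_mono[OF Eb[of i k] Fb[of k n]] C0 \<phi>0 \<psi>0 by (simp add: norm_mult mult_ac)
      qed
      then have "(\<lambda>k. E i k * F k n) sums mat_mult E F i n" unfolding mat_mult_def by (rule summable_sums)
      then have "(\<lambda>k. E i k * F k n) sums F i n" unfolding E_def FGF .
      from sums_diff[OF sums_single[of i "\<lambda>k. F k n"] this]
      have "(\<lambda>k. (if k = i then F k n else 0) - E i k * F k n) sums 0" by simp
      moreover have "(\<lambda>k. (if k = i then F k n else 0) - E i k * F k n) = (\<lambda>k. r k * F k n)"
        by (auto simp: r_def left_diff_distrib)
      ultimately show ?thesis by simp
    qed
    have sr: "summable (\<lambda>k. cmod (r k) * \<phi> k)"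
    proof (rule summable_comparison_test'[where N=0])
      show "summable (\<lambda>k. (if k = i then \<phi> k else 0) + (C * \<phi> i) * (\<phi> k * \<psi> k))"
        by (intro summable_add summable_mult sfp sums_summable[OF sums_single])
      fix k
      have "cmod (r k) \<le> (if k = i then 1 else 0) + C * \<phi> i * \<psi> k"
        unfolding r_def by (rule order_trans[OF norm_triangle_ineq4]) (use Eb[of i k] in auto)
      from mult_right_mono[OF this \<phi>0[of k]]
      show "norm (cmod (r k) * \<phi> k) \<le> (if k = i then \<phi> k else 0) + (C * \<phi> i) * (\<phi> k * \<psi> k)"
        using \<phi>0[of k] by (auto simp: abs_mult algebra_simps split: if_splits)
    qed
    define R where "R = (\<Sum>k. cmod (r k) * \<phi> k)"
    define \<tau> where "\<tau> K = (\<Sum>k. cmod (r (k + K)) * \<phi> (k + K))" for K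
    have \<tau>: "\<tau> \<longlonglongrightarrow> 0"
      unfolding \<tau>_def by (rule suminf_exist_split2[OF sr])
    have bound: "(cmod (\<Sum>k<K. r k * P k m))\<^sup>2 \<le> R * \<tau> K" for K
    proof -
      \<comment> \<open>The full series vanishes, so its head is minus its tail, and the tail is
        controlled by \<open>\<tau> K\<close>.\<close>
      have part: "cmod (\<Sum>k<K. r k * F k n) \<le> \<phi> n * \<tau> K" for n
      proof -
        have s: "summable (\<lambda>k. r k * F k n)" "(\<Sum>k. r k * F k n) = 0"
          using rF[of n] by (auto simp: sums_iff)
        have "(\<Sum>k<K. r k * F k n) = - (\<Sum>k. r (k + K) * F (k + K) n)"
          using suminf_split_initial_segment[OF s(1), of K] s(2) by (simp add: eq_neg_iff_add_eq_0 add.commute)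
        also have "cmod \<dots> \<le> (\<Sum>k. \<phi> n * (cmod (r (k + K)) * \<phi> (k + K)))"
          unfolding norm_minus_cancel
        proof (rule norm_suminf_le[rotated])
          show "summable (\<lambda>k. \<phi> n * (cmod (r (k + K)) * \<phi> (k + K)))"
            by (intro summable_mult summable_ignore_initial_segment sr)
          fix k show "norm (r (k + K) * F (k + K) n) \<le> \<phi> n * (cmod (r (k + K)) * \<phi> (k + K))"
            using mult_left_mono[OF Fb[of "k + K" n] norm_ge_zero[of "r (k + K)"]]
            by (simp add: norm_mult mult_ac)
        qed
        also have "\<dots> = \<phi> n * \<tau> K"
          unfolding \<tau>_def by (intro suminf_mult summable_ignore_initial_segment sr)
        finally show ?thesis .
      qed
      have "((\<lambda>m. \<Sum>k<K. \<Sum>n<K. r k * cnj (r n) * (P k m * cnj (P n m))) has_sum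
          (\<Sum>k<K. \<Sum>n<K. r k * cnj (r n) * F k n)) J"
        by (intro has_sum_finite_sum has_sum_cmult_right fac)
      also have "(\<lambda>m. \<Sum>k<K. \<Sum>n<K. r k * cnj (r n) * (P k m * cnj (P n m)))
          = (\<lambda>m. complex_of_real ((cmod (\<Sum>k<K. r k * P k m))\<^sup>2))"
        unfolding complex_norm_square cnj_sum sum_product by (simp add: mult_ac)
      finally have "((\<lambda>m. Re (complex_of_real ((cmod (\<Sum>k<K. r k * P k m))\<^sup>2))) has_sum
          Re (\<Sum>k<K. \<Sum>n<K. r k * cnj (r n) * F k n)) J"
        by (rule has_sum_Re)
      then have "(\<Sum>m\<in>{m}. (cmod (\<Sum>k<K. r k * P k m))\<^sup>2) \<le> Re (\<Sum>k<K. \<Sum>n<K. r k * cnj (r n) * F k n)"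
        using m by (intro finite_sum_le_has_sum) auto
      also have "\<dots> \<le> cmod (\<Sum>k<K. \<Sum>n<K. r k * cnj (r n) * F k n)" by (rule complex_Re_le_cmod)
      also have "(\<Sum>k<K. \<Sum>n<K. r k * cnj (r n) * F k n) = (\<Sum>n<K. cnj (r n) * (\<Sum>k<K. r k * F k n))"
        by (subst sum.swap) (simp add: sum_distrib_left mult_ac)
      also have "cmod \<dots> \<le> (\<Sum>n<K. cmod (r n) * (\<phi> n * \<tau> K))"
        by (intro sum_norm_le) (simp add: norm_mult mult_left_mono part)
      also have "\<dots> = (\<Sum>n<K. cmod (r n) * \<phi> n) * \<tau> K" by (simp only: sum_distrib_right mult.assoc)
      also have "\<dots> \<le> R * \<tau> K"
        unfolding R_def \<tau>_def using \<phi>0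
        by (intro mult_right_mono sum_le_suminf sr suminf_nonneg summable_ignore_initial_segment) auto
      finally show ?thesis by simp
    qed
    have "(\<lambda>K. (cmod (\<Sum>k<K. r k * P k m))\<^sup>2) \<longlonglongrightarrow> 0"
      by (rule Lim_null_comparison[OF always_eventually tendsto_mult_right_zero[OF \<tau>]])
         (use bound in auto)
    from tendsto_real_sqrt[OF this] have "(\<lambda>K. \<Sum>k<K. r k * P k m) \<longlonglongrightarrow> 0"
      by (simp add: tendsto_norm_zero_iff)
    then have "(\<lambda>k. r k * P k m) sums 0" by (simp add: sums_def)
    from sums_diff[OF sums_single[of i "\<lambda>k. P k m"] this]
    have "(\<lambda>k. (if k = i then P k m else 0) - r k * P k m) sums P i m" by simp
    moreover have "(\<lambda>k. (if k = i then P k m else 0) - r k * P k m) = (\<lambda>k. E i k * P k m)"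
      by (auto simp: r_def left_diff_distrib)
    ultimately show ?thesis by simp
  qed
  \<comment> \<open>\<open>K\<close> is chosen so that the fixed vectors of \<open>E\<close>
    vanishing on the first \<open>K\<close> coordinates satisfy \<open>s <= q s\<close> with some
    \<open>q < 1\<close>. Any \<open>K + 1\<close> columns have a nontrivial combination of this
    kind.\<close>
  have "(\<lambda>K. C * (\<Sum>k. \<phi> (k + K) * \<psi> (k + K))) \<longlonglongrightarrow> C * 0"
    by (intro tendsto_mult_left suminf_exist_split2 sfp)
  then have "\<forall>\<^sub>F K in sequentially. C * (\<Sum>k. \<phi> (k + K) * \<psi> (k + K)) < 1"
    by (rule order_tendstoD) simp
  then obtain K where K: "C * (\<Sum>k. \<phi> (k + K) * \<psi> (k + K)) < 1"
    by (auto simp: eventually_sequentially)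
  show "finite J"
  proof (rule ccontr)
    assume "infinite J"
    then obtain I where I: "finite I" "card I = Suc K" "I \<subseteq> J"
      using infinite_arbitrarily_large by blast
    from underdetermined_system[of I K "\<lambda>m i. P i m"] I obtain c
      where c: "\<exists>m\<in>I. c m \<noteq> 0" "\<And>i. i < K \<Longrightarrow> (\<Sum>m\<in>I. c m * P i m) = 0" by auto
    define v where "v i = (\<Sum>m\<in>I. c m * P i m)" for i
    have Ev: "(\<lambda>k. E i k * v k) sums v i" for i
    proof -
      have "(\<lambda>k. \<Sum>m\<in>I. c m * (E i k * P k m)) sums v i"
        unfolding v_def by (intro sums_sum sums_mult EP) (use I in auto)
      then show ?thesis by (simp add: v_def sum_distrib_left mult_ac)
    qed
    define B where "B = (\<Sum>m\<in>I. cmod (c m))"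
    have vb: "cmod (v k) \<le> B * \<phi> k" for k
      unfolding v_def B_def sum_distrib_right
      by (intro sum_norm_le) (use I Pb in \<open>auto simp: norm_mult intro!: mult_left_mono\<close>)
    have ss: "summable (\<lambda>k. \<psi> k * cmod (v k))"
    proof (rule summable_comparison_test'[where N=0])
      show "summable (\<lambda>k. B * (\<phi> k * \<psi> k))" by (intro summable_mult sfp)
      fix k show "norm (\<psi> k * cmod (v k)) \<le> B * (\<phi> k * \<psi> k)"
        using mult_left_mono[OF vb[of k] \<psi>0[of k]] \<psi>0[of k] by (simp add: abs_mult mult_ac)
    qed
    define s where "s = (\<Sum>k. \<psi> k * cmod (v k))"
    have s0: "0 \<le> s" unfolding s_def using \<psi>0 by (intro suminf_nonneg ss) auto
    have vs: "cmod (v i) \<le> C * \<phi> i * s" for i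
    proof -
      have "cmod (\<Sum>k. E i k * v k) \<le> (\<Sum>k. C * \<phi> i * (\<psi> k * cmod (v k)))"
      proof (rule norm_suminf_le[rotated])
        show "summable (\<lambda>k. C * \<phi> i * (\<psi> k * cmod (v k)))" by (intro summable_mult ss)
        fix k show "norm (E i k * v k) \<le> C * \<phi> i * (\<psi> k * cmod (v k))"
          using mult_right_mono[OF Eb[of i k] norm_ge_zero[of "v k"]] by (simp add: norm_mult mult_ac)
      qed
      also have "\<dots> = C * \<phi> i * s" unfolding s_def by (rule suminf_mult[OF ss])
      finally show ?thesis using Ev[of i] by (simp add: sums_iff)
    qed
    have "s = (\<Sum>k. \<psi> (k + K) * cmod (v (k + K)))"
      unfolding s_def using suminf_split_initial_segment[OF ss, of K] c(2) by (simp add: v_def)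
    also have "\<dots> \<le> (\<Sum>k. C * s * (\<phi> (k + K) * \<psi> (k + K)))"
    proof (rule suminf_le)
      fix k show "\<psi> (k + K) * cmod (v (k + K)) \<le> C * s * (\<phi> (k + K) * \<psi> (k + K))"
        using mult_left_mono[OF vs[of "k + K"] \<psi>0[of "k + K"]] by (simp add: mult_ac)
    qed (intro summable_mult summable_ignore_initial_segment ss sfp)+
    also have "\<dots> = C * (\<Sum>k. \<phi> (k + K) * \<psi> (k + K)) * s"
      by (subst suminf_mult) (auto intro: summable_ignore_initial_segment[OF sfp] simp: mult_ac)
    finally have "s \<le> C * (\<Sum>k. \<phi> (k + K) * \<psi> (k + K)) * s" .
    then have "s = 0"
      using K s0 mult_strict_right_mono[OF K, of s] by (cases "s = 0") auto
    then have v0: "v i = 0" for i using vs[of i] by simp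
    \<comment> \<open>The left inverse recovers the coefficients from the combination
      \<open>v\<close>, which has just been shown to vanish.\<close>
    have "c m = 0" if "m \<in> I" for m
    proof -
      have "(\<lambda>k. \<Sum>n\<in>I. c n * (Q m k * P k n)) sums (\<Sum>n\<in>I. c n * (if m = n then 1 else 0))"
        using I that by (intro sums_sum sums_mult left_inverse) auto
      also have "(\<lambda>k. \<Sum>n\<in>I. c n * (Q m k * P k n)) = (\<lambda>k. Q m k * v k)"
        by (auto simp: v_def sum_distrib_left mult_ac)
      finally have "(\<lambda>k. 0::complex) sums c m"
        using I that by (simp add: v0 if_distrib cong: if_cong)
      then show ?thesis using sums_unique2 sums_zero by blast
    qed
    with c(1) show False by blast
  qed
qed

text \<open>With finitely many columns, a convergent \<open>b^T P\<close> may be inserted into both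
  series of \<open>quad_form\<close> termwise: the inner series gives a combination of conjugated
  entries of \<open>P\<close>, the outer one the squared length of \<open>b^T P\<close>.\<close>

lemma quad_form_factor:
  fixes P :: "nat \<Rightarrow> nat \<Rightarrow> complex" and N :: nat
  assumes F: "\<And>k n. F k n = (\<Sum>m<N. P k m * cnj (P n m))"
    and b: "\<And>m. m < N \<Longrightarrow> summable (\<lambda>k. b k * P k m)"
  shows "quad_form F b = ennreal (\<Sum>m<N. (cmod (\<Sum>k. b k * P k m))\<^sup>2)"
proof -
  define s where "s m = (\<Sum>k. b k * P k m)" for m
  have s: "(\<lambda>k. b k * P k m) sums s m" if "m < N" for m
    unfolding s_def by (rule summable_sums[OF b[OF that]])
  have 1: "(\<lambda>k. b k * F k n) sums (\<Sum>m<N. s m * cnj (P n m))" for n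
  proof -
    have "(\<lambda>k. \<Sum>m<N. b k * P k m * cnj (P n m)) sums (\<Sum>m<N. s m * cnj (P n m))"
      by (intro sums_sum sums_mult2 s) auto
    then show ?thesis by (simp add: F sum_distrib_left mult_ac)
  qed
  have 2: "(\<lambda>n. (\<Sum>k. b k * F k n) * cnj (b n)) sums (\<Sum>m<N. s m * cnj (s m))"
  proof -
    have "(\<lambda>n. \<Sum>m<N. s m * cnj (b n * P n m)) sums (\<Sum>m<N. s m * cnj (s m))"
      by (intro sums_sum sums_mult iffD2[OF sums_cnj] s) simp
    moreover have "(\<Sum>k. b k * F k n) = (\<Sum>m<N. s m * cnj (P n m))" for n
      using 1[of n] by (simp add: sums_iff)
    ultimately show ?thesis by (simp add: sum_distrib_left sum_distrib_right mult_ac)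
  qed
  have "(\<Sum>m<N. s m * cnj (s m)) = complex_of_real (\<Sum>m<N. (cmod (s m))\<^sup>2)"
    unfolding of_real_sum complex_norm_square ..
  then show ?thesis
    using 1 2 unfolding quad_form_def by (auto simp: sums_iff s_def[symmetric])
qed

text \<open>
  The set of vectors \<open>v\<close> for which \<open>b\<^sup>T P v\<close> converges is a subspace of a finite dimensional
  space that contains all rows of \<open>P\<close> (conjugated); the left inverse \<open>Q\<close> makes the unit vectors
  limits of combinations of rows.
\<close>
lemma quad_form_factor_summable:
  fixes P Q :: "nat \<Rightarrow> nat \<Rightarrow> complex" and N :: nat
  assumes F: "\<And>k n. F k n = (\<Sum>m<N. P k m * cnj (P n m))"
    and left_inverse: "\<And>m n. m < N \<Longrightarrow> n < N \<Longrightarrow> (\<lambda>k. Q m k * P k n) sums (if m = n then 1 else 0)"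
    and fin: "quad_form F b \<noteq> \<infinity>" and p: "p < N"
  shows "summable (\<lambda>k. b k * P k p)"
proof -
  have bF: "summable (\<lambda>k. b k * F k n)" for n
    using fin by (auto simp: quad_form_def split: if_splits)
  define V where "V v \<longleftrightarrow> summable (\<lambda>k. b k * (\<Sum>m<N. P k m * v m))" for v :: "nat \<Rightarrow> complex"
  have row: "V (\<lambda>m. cnj (P n m))" for n
    using bF[of n] by (simp add: V_def F)
  have comb: "V (\<lambda>m. \<Sum>i\<in>I. a i * v i m)" if "\<And>i. i \<in> I \<Longrightarrow> V (v i)"
    for I :: "nat set" and a :: "nat \<Rightarrow> complex" and v :: "nat \<Rightarrow> nat \<Rightarrow> complex"
  proof -
    have "summable (\<lambda>k. \<Sum>i\<in>I. a i * (b k * (\<Sum>m<N. P k m * v i m)))"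
      using that unfolding V_def by (intro summable_sum summable_mult)
    also have "(\<lambda>k. \<Sum>i\<in>I. a i * (b k * (\<Sum>m<N. P k m * v i m))) = (\<lambda>k. b k * (\<Sum>m<N. P k m * (\<Sum>i\<in>I. a i * v i m)))"
      by (simp add: sum_distrib_left mult_ac) (subst sum.swap, simp)
    finally show ?thesis by (simp add: V_def)
  qed
  \<comment> \<open>Row \<open>q\<close> of the product \<open>Q P\<close>, truncated after
    \<open>K\<close> terms and conjugated: a finite combination of conjugated rows of
    \<open>P\<close> that tends to the unit vector with index \<open>q\<close>.\<close>
  define w where "w K q m = (\<Sum>n<K. cnj (Q q n) * cnj (P n m))" for K q m
  have Vw: "V (w K q)" for K q
    unfolding w_def by (intro comb row)
  have lim: "(\<lambda>K. w K q m) \<longlonglongrightarrow> (if q = m then 1 else 0)" if "q < N" "m < N" for q m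
  proof -
    have "(\<lambda>K. cnj (\<Sum>n<K. Q q n * P n m)) \<longlonglongrightarrow> cnj (if q = m then 1 else 0)"
      using left_inverse[OF that] unfolding sums_def by (rule tendsto_cnj)
    then show ?thesis by (cases "q = m") (simp_all add: w_def)
  qed
  \<comment> \<open>The tolerance \<open>1 / (2 N)\<close> makes the matrix of the
    \<open>w K q\<close> strictly diagonally dominant, hence its rows independent.\<close>
  have "\<forall>\<^sub>F K in sequentially. \<forall>q\<in>{..<N}. \<forall>m\<in>{..<N}. dist (w K q m) (if q = m then 1 else 0) < 1 / (2 * real N)"
    using p by (intro eventually_ball_finite ballI tendstoD lim) auto
  then obtain K where K: "\<And>q m. q < N \<Longrightarrow> m < N \<Longrightarrow> cmod (w K q m - (if q = m then 1 else 0)) < 1 / (2 * real N)"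
    by (auto simp: eventually_sequentially dist_norm)
  \<comment> \<open>The vectors \<open>w K q\<close> together with the unit vector at
    \<open>p\<close> are \<open>N + 1\<close> vectors with \<open>N\<close> coordinates, hence
    dependent. If the last coefficient is nonzero, the unit vector is a combination of the
    \<open>w K q\<close>.\<close>
  define x where "x q = (if q < N then w K q else (\<lambda>m. if m = p then 1 else 0))" for q
  have "finite {..N}" "N < card {..N}" by auto
  from underdetermined_system[OF this, of x] obtain c
    where c: "\<exists>q\<le>N. c q \<noteq> 0" "\<And>m. m < N \<Longrightarrow> (\<Sum>q\<le>N. c q * x q m) = 0" by auto
  have rel: "(\<Sum>q<N. c q * w K q m) + c N * (if m = p then 1 else 0) = 0" if "m < N" for m
    using c(2)[OF that] by (simp add: x_def lessThan_Suc_atMost[symmetric])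
  \<comment> \<open>Otherwise the \<open>w K q\<close> alone would be dependent. At the index
    \<open>i\<close> of a largest coefficient, \<open>c i\<close> is the sum of the
    \<open>c q\<close> times the deviations of \<open>w K q i\<close> from the unit matrix, whence
    \<open>|c i| <= |c i| / 2\<close>.\<close>
  have "c N \<noteq> 0"
  proof
    assume cN: "c N = 0"
    obtain i where i: "i < N" "\<And>q. q < N \<Longrightarrow> cmod (c q) \<le> cmod (c i)"
    proof -
      have "finite ((\<lambda>q. cmod (c q)) ` {..<N})" "(\<lambda>q. cmod (c q)) ` {..<N} \<noteq> {}" using p by auto
      from Max_in[OF this] Max_ge[OF this(1)] show thesis using that by fastforce
    qed
    have "(\<Sum>q<N. c q * ((if q = i then 1 else 0) - w K q i)) =
        (\<Sum>q<N. if q = i then c q else 0) - (\<Sum>q<N. c q * w K q i)"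
      unfolding sum_subtractf[symmetric] by (intro sum.cong) (auto simp: right_diff_distrib)
    also have "\<dots> = c i"
      using rel[OF i(1)] i(1) cN by simp
    finally have ci: "(\<Sum>q<N. c q * ((if q = i then 1 else 0) - w K q i)) = c i" .
    have "cmod (\<Sum>q<N. c q * ((if q = i then 1 else 0) - w K q i)) \<le> (\<Sum>q<N. cmod (c i) * (1 / (2 * real N)))"
    proof (rule sum_norm_le)
      fix q assume "q \<in> {..<N}"
      then have "q < N" by simp
      show "cmod (c q * ((if q = i then 1 else 0) - w K q i)) \<le> cmod (c i) * (1 / (2 * real N))"
        unfolding norm_mult norm_minus_commute[of _ "w K q i"]
        by (intro mult_mono i(2) less_imp_le[OF K] \<open>q < N\<close> i(1)) auto
    qed
    then have "cmod (c i) \<le> (\<Sum>q<N. cmod (c i) * (1 / (2 * real N)))" unfolding ci .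
    also have "\<dots> = cmod (c i) / 2" using p by simp
    finally have "c i = 0" by simp
    then have "c q = 0" if "q \<le> N" for q
      using i(2)[of q] cN that by (cases "q = N") auto
    with c(1) show False by blast
  qed
  have "V (\<lambda>m. \<Sum>q<N. (- c q / c N) * w K q m)" by (intro comb Vw)
  moreover have "(\<Sum>m<N. P k m * (\<Sum>q<N. (- c q / c N) * w K q m)) = P k p" for k
  proof -
    have "(\<Sum>q<N. (- c q / c N) * w K q m) = (if m = p then 1 else 0)" if "m < N" for m
    proof -
      have "(\<Sum>q<N. (- c q / c N) * w K q m) = - (\<Sum>q<N. c q * w K q m) / c N"
        by (simp add: sum_divide_distrib sum_negf)
      also have "\<dots> = (if m = p then 1 else 0)"
        using rel[OF that] \<open>c N \<noteq> 0\<close> by (auto simp: add_eq_0_iff2)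
      finally show ?thesis .
    qed
    then have "(\<Sum>m<N. P k m * (\<Sum>q<N. (- c q / c N) * w K q m)) = (\<Sum>m<N. P k m * (if m = p then 1 else 0))"
      by (intro sum.cong) auto
    then show ?thesis using p by (simp add: if_distrib cong: if_cong)
  qed
  ultimately show ?thesis by (simp add: V_def)
qed

section \<open>Trigonometric series\<close>

text \<open>Normalised so that the exponentials of period \<open>L\<close> are orthonormal. It is
  used for one period of the process and for the interval of frequencies.\<close>

definition unif :: "real \<Rightarrow> real \<Rightarrow> real measure" where
  "unif a L = density lborel (\<lambda>x. ennreal (indicator {a..<a + L} x / L))"

lemma sets_unif [simp, measurable_cong]: "sets (unif a L) = sets borel"
  by (simp add: unif_def)

lemma space_unif [simp]: "space (unif a L) = UNIV"
  by (simp add: unif_def)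

lemma measurable_unif [simp]: "measurable (unif a L) N = measurable borel N"
  by (rule measurable_cong_sets) simp_all

context
  fixes a L :: real assumes L: "0 < L"
begin

lemma nn_integral_unif:
  assumes [measurable]: "g \<in> borel_measurable borel"
  shows "(\<integral>\<^sup>+x. g x \<partial>unif a L) = ennreal (1 / L) * (\<integral>\<^sup>+x\<in>{a..<a + L}. g x \<partial>lborel)"
proof -
  have "ennreal (indicator {a..<a + L} x / L) * g x = ennreal (1 / L) * (g x * indicator {a..<a + L} x)" for x
    by (auto simp: indicator_def mult.commute)
  then show ?thesis
    by (simp add: unif_def nn_integral_density nn_integral_cmult)
qed

lemma integrable_unif:
  fixes g :: "real \<Rightarrow> 'b::{banach, second_countable_topology}"
  assumes [measurable]: "g \<in> borel_measurable borel"
  shows "integrable (unif a L) g \<longleftrightarrow> set_integrable lborel {a..<a + L} g"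
proof -
  have "integrable (unif a L) g \<longleftrightarrow> integrable lborel (\<lambda>x. (1 / L) *\<^sub>R (indicator {a..<a + L} x *\<^sub>R g x))"
    using L by (simp add: unif_def integrable_density)
  also have "\<dots> \<longleftrightarrow> set_integrable lborel {a..<a + L} g"
    unfolding set_integrable_def
  proof
    assume "integrable lborel (\<lambda>x. (1 / L) *\<^sub>R (indicator {a..<a + L} x *\<^sub>R g x))"
    from integrable_scaleR_right[OF this, of L] show "integrable lborel (\<lambda>x. indicator {a..<a + L} x *\<^sub>R g x)"
      using L by simp
  qed (rule integrable_scaleR_right)
  finally show ?thesis .
qed

lemma integral_unif:
  fixes g :: "real \<Rightarrow> 'b::{banach, second_countable_topology}"
  assumes [measurable]: "g \<in> borel_measurable borel"
  shows "(LINT x|unif a L. g x) = (1 / L) *\<^sub>R (LINT x:{a..<a + L}|lborel. g x)"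
proof -
  have e: "(indicator {a..<a + L} x / L) *\<^sub>R g x = (1 / L) *\<^sub>R (indicator {a..<a + L} x *\<^sub>R g x)" for x
    by simp
  have "(LINT x|unif a L. g x) = (LINT x|lborel. (1 / L) *\<^sub>R (indicator {a..<a + L} x *\<^sub>R g x))"
    unfolding unif_def e[symmetric] using L by (intro integral_density) auto
  then show ?thesis unfolding set_lebesgue_integral_def by (simp only: integral_scaleR_right)
qed

lemma AE_unif: "(AE x in unif a L. P x) \<longleftrightarrow> (AE x in lborel. x \<in> {a..<a + L} \<longrightarrow> P x)"
  unfolding unif_def using L by (subst AE_density) (auto simp: indicator_def intro!: AE_cong)

lemma prob_space_unif: "prob_space (unif a L)"
proof (rule prob_spaceI)
  have "emeasure (unif a L) (space (unif a L)) = (\<integral>\<^sup>+x. 1 \<partial>unif a L)" by simp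
  also have "\<dots> = ennreal (1 / L) * ennreal L"
    using L by (subst nn_integral_unif) auto
  also have "\<dots> = 1" using L by (simp add: ennreal_mult[symmetric])
  finally show "emeasure (unif a L) (space (unif a L)) = 1" .
qed

end

lemma borel_measurable_cis [measurable]: "cis \<in> borel_measurable borel"
  by (intro borel_measurable_continuous_onI continuous_on_cis continuous_on_id)

lemma integral_cis_unif:
  assumes L: "0 < L"
  shows "(LINT x|unif a L. cis (2 * pi * of_int n * x / L)) = (if n = 0 then 1 else 0)"
proof (cases "n = 0")
  case True
  interpret prob_space "unif a L" by (rule prob_space_unif[OF L])
  show ?thesis using True by (simp add: prob_space[simplified])
next
  case False
  define c where "c = 2 * pi * of_int n / L"
  have c: "c \<noteq> 0" using False L by (simp add: c_def)
  let ?F = "\<lambda>x. cis (c * x) / (\<i> * of_real c)"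
  have "integral\<^sup>L lborel (\<lambda>x. indicator {a..a + L} x *\<^sub>R cis (c * x)) = ?F (a + L) - ?F a"
  proof (rule integral_FTC_atLeastAtMost)
    fix x
    have "((\<lambda>x. exp (\<i> * of_real c * of_real x) / (\<i> * of_real c)) has_vector_derivative
        exp (\<i> * of_real c * of_real x)) (at x within {a..a + L})"
      using c by (auto intro!: has_vector_derivative_real_field derivative_eq_intros)
    then show "(?F has_vector_derivative cis (c * x)) (at x within {a..a + L})"
      by (simp add: cis_conv_exp mult.assoc)
  qed (use L in \<open>auto intro!: continuous_intros\<close>)
  also have "cis (c * (a + L)) = cis (c * a)"
  proof -
    have "c * (a + L) = c * a + 2 * pi * of_int n" using L by (simp add: c_def field_simps)
    then show ?thesis by (simp add: cis_mult[symmetric] cis_multiple_2pi)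
  qed
  finally have "integral\<^sup>L lborel (\<lambda>x. indicator {a..a + L} x *\<^sub>R cis (c * x)) = 0" by simp
  also have "integral\<^sup>L lborel (\<lambda>x. indicator {a..a + L} x *\<^sub>R cis (c * x)) =
      integral\<^sup>L lborel (\<lambda>x. indicator {a..<a + L} x *\<^sub>R cis (c * x))"
    using AE_lborel_singleton[of "a + L"]
    by (intro integral_cong_AE) (auto simp: indicator_def elim!: eventually_mono)
  finally show ?thesis
    using False L by (subst integral_unif) (auto simp: set_lebesgue_integral_def c_def)
qed

lemma cis_orthonormal:
  assumes "0 < L"
  shows "ms_inner (unif a L) (\<lambda>x. cis (2 * pi * of_int i * x / L)) (\<lambda>x. cis (2 * pi * of_int j * x / L))
    = (if i = j then 1 else 0)"
proof -
  have "cis (2 * pi * of_int i * x / L) * cnj (cis (2 * pi * of_int j * x / L)) = cis (2 * pi * of_int (i - j) * x / L)" for x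
    by (simp add: cis_cnj cis_mult diff_divide_distrib algebra_simps)
  then show ?thesis
    using integral_cis_unif[OF assms, of a "i - j"] by (simp add: ms_inner_def)
qed

lemma sq_integrable_cis:
  assumes "0 < L" shows "sq_integrable (unif a L) (\<lambda>x. cis (c * x / L'))"
proof -
  interpret prob_space "unif a L" by (rule prob_space_unif[OF assms])
  show ?thesis by (rule sq_integrable_bounded[where C=1]) auto
qed

text \<open>Cauchy--Schwarz with the second sequence bounded through its finite sums, the form in
  which Bessel's inequality and its relatives provide the bound.\<close>

lemma l2_pairing:
  assumes a: "in_l2 a" and p: "\<And>K. (\<Sum>k<K. (cmod (p k))\<^sup>2) \<le> C\<^sup>2" and C: "0 \<le> C"
  shows "summable (\<lambda>k. cmod (a k) * cmod (p k))"
    and "(\<Sum>k. cmod (a k) * cmod (p k)) \<le> l2_norm a * C"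
    and "cmod (\<Sum>k. a k * p k) \<le> l2_norm a * C"
proof -
  have part: "(\<Sum>k<K. cmod (a k) * cmod (p k)) \<le> l2_norm a * C" for K
  proof -
    have "(\<Sum>k<K. \<bar>cmod (a k)\<bar> * \<bar>cmod (p k)\<bar>) \<le> L2_set (\<lambda>k. cmod (a k)) {..<K} * L2_set (\<lambda>k. cmod (p k)) {..<K}"
      by (rule L2_set_mult_ineq)
    also have "\<dots> \<le> l2_norm a * C"
    proof (rule mult_mono)
      show "L2_set (\<lambda>k. cmod (a k)) {..<K} \<le> l2_norm a"
        unfolding L2_set_def l2_norm_def using a
        by (intro real_sqrt_le_mono sum_le_suminf) (auto simp: in_l2_def)
      show "L2_set (\<lambda>k. cmod (p k)) {..<K} \<le> C"
        unfolding L2_set_def using p C by (intro real_le_lsqrt) auto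
      show "0 \<le> l2_norm a" unfolding l2_norm_def using a
        by (intro real_sqrt_ge_zero suminf_nonneg) (auto simp: in_l2_def)
    qed (rule L2_set_nonneg)
    finally show ?thesis by simp
  qed
  show s: "summable (\<lambda>k. cmod (a k) * cmod (p k))"
    by (rule bounded_imp_summable[of _ "l2_norm a * C"])
       (use part in \<open>auto simp: lessThan_Suc_atMost[symmetric] simp del: sum.lessThan_Suc\<close>)
  show le: "(\<Sum>k. cmod (a k) * cmod (p k)) \<le> l2_norm a * C"
    by (rule suminf_le_const[OF s part])
  have "cmod (\<Sum>k. a k * p k) \<le> (\<Sum>k. cmod (a k) * cmod (p k))"
    using s by (intro norm_suminf_le) (auto simp: norm_mult)
  with le show "cmod (\<Sum>k. a k * p k) \<le> l2_norm a * C" by simp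
qed

section \<open>Trigonometric polynomials and Parseval's identity\<close>

inductive trig_poly :: "(real \<Rightarrow> complex) \<Rightarrow> bool" where
  monomial: "trig_poly (\<lambda>t. c * cis (of_int n * t))"
| add: "trig_poly p \<Longrightarrow> trig_poly q \<Longrightarrow> trig_poly (\<lambda>t. p t + q t)"

lemma trig_poly_mult:
  assumes "trig_poly p" "trig_poly q"
  shows "trig_poly (\<lambda>t. p t * q t)"
  using assms(1)
proof induction
  case (monomial c n)
  show ?case using assms(2)
  proof induction
    case (monomial d m)
    have "(\<lambda>t. c * cis (of_int n * t) * (d * cis (of_int m * t))) = (\<lambda>t. (c * d) * cis (of_int (n + m) * t))"
      by (simp add: fun_eq_iff cis_mult algebra_simps)
    then show ?case by (simp only: trig_poly.monomial)
  next
    case (add p q)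
    then show ?case by (simp add: distrib_left trig_poly.add)
  qed
next
  case (add p p')
  then show ?case by (simp add: distrib_right trig_poly.add)
qed

lemma trig_poly_const: "trig_poly (\<lambda>t. c)"
  using trig_poly.monomial[of c 0] by simp

lemma trig_poly_bounded:
  assumes "trig_poly p" shows "\<exists>B. \<forall>t. cmod (p t) \<le> B"
  using assms
proof induction
  case (monomial c n)
  then show ?case by (intro exI[of _ "cmod c"]) (simp add: norm_mult)
next
  case (add p q)
  then obtain B B' where "\<And>t. cmod (p t) \<le> B" "\<And>t. cmod (q t) \<le> B'" by auto
  then have "cmod (p t + q t) \<le> B + B'" for t
    by (intro order_trans[OF norm_triangle_ineq] add_mono)
  then show ?case by blast
qed

lemma trig_poly_borel:
  assumes "trig_poly p" shows "p \<in> borel_measurable borel"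
  using assms by induction measurable

lemma trig_poly_of_real_polynomial:
  assumes "real_polynomial_function (q :: complex \<Rightarrow> real)"
  shows "trig_poly (\<lambda>t. of_real (q (cis t)))"
  using assms
proof induction
  case (linear q)
  then interpret q: bounded_linear q .
  define a b where "a = q 1" and "b = q \<i>"
  have q: "q (cis t) = a * cos t + b * sin t" for t
  proof -
    have "cis t = cos t *\<^sub>R 1 + sin t *\<^sub>R \<i>" by (simp add: complex_eq_iff)
    then show ?thesis by (simp add: q.add q.scaleR a_def b_def mult.commute)
  qed
  \<comment> \<open>Euler's formulas for \<open>cos\<close> and \<open>sin\<close>.\<close>
  have "complex_of_real (q (cis t)) = (of_real a / 2 - \<i> * of_real b / 2) * cis (of_int 1 * t)
      + (of_real a / 2 + \<i> * of_real b / 2) * cis (of_int (-1) * t)" for t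
    unfolding q by (simp add: complex_eq_iff field_simps)
  then show ?case by (simp only: trig_poly.intros)
next
  case (const c)
  then show ?case by (simp add: trig_poly_const)
next
  case (add f g)
  then show ?case by (simp add: trig_poly.add)
next
  case (mult f g)
  then show ?case by (simp add: trig_poly_mult)
qed

lemma trig_poly_of_polynomial:
  assumes "polynomial_function (g :: complex \<Rightarrow> complex)"
  shows "trig_poly (\<lambda>t. g (cis t))"
proof -
  have "real_polynomial_function (\<lambda>z. Re (g z))" "real_polynomial_function (\<lambda>z. Im (g z))"
    using assms unfolding polynomial_function_iff_Basis_inner by (auto simp: Basis_complex_def)
  then have "trig_poly (\<lambda>t. of_real (Re (g (cis t))) + \<i> * of_real (Im (g (cis t))))"
    by (intro trig_poly.add trig_poly_mult trig_poly_const trig_poly_of_real_polynomial)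
  then show ?thesis by (simp add: complex_eq[symmetric])
qed

text \<open>Stone--Weierstrass on the unit circle, where polynomials restrict to trigonometric
  polynomials. The function \<open>c\<close> is carried to the circle by the argument, which jumps
  at 1; since \<open>c\<close> vanishes near both ends of the period, the transported function is
  continuous there too.\<close>

lemma trig_poly_approx:
  assumes c: "continuous_on {0..T} c" and T: "0 < T" and e: "0 < e"
    and \<delta>: "0 < \<delta>" "\<And>u. 0 \<le> u \<Longrightarrow> u \<le> T \<Longrightarrow> u < \<delta> \<or> T - \<delta> < u \<Longrightarrow> c u = 0"
  shows "\<exists>p. trig_poly p \<and> (\<forall>u\<in>{0..<T}. cmod (c u - p (2 * pi * u / T)) < e)"
proof -
  define F where "F z = c (T * Arg2pi z / (2 * pi))" for z
  have range: "T * Arg2pi z / (2 * pi) \<in> {0..<T}" for z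
    using Arg2pi[of z] T by (auto simp: field_simps)
  have F_cis: "F (cis (2 * pi * u / T)) = c u" if "u \<in> {0..<T}" for u
  proof -
    have "Arg2pi (cis (2 * pi * u / T)) = 2 * pi * u / T"
      using that T Arg2pi_exp[of "\<i> * of_real (2 * pi * u / T)"] by (simp add: cis_conv_exp field_simps)
    then show ?thesis using T by (simp add: F_def)
  qed
  have "continuous_on (sphere 0 1) F"
    unfolding continuous_on_eq_continuous_within
  proof
    fix z :: complex assume z: "z \<in> sphere 0 1"
    show "continuous (at z within sphere 0 1) F"
    proof (cases "z = 1")
      case False
      have "z \<notin> \<real>\<^sub>\<ge>\<^sub>0"
      proof
        assume "z \<in> \<real>\<^sub>\<ge>\<^sub>0"
        then have *: "0 \<le> Re z" "Im z = 0" by (auto simp: complex_nonneg_Reals_iff)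
        then have "Re z = 1" using z by (simp add: cmod_eq_Re)
        with * False show False by (simp add: complex_eq_iff)
      qed
      then have "continuous (at z within sphere 0 1) Arg2pi"
        by (rule continuous_at_imp_continuous_within[OF continuous_at_Arg2pi])
      then have "(Arg2pi \<longlongrightarrow> Arg2pi z) (at z within sphere 0 1)"
        by (simp add: continuous_within)
      then have cA: "((\<lambda>z. T * Arg2pi z / (2 * pi)) \<longlongrightarrow> T * Arg2pi z / (2 * pi)) (at z within sphere 0 1)"
        by (rule tendsto_divide[OF tendsto_mult[OF tendsto_const] tendsto_const]) simp
      have "T * Arg2pi w / (2 * pi) \<in> {0..T}" for w using range[of w] by simp
      then show ?thesis
        unfolding continuous_within F_def
        by (intro continuous_on_tendsto_compose[OF c cA] always_eventually allI)
    next
      case True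
      \<comment> \<open>The angle that corresponds to the margin \<open>\<delta>\<close>, capped so
        that it stays below \<open>pi\<close>. Points of the circle with real part above
        \<open>cos \<eta>\<close> then have argument within \<open>\<eta>\<close> of 0 or
        \<open>2 pi\<close>.\<close>
      define \<eta> where "\<eta> = min (2 * pi * \<delta> / T) (pi / 2)"
      have \<eta>: "0 < \<eta>" "\<eta> < pi" "T * \<eta> / (2 * pi) \<le> \<delta>"
      proof -
        show "0 < \<eta>" "\<eta> < pi" using \<delta> T pi_gt_zero unfolding \<eta>_def by (auto simp: min_less_iff_disj simp del: pi_gt_zero)
        have "\<eta> \<le> 2 * pi * \<delta> / T" by (simp add: \<eta>_def)
        then show "T * \<eta> / (2 * pi) \<le> \<delta>" using T by (simp add: field_simps)
      qed
      have F0: "F w = 0" if w: "w \<in> sphere 0 1" "cos \<eta> < Re w" for w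
      proof -
        have Rew: "Re w = cos (Arg2pi w)" using cos_Arg2pi[of w] w by simp
        have "Arg2pi w < \<eta> \<or> 2 * pi - \<eta> < Arg2pi w"
        proof (rule ccontr)
          assume "\<not> ?thesis"
          then have *: "\<eta> \<le> Arg2pi w" "Arg2pi w \<le> 2 * pi - \<eta>" by auto
          have "cos (Arg2pi w) \<le> cos \<eta>"
          proof (cases "Arg2pi w \<le> pi")
            case True
            then show ?thesis using * \<eta> by (intro cos_monotone_0_pi_le) auto
          next
            case False
            have "cos (2 * pi - Arg2pi w) \<le> cos \<eta>"
              using * \<eta> False by (intro cos_monotone_0_pi_le) auto
            then show ?thesis by (simp add: cos_diff)
          qed
          then show False using Rew w by simp
        qed
        then have "T * Arg2pi w / (2 * pi) < \<delta> \<or> T - \<delta> < T * Arg2pi w / (2 * pi)"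
        proof
          assume "Arg2pi w < \<eta>"
          then have "T * Arg2pi w / (2 * pi) < T * \<eta> / (2 * pi)"
            using T by (intro divide_strict_right_mono mult_strict_left_mono) auto
          then show ?thesis using \<eta> by simp
        next
          assume "2 * pi - \<eta> < Arg2pi w"
          then have "T * (2 * pi - \<eta>) / (2 * pi) < T * Arg2pi w / (2 * pi)"
            using T by (intro divide_strict_right_mono mult_strict_left_mono) auto
          moreover have "T * (2 * pi - \<eta>) / (2 * pi) = T - T * \<eta> / (2 * pi)"
            by (simp add: right_diff_distrib diff_divide_distrib)
          ultimately show ?thesis using \<eta> by simp
        qed
        then show ?thesis unfolding F_def using range[of w] by (intro \<delta>(2)) auto
      qed
      have "cos \<eta> < 1" using \<eta> cos_monotone_0_pi[of 0 \<eta>] by simp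
      then have "\<forall>\<^sub>F w in at z within sphere 0 1. cos \<eta> < Re w"
        using True by (intro order_tendstoD(1)[of Re "1::real"]) (auto intro!: tendsto_eq_intros)
      moreover have "\<forall>\<^sub>F w in at z within sphere 0 1. w \<in> sphere 0 1"
        by (simp add: eventually_at_filter)
      ultimately have "\<forall>\<^sub>F w in at z within sphere 0 1. F w = 0"
        by eventually_elim (rule F0)
      then show ?thesis
        unfolding continuous_within using F0[OF z] True \<open>cos \<eta> < 1\<close>
        by (simp add: tendsto_eventually)
    qed
  qed
  from Stone_Weierstrass_polynomial_function[OF compact_sphere this e] obtain g
    where g: "polynomial_function g" "\<And>z. z \<in> sphere 0 1 \<Longrightarrow> norm (F z - g z) < e" by blast
  show ?thesis
  proof (intro exI conjI ballI)
    show "trig_poly (\<lambda>t. g (cis t))" by (rule trig_poly_of_polynomial[OF g(1)])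
    fix u assume "u \<in> {0..<T}"
    then show "cmod (c u - g (cis (2 * pi * u / T))) < e"
      using g(2)[of "cis (2 * pi * u / T)"] by (simp add: F_cis)
  qed
qed

text \<open>Both sides are linear in \<open>c\<close> and bounded by a constant times its supremum:
  the integral because \<open>\<alpha>\<close> is integrable, the series because the coefficients
  are square summable and by Bessel's inequality. They agree on trigonometric polynomials, hence on
  continuous functions that vanish near the ends of the period, and cut-offs of \<open>c\<close>
  lead to \<open>c\<close> itself.\<close>

lemma Parseval_L1:
  fixes T :: real and \<alpha> c :: "real \<Rightarrow> complex" and \<nu> :: "nat \<Rightarrow> int"
  defines "e \<equiv> (\<lambda>k u. cis (2 * pi * of_int (\<nu> k) * u / T))"
  assumes T: "0 < T" and \<nu>: "bij \<nu>" and \<alpha>: "integrable (unif 0 T) \<alpha>"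
    and l2: "in_l2 (\<lambda>k. LINT u|unif 0 T. \<alpha> u * e k u)"
    and c: "continuous_on UNIV c" "\<And>u. cmod (c u) \<le> B"
  shows "(\<lambda>k. (LINT u|unif 0 T. \<alpha> u * e k u) * ms_inner (unif 0 T) c (e k)) sums (LINT u|unif 0 T. \<alpha> u * c u)"
proof -
  define U where "U = unif 0 T"
  define b where "b k = (LINT u|U. \<alpha> u * e k u)" for k
  define J where "J g = (LINT u|U. \<alpha> u * g u)" for g
  define S where "S g = (\<Sum>k. b k * ms_inner U g (e k))" for g
  define C where "C = (LINT u|U. cmod (\<alpha> u)) + l2_norm b"
  interpret prob_space U unfolding U_def by (rule prob_space_unif[OF T])
  have [simp]: "measurable U N = measurable borel N" for N :: "complex measure"
    by (simp add: U_def)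
  have \<alpha>U: "integrable U \<alpha>" using \<alpha> by (simp add: U_def)
  have [measurable]: "\<alpha> \<in> borel_measurable borel" using borel_measurable_integrable[OF \<alpha>U] by simp
  have [measurable]: "c \<in> borel_measurable borel" by (rule borel_measurable_continuous_onI[OF c(1)])
  have b: "in_l2 b" using l2 by (simp add: b_def[abs_def] U_def)
  have e_sq: "sq_integrable U (e k)" for k
    unfolding U_def e_def by (rule sq_integrable_cis[OF T])
  have orth: "ms_inner U (e i) (e j) = (if i = j then 1 else 0)" for i j
    unfolding U_def e_def cis_orthonormal[OF T] using bij_is_inj[OF \<nu>] by (simp add: inj_eq)
  have inU: "AE u in U. u \<in> {0..<T}" unfolding U_def AE_unif[OF T] by simp
  have Bes: "(\<Sum>k<K. (cmod (ms_inner U g (e k)))\<^sup>2) \<le> (sqrt (ms_norm2 U g))\<^sup>2" if "sq_integrable U g" for g K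
    using ms_Bessel[OF finite_lessThan e_sq that orth] by simp
  have S_sum: "summable (\<lambda>k. b k * ms_inner U g (e k))"
    and S_le: "cmod (S g) \<le> l2_norm b * sqrt (ms_norm2 U g)" if "sq_integrable U g" for g
    using l2_pairing[OF b Bes[OF that]] summable_norm_cancel[of "\<lambda>k. b k * ms_inner U g (e k)"]
    by (auto simp: S_def norm_mult)
  have sq: "sq_integrable U g" if "g \<in> borel_measurable borel" "\<And>u. cmod (g u) \<le> D" for g D
    using that by (intro sq_integrable_bounded[where C=D]) auto
  have mult_le: "cmod (x * y) \<le> d * cmod x" if "cmod y \<le> d" for x y :: complex and d
    using mult_right_mono[OF that norm_ge_zero[of x]] by (simp add: norm_mult mult.commute)
  have J_int: "integrable U (\<lambda>u. \<alpha> u * g u)" if g: "g \<in> borel_measurable borel" "\<And>u. cmod (g u) \<le> D" for g D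
  proof (rule Bochner_Integration.integrable_bound)
    show "integrable U (\<lambda>u. D * cmod (\<alpha> u))" using \<alpha>U by simp
    show "(\<lambda>u. \<alpha> u * g u) \<in> borel_measurable U" using g(1) by simp
    have "0 \<le> D" using g(2)[of 0] norm_ge_zero order_trans by blast
    then show "AE u in U. norm (\<alpha> u * g u) \<le> norm (D * cmod (\<alpha> u))"
      using mult_le[OF g(2)] by (intro always_eventually allI) (simp add: abs_mult)
  qed
  have diff: "J (\<lambda>u. g u - h u) = J g - J h" "S (\<lambda>u. g u - h u) = S g - S h"
    if "g \<in> borel_measurable borel" "\<And>u. cmod (g u) \<le> D" "h \<in> borel_measurable borel" "\<And>u. cmod (h u) \<le> D'" for g h D D'
    using J_int[of g D] J_int[of h D'] S_sum[OF sq[of g D]] S_sum[OF sq[of h D']] sq[of g D] sq[of h D'] that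
    by (auto simp: J_def S_def right_diff_distrib ms_inner_diff_left e_sq suminf_diff)
  have plus: "J (\<lambda>u. g u + h u) = J g + J h" "S (\<lambda>u. g u + h u) = S g + S h"
    if "g \<in> borel_measurable borel" "\<And>u. cmod (g u) \<le> D" "h \<in> borel_measurable borel" "\<And>u. cmod (h u) \<le> D'" for g h D D'
    using J_int[of g D] J_int[of h D'] S_sum[OF sq[of g D]] S_sum[OF sq[of h D']] sq[of g D] sq[of h D'] that
    by (auto simp: J_def S_def distrib_left ms_inner_add_left e_sq suminf_add)
  \<comment> \<open>The estimate needs a bound \<open>d\<close> only on one period, where the
    measure lives; the global bound \<open>D\<close> just secures integrability. The approximating
    polynomial is close to \<open>g\<close> only on the period.\<close>
  have bound: "cmod (J g) + cmod (S g) \<le> C * d"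
    if g: "g \<in> borel_measurable borel" "\<And>u. cmod (g u) \<le> D" "\<And>u. u \<in> {0..<T} \<Longrightarrow> cmod (g u) \<le> d" "0 \<le> d" for g D d
  proof -
    have AEd: "AE u in U. cmod (g u) \<le> d" using inU by eventually_elim (rule g(3))
    have "cmod (J g) \<le> (LINT u|U. cmod (\<alpha> u * g u))"
      unfolding J_def by (rule integral_norm_bound)
    also have "\<dots> \<le> (LINT u|U. d * cmod (\<alpha> u))"
    proof (rule integral_mono_AE)
      show "integrable U (\<lambda>u. cmod (\<alpha> u * g u))" by (intro integrable_norm J_int[OF g(1,2)])
      show "integrable U (\<lambda>u. d * cmod (\<alpha> u))" using \<alpha>U by simp
      show "AE u in U. cmod (\<alpha> u * g u) \<le> d * cmod (\<alpha> u)"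
        using AEd by eventually_elim (rule mult_le)
    qed
    finally have 1: "cmod (J g) \<le> d * (LINT u|U. cmod (\<alpha> u))" by simp
    have "ms_norm2 U g \<le> (LINT u|U. d\<^sup>2)"
      unfolding ms_norm2_def
    proof (rule integral_mono_AE)
      show "integrable U (\<lambda>u. (cmod (g u))\<^sup>2)" using sq[OF g(1,2)] by (simp add: sq_integrable_def)
      show "AE u in U. (cmod (g u))\<^sup>2 \<le> d\<^sup>2"
        using AEd by eventually_elim (simp add: power_mono)
    qed simp
    then have "sqrt (ms_norm2 U g) \<le> d" using g(4) by (intro real_le_lsqrt) (simp_all add: prob_space)
    then have "l2_norm b * sqrt (ms_norm2 U g) \<le> l2_norm b * d"
      using b by (intro mult_left_mono) (auto simp: l2_norm_def in_l2_def intro!: real_sqrt_ge_zero suminf_nonneg)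
    with S_le[OF sq[OF g(1,2)]] 1 show ?thesis by (simp add: C_def algebra_simps)
  qed
  have C0: "0 \<le> C"
    using b unfolding C_def l2_norm_def in_l2_def
    by (intro add_nonneg_nonneg real_sqrt_ge_zero suminf_nonneg Bochner_Integration.integral_nonneg) auto
  have trig: "J (\<lambda>u. p (2 * pi * u / T)) = S (\<lambda>u. p (2 * pi * u / T))" if "trig_poly p" for p
    using that
  proof induction
    case (monomial a n)
    obtain k where k: "\<nu> k = n" using bij_is_surj[OF \<nu>] by (metis surjD)
    have eq: "(\<lambda>u. a * cis (of_int n * (2 * pi * u / T))) = (\<lambda>u. a * e k u)"
      by (simp add: e_def k mult_ac)
    have "S (\<lambda>u. a * e k u) = (\<Sum>j. if j = k then b k * a else 0)"
      unfolding S_def by (intro suminf_cong) (simp add: ms_inner_cmult_left orth)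
    also have "\<dots> = a * b k"
      using sums_single[of k "\<lambda>_. b k * a"] by (simp add: sums_iff)
    also have "\<dots> = J (\<lambda>u. a * e k u)"
      unfolding J_def b_def by (simp add: mult.left_commute)
    finally show ?case unfolding eq by simp
  next
    case (add p q)
    obtain D D' where D: "\<And>t. cmod (p t) \<le> D" "\<And>t. cmod (q t) \<le> D'"
      using trig_poly_bounded[OF add(1)] trig_poly_bounded[OF add(2)] by auto
    have pq: "(\<lambda>u. p (2 * pi * u / T)) \<in> borel_measurable borel" "(\<lambda>u. q (2 * pi * u / T)) \<in> borel_measurable borel"
      by (intro measurable_compose[OF _ trig_poly_borel] add(1,2); simp)+
    show ?case using add.IH by (simp add: plus[OF pq(1) D(1) pq(2) D(2)])
  qed
  have approx: "J g = S g"
    if g: "continuous_on UNIV g" "\<And>u. cmod (g u) \<le> D"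
      and \<delta>: "0 < \<delta>" "\<And>u. 0 \<le> u \<Longrightarrow> u \<le> T \<Longrightarrow> u < \<delta> \<or> T - \<delta> < u \<Longrightarrow> g u = 0" for g D \<delta>
  proof -
    have "cmod (J g - S g) \<le> 0 + d" if d: "0 < d" for d
    proof -
      \<comment> \<open>\<open>C\<close> may vanish, so the tolerance is divided by
        \<open>C + 1\<close>.\<close>
      have dC: "0 < d / (C + 1)" using d C0 by simp
      from trig_poly_approx[OF continuous_on_subset[OF g(1)] T dC \<delta>] obtain p
        where p: "trig_poly p" "\<And>u. u \<in> {0..<T} \<Longrightarrow> cmod (g u - p (2 * pi * u / T)) < d / (C + 1)" by auto
      let ?p = "\<lambda>u. p (2 * pi * u / T)"
      obtain D' where D': "\<And>t. cmod (p t) \<le> D'" using trig_poly_bounded[OF p(1)] by auto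
      have pb: "?p \<in> borel_measurable borel"
        by (intro measurable_compose[OF _ trig_poly_borel[OF p(1)]]) simp
      have gb: "g \<in> borel_measurable borel" by (rule borel_measurable_continuous_onI[OF g(1)])
      have gp: "(\<lambda>u. g u - ?p u) \<in> borel_measurable borel" by (rule borel_measurable_diff[OF gb pb])
      have D'': "cmod (g u - ?p u) \<le> D + D'" for u
        using norm_triangle_ineq4[of "g u" "?p u"] g(2)[of u] D'[of "2 * pi * u / T"] by simp
      have near: "cmod (g u - ?p u) \<le> d / (C + 1)" if "u \<in> {0..<T}" for u
        using p(2)[OF that] by simp
      have eq: "J g - S g = J (\<lambda>u. g u - ?p u) - S (\<lambda>u. g u - ?p u)"
        using diff[OF gb g(2) pb D'] trig[OF p(1)] by simp
      have "cmod (J g - S g) \<le> cmod (J (\<lambda>u. g u - ?p u)) + cmod (S (\<lambda>u. g u - ?p u))"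
        unfolding eq by (rule norm_triangle_ineq4)
      also have "\<dots> \<le> C * (d / (C + 1))"
      proof (rule bound[of "\<lambda>u. g u - ?p u" "D + D'" "d / (C + 1)"])
        show "(\<lambda>u. g u - ?p u) \<in> borel_measurable borel" by (rule gp)
        show "cmod (g u - ?p u) \<le> D + D'" for u by (rule D'')
        show "cmod (g u - ?p u) \<le> d / (C + 1)" if "u \<in> {0..<T}" for u by (rule near[OF that])
        show "0 \<le> d / (C + 1)" by (rule less_imp_le[OF dC])
      qed
      also have "\<dots> \<le> d" using d C0 by (simp add: field_simps)
      finally show ?thesis by simp
    qed
    then have "cmod (J g - S g) \<le> 0" by (rule field_le_epsilon)
    then show ?thesis by simp
  qed
  \<comment> \<open>For \<open>n > 0\<close> a piecewise linear cut-off: zero within distance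
    \<open>1/n\<close> of the ends of the period, one inside from distance \<open>2/n\<close>
    on.\<close>
  define \<kappa> where "\<kappa> n u = max 0 (min 1 (real n * min u (T - u) - 1))" for n u
  define g where "g n u = c u * of_real (\<kappa> n u)" for n u
  have \<kappa>: "0 \<le> \<kappa> n u" "\<kappa> n u \<le> 1" for n u by (auto simp: \<kappa>_def)
  have B0: "0 \<le> B" using c(2)[of 0] norm_ge_zero order_trans by blast
  have g_le: "cmod (g n u) \<le> B" for n u
    using mult_mono[OF c(2)[of u] \<kappa>(2)[of n u] B0 \<kappa>(1)] \<kappa>(1)[of n u] by (simp add: g_def norm_mult)
  have g_cont: "continuous_on UNIV (g n)" for n
    unfolding g_def \<kappa>_def by (intro continuous_intros c(1))
  have gb: "g n \<in> borel_measurable borel" for n by (rule borel_measurable_continuous_onI[OF g_cont])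
  have g_eq: "J (g (Suc n)) = S (g (Suc n))" for n
  proof (rule approx[OF g_cont g_le])
    show "0 < 1 / real (Suc n)" by simp
    fix u assume "u < 1 / real (Suc n) \<or> T - 1 / real (Suc n) < u"
    then have "min u (T - u) < 1 / real (Suc n)" by auto
    then have "real (Suc n) * min u (T - u) < 1" by (simp add: field_simps del: of_nat_Suc)
    then show "g (Suc n) u = 0" by (simp add: g_def \<kappa>_def del: of_nat_Suc)
  qed
  have lim: "AE u in U. (\<lambda>n. g (Suc n) u) \<longlonglongrightarrow> c u"
  proof -
    have "AE u in U. u \<noteq> 0"
      unfolding U_def AE_unif[OF T] using AE_lborel_singleton[of 0] by eventually_elim simp
    with inU show ?thesis
    proof eventually_elim
      case (elim u)
      then have m: "0 < min u (T - u)" by auto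
      obtain n0 where n0: "2 / min u (T - u) \<le> real n0" using real_arch_simple by blast
      have "g (Suc n) u = c u" if "n0 \<le> n" for n
      proof -
        have "2 / min u (T - u) \<le> real (Suc n)" using n0 that by simp
        then have "2 \<le> real (Suc n) * min u (T - u)" using m by (simp only: pos_divide_le_eq)
        then show ?thesis by (simp add: g_def \<kappa>_def del: of_nat_Suc)
      qed
      then show ?case by (intro tendsto_eventually) (auto simp: eventually_sequentially)
    qed
  qed
  have "(\<lambda>n. J (g (Suc n))) \<longlonglongrightarrow> J c"
    unfolding J_def
  proof (rule integral_dominated_convergence)
    show "integrable U (\<lambda>u. B * cmod (\<alpha> u))" using \<alpha>U by simp
    show "AE u in U. (\<lambda>n. \<alpha> u * g (Suc n) u) \<longlonglongrightarrow> \<alpha> u * c u"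
      using lim by eventually_elim (rule tendsto_mult_left)
    show "AE u in U. norm (\<alpha> u * g (Suc n) u) \<le> B * cmod (\<alpha> u)" for n
      by (intro always_eventually allI mult_le g_le)
    show "(\<lambda>u. \<alpha> u * g (Suc n) u) \<in> borel_measurable U" for n using gb by simp
  qed simp
  \<comment> \<open>The series is bounded by a multiple of the mean square norm, so dominated
    convergence is applied to the squared differences of \<open>c\<close> and its cut-offs.\<close>
  moreover have "(\<lambda>n. S (g (Suc n))) \<longlonglongrightarrow> S c"
  proof -
    have le: "cmod (c u - g n u) \<le> B" for n u
    proof -
      have "cmod (c u - g n u) = cmod (c u) * (1 - \<kappa> n u)"
      proof -
        have "c u - g n u = c u * of_real (1 - \<kappa> n u)" by (simp add: g_def right_diff_distrib)
        then show ?thesis using \<kappa>[of n u] by (simp add: norm_mult del: of_real_diff)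
      qed
      also have "\<dots> \<le> B * 1" using \<kappa>[of n u] B0 c(2) by (intro mult_mono) auto
      finally show ?thesis by simp
    qed
    have "(\<lambda>n. ms_norm2 U (\<lambda>u. c u - g (Suc n) u)) \<longlonglongrightarrow> (LINT u|U. 0)"
      unfolding ms_norm2_def
    proof (rule integral_dominated_convergence)
      show "integrable U (\<lambda>u. B\<^sup>2)" by simp
      show "AE u in U. (\<lambda>n. (cmod (c u - g (Suc n) u))\<^sup>2) \<longlonglongrightarrow> 0"
        using lim
      proof eventually_elim
        case (elim u)
        from tendsto_power[OF tendsto_norm[OF tendsto_diff[OF tendsto_const[of "c u"] elim]], of 2]
        show ?case by simp
      qed
      show "AE u in U. norm ((cmod (c u - g (Suc n) u))\<^sup>2) \<le> B\<^sup>2" for n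
        by (intro always_eventually allI) (simp add: power_mono le)
      have [measurable]: "g n \<in> borel_measurable borel" for n by (rule gb)
      show "(\<lambda>u. (cmod (c u - g (Suc n) u))\<^sup>2) \<in> borel_measurable U" for n
        unfolding U_def measurable_unif by measurable
    qed simp
    then have to0: "(\<lambda>n. l2_norm b * sqrt (ms_norm2 U (\<lambda>u. c u - g (Suc n) u))) \<longlonglongrightarrow> 0"
      using tendsto_mult_left[OF tendsto_real_sqrt, of _ 0 _ "l2_norm b"] by simp
    have sqd: "sq_integrable U (\<lambda>u. c u - g (Suc n) u)" for n
      by (rule sq[of _ B]) (use gb le in auto)
    have "(\<lambda>n. S c - S (g (Suc n))) \<longlonglongrightarrow> 0"
    proof (rule Lim_null_comparison[OF always_eventually to0], rule allI)
      fix n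
      have "S c - S (g (Suc n)) = S (\<lambda>u. c u - g (Suc n) u)"
        using diff(2)[of c B "g (Suc n)" B] c(2) gb g_le by simp
      then show "norm (S c - S (g (Suc n))) \<le> l2_norm b * sqrt (ms_norm2 U (\<lambda>u. c u - g (Suc n) u))"
        using S_le[OF sqd[of n]] by simp
    qed
    then show ?thesis by (rule Lim_transform2[OF tendsto_const])
  qed
  ultimately have "J c = S c"
    unfolding g_eq by (rule LIMSEQ_unique)
  then show ?thesis
    using summable_sums[OF S_sum[OF sq[of c B]]] c(2) by (simp add: S_def J_def b_def U_def)
qed

text \<open>The integer frequencies of the basis functions in the order 0, 1, -1, 2, -2, and so
  on.\<close>

definition freq_index :: "nat \<Rightarrow> int" where
  "freq_index k = (- 1) ^ (k + 1) * int ((k + 1) div 2)"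

lemma freq_index_simps:
  "freq_index 0 = 0" "freq_index (2 * n + 1) = int n + 1" "freq_index (2 * n + 2) = - int n - 1"
  by (simp_all add: freq_index_def)

lemma nat_parity_cases:
  obtains "k = 0" | n where "k = 2 * n + 1" | n where "k = 2 * n + (2::nat)"
proof -
  consider "k = 0" | n where "k = Suc (2 * n)" | n where "k = Suc (Suc (2 * n))"
    by (metis even_Suc_div_two oddE evenE not0_implies_Suc Suc_eq_plus1 mult_Suc_right mult_2 add_2_eq_Suc not_gr_zero mult_0_right)
  then show thesis using that by cases auto
qed

lemma bij_freq_index: "bij freq_index"
proof (rule bijI)
  show "inj freq_index"
  proof (rule injI)
    fix i j assume "freq_index i = freq_index j"
    then show "i = j"
      by (cases i rule: nat_parity_cases; cases j rule: nat_parity_cases) (auto simp: freq_index_simps[simplified])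
  qed
  show "surj freq_index"
  proof (rule surjI)
    fix n :: int
    show "freq_index (if n = 0 then 0 else if 0 < n then 2 * nat (n - 1) + 1 else 2 * nat (- n - 1) + 2) = n"
      using freq_index_simps by auto
  qed
qed

lemma freq_index_coef_perm: "freq_index (coef_perm k) = - freq_index k"
  by (cases k rule: nat_parity_cases) (auto simp: freq_index_def coef_perm_def)

lemma basis_fn_eq: "basis_fn T k u = of_real (1 / sqrt T) * cis (2 * pi * of_int (freq_index k) * u / T)"
  by (simp add: basis_fn_def freq_index_def)

text \<open>Conjugation and the permutation both negate the frequency, so the two cancel. Hence
  \<open>avec\<close> integrates against \<open>basis_fn T k\<close> itself and \<open>z\<close>
  against its conjugate, which is what the pairing without conjugation in \<open>a_j^T z_j\<close>
  requires.\<close>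

lemma cnj_basis_fn_coef_perm: "cnj (basis_fn T (coef_perm k) u) = basis_fn T k u"
  by (simp add: basis_fn_eq freq_index_coef_perm cis_cnj)

section \<open>Mean square integrals\<close>

lemma simple_ms_Cons:
  "simple_ms ((B, X) # xs) t = (\<lambda>w. indicator B t * X w + simple_ms xs t w)"
  "simple_ms_integral ((B, X) # xs) = (\<lambda>w. of_real (measure lborel B) * X w + simple_ms_integral xs w)"
  by (simp_all add: simple_ms_def simple_ms_integral_def fun_eq_iff)

lemma simple_ms_Nil: "simple_ms [] t = (\<lambda>w. 0)" "simple_ms_integral [] = (\<lambda>w. 0)"
  by (simp_all add: simple_ms_def simple_ms_integral_def fun_eq_iff)

lemma simple_ms_inner:
  assumes "\<forall>(B, Y)\<in>set xs. B \<in> sets lborel \<and> emeasure lborel B < \<infinity> \<and> sq_integrable \<Omega> Y"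
    and W: "sq_integrable \<Omega> W"
  shows "sq_integrable \<Omega> (simple_ms xs t)" "sq_integrable \<Omega> (simple_ms_integral xs)"
    and "integrable lborel (\<lambda>t. ms_inner \<Omega> (simple_ms xs t) W)"
    and "(LINT t|lborel. ms_inner \<Omega> (simple_ms xs t) W) = ms_inner \<Omega> (simple_ms_integral xs) W"
proof -
  have "(\<forall>t. sq_integrable \<Omega> (simple_ms xs t)) \<and> sq_integrable \<Omega> (simple_ms_integral xs)
    \<and> integrable lborel (\<lambda>t. ms_inner \<Omega> (simple_ms xs t) W)
    \<and> (LINT t|lborel. ms_inner \<Omega> (simple_ms xs t) W) = ms_inner \<Omega> (simple_ms_integral xs) W"
    using assms(1)
  proof (induction xs)
    case Nil
    then show ?case by (simp add: simple_ms_Nil)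
  next
    case (Cons p xs)
    obtain B Y where p: "p = (B, Y)" by (cases p)
    have B: "B \<in> sets lborel" "emeasure lborel B < \<infinity>" "sq_integrable \<Omega> Y"
      and xs: "\<And>t. sq_integrable \<Omega> (simple_ms xs t)" "sq_integrable \<Omega> (simple_ms_integral xs)"
        "integrable lborel (\<lambda>t. ms_inner \<Omega> (simple_ms xs t) W)"
        "(LINT t|lborel. ms_inner \<Omega> (simple_ms xs t) W) = ms_inner \<Omega> (simple_ms_integral xs) W"
      using Cons by (auto simp: p)
    have ind: "integrable lborel (\<lambda>t. complex_of_real (indicator B t))"
      using B by (intro integrable_of_real integrable_real_indicator)
    have eq: "ms_inner \<Omega> (simple_ms (p # xs) t) W = indicator B t * ms_inner \<Omega> Y W + ms_inner \<Omega> (simple_ms xs t) W" for t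
      unfolding p simple_ms_Cons
      by (simp add: ms_inner_add_left[OF sq_integrable_cmult[OF B(3)] xs(1) W] ms_inner_cmult_left)
    have ind': "integrable lborel (\<lambda>t. indicator B t * ms_inner \<Omega> Y W)"
      using ind unfolding of_real_indicator by simp
    have "(LINT t|lborel. complex_of_real (indicator B t)) = of_real (measure lborel B)"
      unfolding integral_complex_of_real using B by simp
    then have "(LINT t|lborel. indicator B t * ms_inner \<Omega> Y W) = of_real (measure lborel B) * ms_inner \<Omega> Y W"
      unfolding of_real_indicator by (simp only: integral_mult_left_zero)
    then have "(LINT t|lborel. ms_inner \<Omega> (simple_ms (p # xs) t) W) = ms_inner \<Omega> (simple_ms_integral (p # xs)) W"
      unfolding eq using ind' xs
      by (simp add: p simple_ms_Cons ms_inner_add_left[OF sq_integrable_cmult[OF B(3)] xs(2) W] ms_inner_cmult_left)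
    moreover have "integrable lborel (\<lambda>t. ms_inner \<Omega> (simple_ms (p # xs) t) W)"
      unfolding eq using ind' xs(3) by (rule Bochner_Integration.integrable_add)
    moreover have "sq_integrable \<Omega> (simple_ms (p # xs) t)" for t
      unfolding p simple_ms_Cons by (rule sq_integrable_add[OF sq_integrable_cmult[OF B(3)] xs(1)])
    moreover have "sq_integrable \<Omega> (simple_ms_integral (p # xs))"
      unfolding p simple_ms_Cons by (rule sq_integrable_add[OF sq_integrable_cmult[OF B(3)] xs(2)])
    ultimately show ?case by blast
  qed
  then show "sq_integrable \<Omega> (simple_ms xs t)" "sq_integrable \<Omega> (simple_ms_integral xs)"
    "integrable lborel (\<lambda>t. ms_inner \<Omega> (simple_ms xs t) W)"
    "(LINT t|lborel. ms_inner \<Omega> (simple_ms xs t) W) = ms_inner \<Omega> (simple_ms_integral xs) W"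
    by blast+
qed

text \<open>Against a fixed \<open>W\<close> the error of the approximating step functions is at
  most the norm of \<open>W\<close> times the integral of their distance to \<open>X\<close>, so the
  identity passes from step functions to the limit.\<close>

lemma has_ms_integral_inner:
  assumes "has_ms_integral \<Omega> X I" and W: "sq_integrable \<Omega> W"
    and int: "integrable lborel (\<lambda>t. ms_inner \<Omega> (X t) W)"
  shows "ms_inner \<Omega> I W = (LINT t|lborel. ms_inner \<Omega> (X t) W)"
proof -
  from assms(1) obtain xs :: "nat \<Rightarrow> (real set \<times> ('a \<Rightarrow> complex)) list"
    where I: "sq_integrable \<Omega> I" and X: "\<And>t. sq_integrable \<Omega> (X t)"
      and xs: "\<And>r. \<forall>(B, Y)\<in>set (xs r). B \<in> sets lborel \<and> emeasure lborel B < \<infinity> \<and> sq_integrable \<Omega> Y"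
      and meas: "\<And>r. (\<lambda>t. ms_norm2 \<Omega> (\<lambda>w. X t w - simple_ms (xs r) t w)) \<in> borel_measurable lborel"
      and lim: "(\<lambda>r. \<integral>\<^sup>+t. ennreal (sqrt (ms_norm2 \<Omega> (\<lambda>w. X t w - simple_ms (xs r) t w))) \<partial>lborel) \<longlonglongrightarrow> 0"
      and limI: "(\<lambda>r. ms_norm2 \<Omega> (\<lambda>w. I w - simple_ms_integral (xs r) w)) \<longlonglongrightarrow> 0"
    unfolding has_ms_integral_def by auto
  note s = simple_ms_inner[OF xs W]
  define J where "J = (LINT t|lborel. ms_inner \<Omega> (X t) W)"
  define e where "e r = (\<integral>\<^sup>+t. ennreal (sqrt (ms_norm2 \<Omega> (\<lambda>w. X t w - simple_ms (xs r) t w))) \<partial>lborel)" for r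
  have "ennreal (cmod (J - ms_inner \<Omega> (simple_ms_integral (xs r)) W)) \<le> ennreal (sqrt (ms_norm2 \<Omega> W)) * e r" for r
  proof -
    have "J - ms_inner \<Omega> (simple_ms_integral (xs r)) W = (LINT t|lborel. ms_inner \<Omega> (X t) W - ms_inner \<Omega> (simple_ms (xs r) t) W)"
      unfolding J_def using int s by simp
    then have "ennreal (cmod (J - ms_inner \<Omega> (simple_ms_integral (xs r)) W))
        \<le> (\<integral>\<^sup>+t. ennreal (cmod (ms_inner \<Omega> (X t) W - ms_inner \<Omega> (simple_ms (xs r) t) W)) \<partial>lborel)"
      using integral_norm_bound_ennreal[OF Bochner_Integration.integrable_diff[OF int s(3)]] by simp
    also have "\<dots> \<le> (\<integral>\<^sup>+t. ennreal (sqrt (ms_norm2 \<Omega> W)) *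
        ennreal (sqrt (ms_norm2 \<Omega> (\<lambda>w. X t w - simple_ms (xs r) t w))) \<partial>lborel)"
    proof (rule nn_integral_mono)
      fix t
      have "cmod (ms_inner \<Omega> (X t) W - ms_inner \<Omega> (simple_ms (xs r) t) W)
          \<le> sqrt (ms_norm2 \<Omega> (\<lambda>w. X t w - simple_ms (xs r) t w)) * sqrt (ms_norm2 \<Omega> W)"
        unfolding ms_inner_diff_left[OF X s(1) W, symmetric]
        by (rule ms_inner_le[OF sq_integrable_diff[OF X s(1)] W])
      then show "ennreal (cmod (ms_inner \<Omega> (X t) W - ms_inner \<Omega> (simple_ms (xs r) t) W))
          \<le> ennreal (sqrt (ms_norm2 \<Omega> W)) * ennreal (sqrt (ms_norm2 \<Omega> (\<lambda>w. X t w - simple_ms (xs r) t w)))"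
        by (simp add: ennreal_mult[symmetric] ennreal_leI mult.commute)
    qed
    also have "\<dots> = ennreal (sqrt (ms_norm2 \<Omega> W)) * e r"
      unfolding e_def using meas by (intro nn_integral_cmult) simp
    finally show ?thesis .
  qed
  moreover have "(\<lambda>r. ennreal (sqrt (ms_norm2 \<Omega> W)) * e r) \<longlonglongrightarrow> ennreal (sqrt (ms_norm2 \<Omega> W)) * 0"
    using lim unfolding e_def by (intro ennreal_tendsto_cmult) auto
  ultimately have "(\<lambda>r. ennreal (cmod (J - ms_inner \<Omega> (simple_ms_integral (xs r)) W))) \<longlonglongrightarrow> 0"
    using tendsto_sandwich[OF always_eventually always_eventually tendsto_const] by (metis (no_types, lifting) mult_zero_right zero_le)
  then have "(\<lambda>r. cmod (J - ms_inner \<Omega> (simple_ms_integral (xs r)) W)) \<longlonglongrightarrow> 0"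
    using tendsto_ennreal_iff[of "\<lambda>r. cmod (J - ms_inner \<Omega> (simple_ms_integral (xs r)) W)" sequentially 0] by simp
  then have "(\<lambda>r. J - ms_inner \<Omega> (simple_ms_integral (xs r)) W) \<longlonglongrightarrow> 0"
    by (rule tendsto_norm_zero_cancel)
  then have "(\<lambda>r. ms_inner \<Omega> (simple_ms_integral (xs r)) W) \<longlonglongrightarrow> J"
    by (rule Lim_transform2[OF tendsto_const])
  moreover have "(\<lambda>r. ms_inner \<Omega> (simple_ms_integral (xs r)) W) \<longlonglongrightarrow> ms_inner \<Omega> I W"
    by (rule ms_tendsto_inner[OF limI s(2) I W])
  ultimately show ?thesis unfolding J_def by (rule LIMSEQ_unique[rotated])
qed

section \<open>The functional and the generated sequence\<close>

lemma pc_process_inner_continuous: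
  assumes "pc_process \<Omega> T \<zeta>" "sq_integrable \<Omega> W"
  shows "continuous_on UNIV (\<lambda>t. ms_inner \<Omega> (\<zeta> t) W)"
proof (intro continuous_at_imp_continuous_on ballI)
  fix t
  have sq: "\<And>s. sq_integrable \<Omega> (\<zeta> s)" and "((\<lambda>s. ms_norm2 \<Omega> (\<lambda>w. \<zeta> s w - \<zeta> t w)) \<longlongrightarrow> 0) (at t)"
    using assms(1) by (auto simp: pc_process_def)
  then have "ms_tendsto \<Omega> \<zeta> (\<zeta> t) (at t)" by (simp add: ms_norm2_minus_commute[of \<Omega> "\<zeta> t"])
  from ms_tendsto_inner[OF this sq sq assms(2)]
  show "isCont (\<lambda>t. ms_inner \<Omega> (\<zeta> t) W) t" by (simp add: isCont_def)
qed

text \<open>The variance is continuous and has period \<open>T\<close>, so its supremum is attained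
  on one period.\<close>

lemma pc_process_norm2_bounded:
  assumes pc: "pc_process \<Omega> T \<zeta>" and T: "0 < T"
  shows "\<exists>B. \<forall>t. ms_norm2 \<Omega> (\<zeta> t) \<le> B"
proof -
  let ?g = "\<lambda>t. ms_norm2 \<Omega> (\<zeta> t)"
  have step: "?g (t + T) = ?g t" for t
  proof -
    have "ms_inner \<Omega> (\<zeta> t) (\<zeta> t) = ms_inner \<Omega> (\<zeta> (t + T)) (\<zeta> (t + T))"
      using pc unfolding pc_process_def by simp
    then show ?thesis by (simp add: ms_inner_self)
  qed
  have per: "?g (t + real n * T) = ?g t" for t n
  proof (induction n)
    case (Suc n)
    have "t + real (Suc n) * T = t + real n * T + T" by (simp add: algebra_simps)
    then show ?case using step[of "t + real n * T"] Suc by (simp only:)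
  qed simp
  have "continuous_on UNIV ?g"
  proof (intro continuous_at_imp_continuous_on ballI)
    fix t
    have sq: "\<And>s. sq_integrable \<Omega> (\<zeta> s)" and "((\<lambda>s. ms_norm2 \<Omega> (\<lambda>w. \<zeta> s w - \<zeta> t w)) \<longlongrightarrow> 0) (at t)"
      using pc by (auto simp: pc_process_def)
    then have "ms_tendsto \<Omega> \<zeta> (\<zeta> t) (at t)" by (simp add: ms_norm2_minus_commute[of \<Omega> "\<zeta> t"])
    from ms_tendsto_norm2[OF this sq sq] show "isCont ?g t" by (simp add: isCont_def)
  qed
  then have "compact (?g ` {0..T})"
    by (rule compact_continuous_image[OF continuous_on_subset[OF _ subset_UNIV] compact_Icc])
  from compact_imp_bounded[OF this] obtain B where "\<forall>x\<in>?g ` {0..T}. norm x \<le> B"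
    unfolding bounded_iff by (rule exE)
  then have B: "\<bar>?g s\<bar> \<le> B" if "s \<in> {0..T}" for s using that by (auto simp del: abs_of_nonneg)
  have "?g t \<le> B" for t
  proof -
    define s where "s = t - of_int \<lfloor>t / T\<rfloor> * T"
    have "of_int \<lfloor>t / T\<rfloor> * T \<le> t"
      unfolding pos_le_divide_eq[OF T, symmetric] by (rule of_int_floor_le)
    moreover have "t < (of_int \<lfloor>t / T\<rfloor> + 1) * T"
      unfolding pos_divide_less_eq[OF T, symmetric] by simp
    ultimately have s: "s \<in> {0..T}" by (simp add: s_def algebra_simps)
    have "?g t = ?g s"
    \<comment> \<open>\<open>per\<close> shifts by natural multiples of \<open>T\<close>; for a
      negative quotient the shift goes from \<open>t\<close> to \<open>s\<close>.\<close>
    proof (cases "0 \<le> \<lfloor>t / T\<rfloor>")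
      case True
      then have "t = s + real (nat \<lfloor>t / T\<rfloor>) * T" by (simp add: s_def)
      then show ?thesis using per[of s "nat \<lfloor>t / T\<rfloor>"] by simp
    next
      case False
      then have "s = t + real (nat (- \<lfloor>t / T\<rfloor>)) * T" by (simp add: s_def)
      then show ?thesis using per[of t "nat (- \<lfloor>t / T\<rfloor>)"] by simp
    qed
    then show ?thesis using B[OF s] by simp
  qed
  then show ?thesis by blast
qed

text \<open>The scalar form of the expansion of the functional in the vectors
  \<open>a_j^T z_j\<close>. On each period Parseval's identity is applied to the piece of
  \<open>a\<close>, which is integrable with square summable coefficients, and to the continuous
  bounded function \<open>t\<close> to \<open>(\<zeta> t, W)\<close>; dominated convergence joins
  the periods.\<close>

lemma functional_pairing:
  assumes T: "0 < T" and pc: "pc_process \<Omega> T \<zeta>" and gen: "generated_sequence \<Omega> T \<zeta> z"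
    and a: "set_integrable lborel {0..} a"
    and A\<zeta>: "has_ms_integral \<Omega> (\<lambda>t w. indicator {0..} t * a t * \<zeta> t w) A\<zeta>"
    and l2: "\<And>j. in_l2 (avec T a j)" and W: "sq_integrable \<Omega> W"
  shows "(\<lambda>j. \<Sum>k. avec T a j k * ms_inner \<Omega> (z k (int j)) W) sums ms_inner \<Omega> A\<zeta> W"
proof -
  define c where "c t = ms_inner \<Omega> (\<zeta> t) W" for t
  define a' where "a' t = indicator {0..} t *\<^sub>R a t" for t
  have a'int: "integrable lborel a'" using a by (simp add: set_integrable_def a'_def[abs_def])
  have [measurable]: "a' \<in> borel_measurable borel" using borel_measurable_integrable[OF a'int] by simp
  have sq: "sq_integrable \<Omega> (\<zeta> t)" for t using pc by (simp add: pc_process_def)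
  have cc: "continuous_on UNIV c"
    unfolding c_def by (rule pc_process_inner_continuous[OF pc W])
  have [measurable]: "c \<in> borel_measurable borel" by (rule borel_measurable_continuous_onI[OF cc])
  obtain B0 where B0: "\<And>t. ms_norm2 \<Omega> (\<zeta> t) \<le> B0" using pc_process_norm2_bounded[OF pc T] by auto
  define B where "B = sqrt B0 * sqrt (ms_norm2 \<Omega> W)"
  have cB: "cmod (c t) \<le> B" for t
    unfolding c_def B_def
    by (rule order_trans[OF ms_inner_le[OF sq W]]) (intro mult_right_mono real_sqrt_le_mono B0; simp)
  have acint: "integrable lborel (\<lambda>t. a' t * c t)"
  proof (rule Bochner_Integration.integrable_bound)
    show "integrable lborel (\<lambda>t. B * cmod (a' t))" using a'int by simp
    have "0 \<le> B" using cB[of 0] norm_ge_zero order_trans by blast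
    then have "norm (a' t * c t) \<le> norm (B * cmod (a' t))" for t
      using mult_right_mono[OF cB[of t] norm_ge_zero[of "a' t"]] by (simp add: norm_mult abs_mult mult.commute)
    then show "AE t in lborel. norm (a' t * c t) \<le> norm (B * cmod (a' t))" by simp
  qed simp
  have A\<zeta>W: "ms_inner \<Omega> A\<zeta> W = (LINT t|lborel. a' t * c t)"
  proof -
    have eq: "ms_inner \<Omega> (\<lambda>w. indicator {0..} t * a t * \<zeta> t w) W = a' t * c t" for t
      by (simp add: ms_inner_cmult_left c_def a'_def indicator_def)
    show ?thesis
      using has_ms_integral_inner[OF A\<zeta> W] acint unfolding eq by simp
  qed
  define e where "e k u = cis (2 * pi * of_int (freq_index k) * u / T)" for k u
  have e_borel [measurable]: "e k \<in> borel_measurable borel" for k unfolding e_def by measurable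
  have piece: "(\<lambda>k. avec T a j k * ms_inner \<Omega> (z k (int j)) W) sums
      (LINT t:{0..<T}|lborel. a' (t + real j * T) * c (t + real j * T))" for j
  proof -
    define \<alpha> where "\<alpha> u = a' (u + real j * T)" for u
    define g where "g u = c (u + real j * T)" for u
    have [measurable]: "\<alpha> \<in> borel_measurable borel" "g \<in> borel_measurable borel"
      unfolding \<alpha>_def g_def by measurable
    have "integrable lborel (\<lambda>u. a' (real j * T + 1 * u))"
      by (rule lborel_integrable_real_affine[OF a'int]) simp
    then have \<alpha>0: "integrable lborel \<alpha>" by (simp add: \<alpha>_def[abs_def] add.commute)
    have \<alpha>: "integrable (unif 0 T) \<alpha>"
      unfolding integrable_unif[OF T \<open>\<alpha> \<in> borel_measurable borel\<close>] set_integrable_def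
      by (rule integrable_mult_indicator[OF _ \<alpha>0]) simp
    define b where "b k = (LINT u|unif 0 T. \<alpha> u * e k u)" for k
    \<comment> \<open>\<open>basis_fn\<close> carries \<open>1 / sqrt T\<close> and
      \<open>unif\<close> divides by \<open>T\<close>, which leaves a factor \<open>sqrt T\<close>
      here and another one in \<open>zW\<close>. Their product \<open>T\<close> undoes the averaging
      over the period.\<close>
    have avec: "avec T a j k = of_real (sqrt T) * b k" for k
    proof -
      have "avec T a j k = (LINT u:{0..<T}|lborel. \<alpha> u * (of_real (1 / sqrt T) * e k u))"
        unfolding avec_def cnj_basis_fn_coef_perm unfolding basis_fn_eq e_def set_lebesgue_integral_def
        by (intro Bochner_Integration.integral_cong refl) (use T in \<open>auto simp: \<alpha>_def a'_def indicator_def\<close>)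
      also have "\<dots> = of_real (1 / sqrt T) * (LINT u:{0..<T}|lborel. \<alpha> u * e k u)"
        unfolding set_integral_mult_right[symmetric] by (simp only: mult_ac)
      also have "(LINT u:{0..<T}|lborel. \<alpha> u * e k u) = of_real T * b k"
        unfolding b_def using T by (subst integral_unif) (auto simp: scaleR_conv_of_real)
      also have "of_real (1 / sqrt T) * (of_real T * b k) = of_real (T / sqrt T) * b k"
        by simp
      also have "T / sqrt T = sqrt T" using T by (simp add: real_div_sqrt)
      finally show ?thesis .
    qed
    have zW: "ms_inner \<Omega> (z k (int j)) W = of_real (sqrt T) * ms_inner (unif 0 T) g (e k)" for k
    proof -
      have eq: "ms_inner \<Omega> (\<lambda>w. indicator {0..<T} v * (\<zeta> (v + of_int (int j) * T) w * cnj (basis_fn T k v))) W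
          = indicator {0..<T} v *\<^sub>R (of_real (1 / sqrt T) * (g v * cnj (e k v)))" for v
      proof -
        have fn: "(\<lambda>w. indicator {0..<T} v * (\<zeta> (v + of_int (int j) * T) w * cnj (basis_fn T k v))) =
          (\<lambda>w. (indicator {0..<T} v * cnj (basis_fn T k v)) * \<zeta> (v + real j * T) w)"
          by (simp add: fun_eq_iff mult_ac)
        show ?thesis
          unfolding fn ms_inner_cmult_left by (simp add: basis_fn_eq e_def g_def c_def indicator_def)
      qed
      have e1: "cmod (e k v) = 1" for v by (simp add: e_def)
      have int: "integrable lborel (\<lambda>v. indicator {0..<T} v *\<^sub>R (of_real (1 / sqrt T) * (g v * cnj (e k v))))"
      proof -
        interpret prob_space "unif 0 T" by (rule prob_space_unif[OF T])
        have meas: "(\<lambda>v. of_real (1 / sqrt T) * (g v * cnj (e k v))) \<in> borel_measurable borel" by measurable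
        have "integrable (unif 0 T) (\<lambda>v. of_real (1 / sqrt T) * (g v * cnj (e k v)))"
          by (intro integrable_const_bound[where B="1 / sqrt T * B"] always_eventually allI)
             (use T cB meas in \<open>simp_all add: norm_mult norm_divide e1 g_def divide_right_mono\<close>)
        then show ?thesis
          unfolding integrable_unif[OF T meas] by (simp only: set_integrable_def add_0)
      qed
      have "ms_inner \<Omega> (z k (int j)) W = (LINT v|lborel. indicator {0..<T} v *\<^sub>R (of_real (1 / sqrt T) * (g v * cnj (e k v))))"
        using has_ms_integral_inner[of \<Omega> _ "z k (int j)", OF _ W] gen int unfolding generated_sequence_def eq[symmetric] by blast
      also have "\<dots> = of_real (1 / sqrt T) * (LINT v:{0..<T}|lborel. g v * cnj (e k v))"
        unfolding set_integral_mult_right[symmetric] unfolding set_lebesgue_integral_def ..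
      also have "(LINT v:{0..<T}|lborel. g v * cnj (e k v)) = of_real T * ms_inner (unif 0 T) g (e k)"
        unfolding ms_inner_def using T by (subst integral_unif) (auto simp: scaleR_conv_of_real)
      also have "of_real (1 / sqrt T) * (of_real T * ms_inner (unif 0 T) g (e k)) = of_real (T / sqrt T) * ms_inner (unif 0 T) g (e k)"
        by simp
      also have "T / sqrt T = sqrt T" using T by (simp add: real_div_sqrt)
      finally show ?thesis .
    qed
    have inb: "in_l2 b"
    proof -
      have "summable (\<lambda>k. (1 / T) * (cmod (avec T a j k))\<^sup>2)"
        using l2[of j] unfolding in_l2_def by (rule summable_mult)
      also have "(\<lambda>k. (1 / T) * (cmod (avec T a j k))\<^sup>2) = (\<lambda>k. (cmod (b k))\<^sup>2)"
        using T by (simp add: avec norm_mult power_mult_distrib)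
      finally show ?thesis by (simp add: in_l2_def)
    qed
    have gc: "continuous_on UNIV g"
      unfolding g_def by (rule continuous_on_compose2[OF cc]) (auto intro!: continuous_intros)
    have gB: "cmod (g u) \<le> B" for u by (simp add: g_def cB)
    have "(\<lambda>k. b k * ms_inner (unif 0 T) g (e k)) sums (LINT u|unif 0 T. \<alpha> u * g u)"
      using Parseval_L1[OF T bij_freq_index \<alpha> _ gc gB] inb
      unfolding b_def[abs_def] e_def[abs_def] by simp
    from sums_mult[OF this, of "of_real T"]
    have "(\<lambda>k. of_real T * (b k * ms_inner (unif 0 T) g (e k))) sums (of_real T * (LINT u|unif 0 T. \<alpha> u * g u))" .
    moreover have "of_real T * (b k * ms_inner (unif 0 T) g (e k)) = avec T a j k * ms_inner \<Omega> (z k (int j)) W" for k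
    proof -
      have "complex_of_real T = of_real (sqrt T) * of_real (sqrt T)"
        using T by (simp add: of_real_mult[symmetric] del: of_real_mult)
      then show ?thesis by (simp add: avec zW)
    qed
    moreover have "of_real T * (LINT u|unif 0 T. \<alpha> u * g u) = (LINT t:{0..<T}|lborel. a' (t + real j * T) * c (t + real j * T))"
      using T by (subst integral_unif) (auto simp: scaleR_conv_of_real \<alpha>_def g_def)
    ultimately show ?thesis by simp
  qed
  have shift: "(LINT t:{0..<T}|lborel. a' (t + s) * c (t + s)) = (LINT t:{s..<s + T}|lborel. a' t * c t)" for s
  proof -
    have "(LINT t:{s..<s + T}|lborel. a' t * c t) = (LINT t|lborel. indicator {s..<s + T} (s + 1 * t) *\<^sub>R (a' (s + 1 * t) * c (s + 1 * t)))"
      unfolding set_lebesgue_integral_def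
      by (subst lborel_integral_real_affine[of 1 _ s]) simp_all
    also have "\<dots> = (LINT t:{0..<T}|lborel. a' (t + s) * c (t + s))"
      unfolding set_lebesgue_integral_def
      by (intro Bochner_Integration.integral_cong) (auto simp: indicator_def add.commute)
    finally show ?thesis ..
  qed
  have seti: "set_integrable lborel A (\<lambda>t. a' t * c t)" if "A \<in> sets lborel" for A
    unfolding set_integrable_def by (rule integrable_mult_indicator[OF that acint])
  have part: "(\<Sum>j<n. LINT t:{0..<T}|lborel. a' (t + real j * T) * c (t + real j * T))
      = (LINT t:{0..<real n * T}|lborel. a' t * c t)" for n
  proof (induction n)
    case 0
    then show ?case by (simp add: set_lebesgue_integral_def)
  next
    case (Suc n)
    have un: "{0..<real (Suc n) * T} = {0..<real n * T} \<union> {real n * T..<real n * T + T}"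
      using ivl_disj_un_two(3)[of 0 "real n * T" "real n * T + T"] T by (simp add: algebra_simps)
    show ?case unfolding un
      by (subst set_integral_Un) (auto intro!: seti simp: Suc.IH[unfolded shift] shift)
  qed
  have "(\<lambda>n. LINT t:{0..<real n * T}|lborel. a' t * c t) \<longlonglongrightarrow> (LINT t|lborel. a' t * c t)"
    unfolding set_lebesgue_integral_def
  proof (rule integral_dominated_convergence)
    show "integrable lborel (\<lambda>t. norm (a' t * c t))" using acint by (rule integrable_norm)
    show "AE t in lborel. (\<lambda>n. indicator {0..<real n * T} t *\<^sub>R (a' t * c t)) \<longlonglongrightarrow> a' t * c t"
    proof (intro always_eventually allI)
      fix t
      obtain n0 where n0: "t / T < real n0" using reals_Archimedean2 by blast
      have "indicator {0..<real n * T} t *\<^sub>R (a' t * c t) = a' t * c t" if "n0 \<le> n" for n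
      proof (cases "0 \<le> t")
        case True
        have "t / T < real n" using n0 that by simp
        then have "t < real n * T" using T by (simp add: pos_divide_less_eq)
        with True show ?thesis by simp
      next
        case False
        then show ?thesis by (simp add: a'_def)
      qed
      then show "(\<lambda>n. indicator {0..<real n * T} t *\<^sub>R (a' t * c t)) \<longlonglongrightarrow> a' t * c t"
        by (intro tendsto_eventually) (auto simp: eventually_sequentially)
    qed
    show "AE t in lborel. norm (indicator {0..<real n * T} t *\<^sub>R (a' t * c t)) \<le> norm (a' t * c t)" for n
      by (intro always_eventually allI) (simp add: indicator_def)
  qed simp_all
  then have "(\<lambda>j. LINT t:{0..<T}|lborel. a' (t + real j * T) * c (t + real j * T)) sums ms_inner \<Omega> A\<zeta> W"
    unfolding sums_def part A\<zeta>W .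
  then show ?thesis using piece by (simp add: sums_iff)
qed

section \<open>Absolutely convergent double series\<close>

lemma sums_infsum_nat:
  fixes g :: "nat \<Rightarrow> complex"
  assumes "g summable_on UNIV"
  shows "g sums infsum g UNIV"
  by (rule has_sum_imp_sums[OF has_sum_infsum[OF assms]])

lemma filterlim_square_finite_subsets:
  "filterlim (\<lambda>n. {..<n} \<times> {..<n}) (finite_subsets_at_top UNIV) (sequentially :: nat filter)"
  unfolding filterlim_finite_subsets_at_top
proof (intro allI impI)
  fix X :: "(nat \<times> nat) set" assume "finite X \<and> X \<subseteq> UNIV"
  then have fin: "finite (fst ` X \<union> snd ` X)" by auto
  obtain n0 where n0: "\<And>i. i \<in> fst ` X \<union> snd ` X \<Longrightarrow> i < n0"
    using finite_nat_set_iff_bounded[of "fst ` X \<union> snd ` X"] fin by blast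
  have "X \<subseteq> {..<n} \<times> {..<n}" if "n0 \<le> n" for n
  proof
    fix q assume "q \<in> X"
    then have "fst q < n0" "snd q < n0" by (auto intro: n0)
    then show "q \<in> {..<n} \<times> {..<n}" using that by (simp add: mem_Times_iff)
  qed
  then show "\<forall>\<^sub>F n in sequentially. finite ({..<n} \<times> {..<n}) \<and> X \<subseteq> {..<n} \<times> {..<n} \<and> {..<n} \<times> {..<n} \<subseteq> UNIV"
    by (auto simp: eventually_sequentially)
qed

text \<open>The absolute sum of row \<open>j\<close> is at most \<open>l2_norm (a j) * C\<close>,
  and these bounds are summable. So the double series converges absolutely, and its sums by rows, by
  columns and over squares agree.\<close>

lemma l2_double_series:
  fixes a p :: "nat \<Rightarrow> nat \<Rightarrow> complex"
  assumes a: "\<And>j. in_l2 (a j)" "summable (\<lambda>j. l2_norm (a j))"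
    and p: "\<And>j K. (\<Sum>k<K. (cmod (p j k))\<^sup>2) \<le> C\<^sup>2" and C: "0 \<le> C"
  shows "summable (\<lambda>j. \<Sum>k. a j k * p j k)"
    and "(\<lambda>k. \<Sum>j. a j k * p j k) sums (\<Sum>j. \<Sum>k. a j k * p j k)"
    and "(\<lambda>n. \<Sum>j<n. \<Sum>k<n. a j k * p j k) \<longlonglongrightarrow> (\<Sum>j. \<Sum>k. a j k * p j k)"
    and "cmod (\<Sum>j<n. \<Sum>k<n. a j k * p j k) \<le> (\<Sum>j. l2_norm (a j)) * C"
proof -
  define f where "f = (\<lambda>(j, k). a j k * p j k)"
  note row = l2_pairing[OF a(1) p C]
  have nonneg: "0 \<le> l2_norm (a j)" for j
    using a(1)[of j] unfolding l2_norm_def in_l2_def by (intro real_sqrt_ge_zero suminf_nonneg) auto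
  have inner: "((\<lambda>k. norm (f (j, k))) has_sum (\<Sum>k. cmod (a j k) * cmod (p j k))) UNIV" for j
  proof (rule norm_summable_imp_has_sum)
    show "summable (\<lambda>k. norm (norm (f (j, k))))" using row(1)[of j] by (simp add: f_def norm_mult)
    show "(\<lambda>k. norm (f (j, k))) sums (\<Sum>k. cmod (a j k) * cmod (p j k))"
      using summable_sums[OF row(1)[of j]] by (simp add: f_def norm_mult)
  qed
  have inner': "(\<lambda>k. norm (f (j, k))) summable_on UNIV" for j
    using inner[of j] by (rule has_sum_imp_summable)
  have "(\<lambda>j. norm (infsum (\<lambda>k. norm (f (j, k))) UNIV)) summable_on UNIV"
    unfolding infsumI[OF inner]
  proof (rule norm_summable_imp_summable_on, rule summable_comparison_test'[OF summable_mult2[OF a(2), of C]])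
    fix j
    have "0 \<le> (\<Sum>k. cmod (a j k) * cmod (p j k))" by (intro suminf_nonneg row(1)) simp
    then show "norm (norm (norm (\<Sum>k. cmod (a j k) * cmod (p j k)))) \<le> l2_norm (a j) * C"
      using row(2)[of j] by simp
  qed
  then have "(\<lambda>q. norm (f q)) summable_on UNIV \<times> UNIV"
    unfolding Infinite_Sum.abs_summable_on_Sigma_iff using inner' by blast
  then have f: "f summable_on UNIV \<times> UNIV" by (rule abs_summable_summable)
  have rowsum: "(\<lambda>k. f (j, k)) summable_on UNIV" for j by (rule abs_summable_summable[OF inner'])
  have rows: "(\<Sum>k. a j k * p j k) = infsum (\<lambda>k. f (j, k)) UNIV" for j
    using sums_infsum_nat[OF rowsum[of j]] by (simp add: f_def sums_iff)
  have outer: "(\<lambda>j. \<Sum>k. a j k * p j k) summable_on UNIV"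
    unfolding rows using summable_on_Sigma_banach[of "\<lambda>j k. f (j, k)" UNIV "\<lambda>_. UNIV"] f by simp
  have total: "(\<Sum>j. \<Sum>k. a j k * p j k) = infsum f (UNIV \<times> UNIV)"
  proof -
    have "(\<Sum>j. \<Sum>k. a j k * p j k) = infsum (\<lambda>j. \<Sum>k. a j k * p j k) UNIV"
      using sums_infsum_nat[OF outer] by (simp add: sums_iff)
    also have "\<dots> = infsum f (UNIV \<times> UNIV)"
      unfolding rows by (rule infsum_Sigma_banach[OF f])
    finally show ?thesis .
  qed
  show "summable (\<lambda>j. \<Sum>k. a j k * p j k)"
    using sums_infsum_nat[OF outer] by (simp add: sums_iff)
  have f': "(\<lambda>(k, j). f (j, k)) summable_on UNIV \<times> UNIV"
  proof -
    have "bij_betw (\<lambda>(k, j). (j, k)) (UNIV \<times> UNIV) (UNIV \<times> (UNIV :: nat set))"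
      by (rule bij_betw_byWitness[where f'="\<lambda>(k, j). (j, k)"]) auto
    from iffD2[OF summable_on_reindex_bij_betw[OF this] f] show ?thesis
      by (simp add: case_prod_unfold)
  qed
  have colsum: "(\<lambda>j. f (j, k)) summable_on UNIV" for k
    using summable_on_SigmaD1[of "\<lambda>k j. f (j, k)" UNIV "\<lambda>_. UNIV" k] f' by simp
  have cols: "(\<Sum>j. a j k * p j k) = infsum (\<lambda>j. f (j, k)) UNIV" for k
    using sums_infsum_nat[OF colsum[of k]] by (simp add: f_def sums_iff)
  have "(\<lambda>k. infsum (\<lambda>j. f (j, k)) UNIV) summable_on UNIV"
    using summable_on_Sigma_banach[of "\<lambda>k j. f (j, k)" UNIV "\<lambda>_. UNIV"] f' by simp
  from sums_infsum_nat[OF this]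
  have "(\<lambda>k. \<Sum>j. a j k * p j k) sums infsum (\<lambda>k. infsum (\<lambda>j. f (j, k)) UNIV) UNIV"
    unfolding cols .
  also have "infsum (\<lambda>k. infsum (\<lambda>j. f (j, k)) UNIV) UNIV = infsum f (UNIV \<times> UNIV)"
    using infsum_swap_banach[of "\<lambda>j k. f (j, k)" UNIV UNIV] infsum_Sigma_banach[OF f] f by simp
  finally show "(\<lambda>k. \<Sum>j. a j k * p j k) sums (\<Sum>j. \<Sum>k. a j k * p j k)"
    unfolding total .
  have square: "(\<Sum>j<n. \<Sum>k<n. a j k * p j k) = sum f ({..<n} \<times> {..<n})" for n
    by (simp add: sum.cartesian_product f_def)
  have "(sum f \<longlongrightarrow> infsum f (UNIV \<times> UNIV)) (finite_subsets_at_top UNIV)"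
    using has_sum_infsum[OF f] by (simp add: has_sum_def)
  from filterlim_compose[OF this filterlim_square_finite_subsets]
  show "(\<lambda>n. \<Sum>j<n. \<Sum>k<n. a j k * p j k) \<longlonglongrightarrow> (\<Sum>j. \<Sum>k. a j k * p j k)"
    unfolding square total .
  have "cmod (\<Sum>j<n. \<Sum>k<n. a j k * p j k) \<le> (\<Sum>j<n. \<Sum>k<n. cmod (a j k) * cmod (p j k))"
    by (intro sum_norm_le) (simp add: norm_mult)
  also have "\<dots> \<le> (\<Sum>j<n. l2_norm (a j) * C)"
  proof (rule sum_mono)
    fix j
    have "(\<Sum>k<n. cmod (a j k) * cmod (p j k)) \<le> (\<Sum>k. cmod (a j k) * cmod (p j k))"
      by (intro sum_le_suminf row(1)) auto
    then show "(\<Sum>k<n. cmod (a j k) * cmod (p j k)) \<le> l2_norm (a j) * C" using row(2) by (rule order_trans)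
  qed
  also have "\<dots> = (\<Sum>j<n. l2_norm (a j)) * C" by (simp add: sum_distrib_right)
  also have "\<dots> \<le> (\<Sum>j. l2_norm (a j)) * C"
    using C nonneg by (intro mult_right_mono sum_le_suminf a(2)) auto
  finally show "cmod (\<Sum>j<n. \<Sum>k<n. a j k * p j k) \<le> (\<Sum>j. l2_norm (a j)) * C" .
qed

section \<open>Norms and Gram matrices\<close>

lemma ms_norm2_lincomb:
  assumes "\<And>i. i \<in> I \<Longrightarrow> sq_integrable M (g i)"
  shows "complex_of_real (ms_norm2 M (\<lambda>w. \<Sum>i\<in>I. c i * g i w)) =
    (\<Sum>i\<in>I. \<Sum>j\<in>I. c i * (cnj (c j) * ms_inner M (g i) (g j)))"
  using assms unfolding ms_inner_self[symmetric]
  by (simp add: ms_inner_sum_left ms_inner_sum_right sq_integrable_sum sq_integrable_cmult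
      ms_inner_cmult_left ms_inner_cmult_right sum_distrib_left)

text \<open>The norm of a combination is determined by its coefficients and the Gram matrix. This
  transports distances between random variables and functions of the frequency before any map
  between the two spaces is available.\<close>

lemma ms_norm2_gram:
  assumes sq: "\<And>i. i \<in> I \<Longrightarrow> sq_integrable M (g i)" "\<And>i. i \<in> I \<Longrightarrow> sq_integrable M' (g' i)"
    and gram: "\<And>i j. i \<in> I \<Longrightarrow> j \<in> I \<Longrightarrow> ms_inner M (g i) (g j) = ms_inner M' (g' i) (g' j)"
  shows "ms_norm2 M (\<lambda>w. \<Sum>i\<in>I. c i * g i w) = ms_norm2 M' (\<lambda>w. \<Sum>i\<in>I. c i * g' i w)"
proof -
  have "complex_of_real (ms_norm2 M (\<lambda>w. \<Sum>i\<in>I. c i * g i w)) = complex_of_real (ms_norm2 M' (\<lambda>w. \<Sum>i\<in>I. c i * g' i w))"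
    using gram by (simp add: ms_norm2_lincomb[OF sq(1)] ms_norm2_lincomb[OF sq(2)])
  then show ?thesis by (simp only: of_real_eq_iff)
qed

section \<open>Vector functions of the frequency\<close>

abbreviation freq :: "real measure" where
  "freq \<equiv> unif (- pi) (2 * pi)"

lemma freq_interval: "{- pi..< - pi + 2 * pi} = {- pi..<pi}" by simp

lemma two_pi_pos: "0 < 2 * pi" by simp

lemmas AE_freq = AE_unif[OF two_pi_pos, where a="- pi", unfolded freq_interval]
lemmas integral_freq = integral_unif[OF two_pi_pos, where a="- pi", unfolded freq_interval]
lemmas nn_integral_freq = nn_integral_unif[OF two_pi_pos, where a="- pi", unfolded freq_interval]

lemma prob_space_freq: "prob_space freq"
  by (rule prob_space_unif) simp

lemma cis_freq_orthonormal:
  "ms_inner freq (\<lambda>x. cis (of_int i * x)) (\<lambda>x. cis (of_int j * x)) = (if i = j then 1 else 0)"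
  using cis_orthonormal[of "2 * pi" "- pi" i j] by simp

text \<open>A function of the pair \<open>(m, x)\<close> on \<open>channels N\<close> stands for the \<open>N\<close>-vector function of \<open>x\<close> with components \<open>m\<close>.\<close>
definition channels :: "nat \<Rightarrow> (nat \<times> real) measure" where
  "channels N = count_space {..<N} \<Otimes>\<^sub>M freq"

lemma borel_measurable_channels:
  assumes "\<And>m. m < N \<Longrightarrow> (\<lambda>x. g (m, x)) \<in> borel_measurable borel"
  shows "g \<in> borel_measurable (channels N)"
  unfolding channels_def using assms by (intro measurable_pair_measure_countable1) auto

lemma pair_sigma_finite_channels: "pair_sigma_finite (count_space {..<N::nat}) freq"
proof -
  interpret prob_space freq by (rule prob_space_freq)
  show ?thesis
    unfolding pair_sigma_finite_def
    using sigma_finite_measure_count_space_finite[of "{..<N}"] sigma_finite_measure_axioms by simp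
qed

lemma nn_integral_channels:
  assumes "\<And>m. m < N \<Longrightarrow> (\<lambda>x. g (m, x)) \<in> borel_measurable borel"
  shows "(\<integral>\<^sup>+p. g p \<partial>channels N) = (\<Sum>m<N. \<integral>\<^sup>+x. g (m, x) \<partial>freq)"
proof -
  interpret prob_space freq by (rule prob_space_freq)
  have "(\<integral>\<^sup>+p. g p \<partial>channels N) = (\<integral>\<^sup>+m. \<integral>\<^sup>+x. g (m, x) \<partial>freq \<partial>count_space {..<N})"
    unfolding channels_def
    by (rule nn_integral_fst[symmetric], rule borel_measurable_channels[unfolded channels_def, OF assms])
  then show ?thesis by (simp add: nn_integral_count_space_finite)
qed

lemma integral_channels:
  fixes g :: "nat \<times> real \<Rightarrow> complex"
  assumes "integrable (channels N) g"
  shows "(LINT p|channels N. g p) = (\<Sum>m<N. LINT x|freq. g (m, x))"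
proof -
  interpret pair_sigma_finite "count_space {..<N}" freq by (rule pair_sigma_finite_channels)
  have "(LINT p|channels N. g p) = (LINT m|count_space {..<N}. LINT x|freq. g (m, x))"
    using integral_fst'[of g] assms by (simp add: channels_def)
  then show ?thesis by (simp add: lebesgue_integral_count_space_finite)
qed

lemma AE_channels:
  fixes g h :: "nat \<times> real \<Rightarrow> complex"
  assumes [measurable]: "g \<in> borel_measurable (channels N)" "h \<in> borel_measurable (channels N)"
    and "\<And>m. m < N \<Longrightarrow> AE x in freq. g (m, x) = h (m, x)"
  shows "AE p in channels N. g p = h p"
proof -
  interpret pair_sigma_finite "count_space {..<N}" freq by (rule pair_sigma_finite_channels)
  show ?thesis
    unfolding channels_def
  proof (rule AE_pair_measure)
    show "{p \<in> space (count_space {..<N} \<Otimes>\<^sub>M freq). g p = h p} \<in> sets (count_space {..<N} \<Otimes>\<^sub>M freq)"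
      unfolding channels_def[symmetric] by measurable
    show "AE m in count_space {..<N}. AE x in freq. g (m, x) = h (m, x)"
      using assms(3) by (simp add: AE_count_space)
  qed
qed

lemma sq_integrable_channels:
  assumes "\<And>m. m < N \<Longrightarrow> sq_integrable freq (\<lambda>x. g (m, x))"
  shows "sq_integrable (channels N) g"
proof (rule sq_integrableI_nn)
  have b: "(\<lambda>x. g (m, x)) \<in> borel_measurable borel" if "m < N" for m
    using assms[OF that] by (simp add: sq_integrable_def)
  show "g \<in> borel_measurable (channels N)" using b by (rule borel_measurable_channels)
  have "(\<integral>\<^sup>+p. ennreal ((cmod (g p))\<^sup>2) \<partial>channels N) = (\<Sum>m<N. \<integral>\<^sup>+x. ennreal ((cmod (g (m, x)))\<^sup>2) \<partial>freq)"
    using b by (intro nn_integral_channels) simp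
  also have "\<dots> < \<infinity>"
    using assms by (simp add: nn_integral_cmod_sq)
  finally show "(\<integral>\<^sup>+p. ennreal ((cmod (g p))\<^sup>2) \<partial>channels N) < \<infinity>" .
qed

lemma ms_inner_channels:
  assumes "sq_integrable (channels N) g" "sq_integrable (channels N) h"
  shows "ms_inner (channels N) g h = (\<Sum>m<N. ms_inner freq (\<lambda>x. g (m, x)) (\<lambda>x. h (m, x)))"
  unfolding ms_inner_def by (rule integral_channels[OF sq_integrable_mult_cnj[OF assms]])

lemma ms_norm2_channels:
  assumes "sq_integrable (channels N) g"
  shows "ms_norm2 (channels N) g = (\<Sum>m<N. ms_norm2 freq (\<lambda>x. g (m, x)))"
proof -
  have "complex_of_real (ms_norm2 (channels N) g) = of_real (\<Sum>m<N. ms_norm2 freq (\<lambda>x. g (m, x)))"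
    unfolding ms_inner_self[symmetric] of_real_sum by (rule ms_inner_channels[OF assms assms])
  then show ?thesis by (simp only: of_real_eq_iff)
qed

lemma L2f_norm2_freq:
  assumes [measurable]: "q \<in> borel_measurable borel"
    and "AE x in freq. quad_form (f x) (b x) = q x"
  shows "L2f_norm2 f b = ennreal (2 * pi) * (\<integral>\<^sup>+x. q x \<partial>freq)"
proof -
  have "L2f_norm2 f b = (\<integral>\<^sup>+x\<in>{-pi..<pi}. q x \<partial>lborel)"
    unfolding L2f_norm2_def using assms(2) unfolding AE_freq
    by (intro nn_integral_cong_AE) (auto elim!: eventually_mono simp: indicator_def)
  also have "\<dots> = ennreal (2 * pi) * (ennreal (1 / (2 * pi)) * (\<integral>\<^sup>+x\<in>{-pi..<pi}. q x \<partial>lborel))"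
    by (simp add: mult.assoc[symmetric] ennreal_mult[symmetric])
  also have "\<dots> = ennreal (2 * pi) * (\<integral>\<^sup>+x. q x \<partial>freq)"
    by (simp only: nn_integral_freq[OF assms(1)])
  finally show ?thesis .
qed

text \<open>\<open>through P b\<close> is the row vector \<open>b\<^sup>T P\<close>.\<close>
definition through :: "(real \<Rightarrow> nat \<Rightarrow> nat \<Rightarrow> complex) \<Rightarrow> (real \<Rightarrow> nat \<Rightarrow> complex) \<Rightarrow> nat \<times> real \<Rightarrow> complex" where
  "through P b = (\<lambda>(m, x). \<Sum>k. b x k * P x k m)"

text \<open>The image under \<open>through P\<close> of the vector function whose only component is
  \<open>g\<close>, at index \<open>n\<close>.\<close>

definition col :: "(real \<Rightarrow> nat \<Rightarrow> nat \<Rightarrow> complex) \<Rightarrow> (real \<Rightarrow> complex) \<Rightarrow> nat \<Rightarrow> nat \<times> real \<Rightarrow> complex" where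
  "col P g n = (\<lambda>(m, x). g x * P x n m)"

text \<open>The frequency counterpart of the innovation \<open>\<epsilon> m0 u\<close>.\<close>

definition trig_unit :: "int \<Rightarrow> nat \<Rightarrow> nat \<times> real \<Rightarrow> complex" where
  "trig_unit u m0 = (\<lambda>(m, x). if m = m0 then cis (of_int u * x) else 0)"

lemma sq_integrable_cis_freq: "sq_integrable freq (\<lambda>x. cis (c * x))"
proof -
  interpret prob_space freq by (rule prob_space_freq)
  show ?thesis by (rule sq_integrable_bounded[where C=1]) auto
qed

lemma sq_integrable_trig_unit: "sq_integrable (channels N) (trig_unit u m)"
proof (rule sq_integrable_channels)
  fix m'
  have "sq_integrable freq (\<lambda>x. cis (of_int u * x))"
    by (rule sq_integrable_cis_freq)
  then show "sq_integrable freq (\<lambda>x. trig_unit u m (m', x))"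
    by (cases "m' = m") (simp_all add: trig_unit_def)
qed

locale factored_density =
  fixes f P Q :: "real \<Rightarrow> nat \<Rightarrow> nat \<Rightarrow> complex" and N :: nat
  assumes f_borel [measurable]: "(\<lambda>x. f x k n) \<in> borel_measurable borel"
    and P_borel: "m < N \<Longrightarrow> (\<lambda>x. P x k m) \<in> borel_measurable borel"
    and P_sq: "m < N \<Longrightarrow> sq_integrable freq (\<lambda>x. P x k m)"
    and factor: "AE x in freq. \<forall>k n. f x k n = (\<Sum>m<N. P x k m * cnj (P x n m))"
    and left_inverse: "AE x in freq. \<forall>m n. m < N \<longrightarrow> n < N \<longrightarrow> (\<lambda>k. Q x m k * P x k n) sums (if m = n then 1 else 0)"
begin

abbreviation "adm b \<equiv> (AE x in freq. \<forall>m<N. summable (\<lambda>k. b x k * P x k m))"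

lemma through_borel:
  assumes [measurable]: "\<And>k. (\<lambda>x. b x k) \<in> borel_measurable borel"
  shows "through P b \<in> borel_measurable (channels N)" and "m < N \<Longrightarrow> (\<lambda>x. through P b (m, x)) \<in> borel_measurable borel"
proof -
  show *: "(\<lambda>x. through P b (m, x)) \<in> borel_measurable borel" if "m < N" for m
  proof -
    have [measurable]: "(\<lambda>x. P x k m) \<in> borel_measurable borel" for k by (rule P_borel[OF that])
    show ?thesis unfolding through_def by simp
  qed
  show "through P b \<in> borel_measurable (channels N)" by (rule borel_measurable_channels[OF *])
qed

text \<open>The isometry: \<open>quad_form_factor\<close> at almost every frequency, then
  integration. The factor \<open>2 * pi\<close> compensates the normalisation of
  \<open>freq\<close>.\<close>

lemma L2f_norm2_through:
  assumes b: "\<And>k. (\<lambda>x. b x k) \<in> borel_measurable borel" and adm: "adm b"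
  shows "L2f_norm2 f b = ennreal (2 * pi) * (\<integral>\<^sup>+p. ennreal ((cmod (through P b p))\<^sup>2) \<partial>channels N)"
proof -
  have [measurable]: "m < N \<Longrightarrow> (\<lambda>x. through P b (m, x)) \<in> borel_measurable borel" for m
    by (rule through_borel[OF b])
  have "L2f_norm2 f b = ennreal (2 * pi) * (\<integral>\<^sup>+x. (\<Sum>m<N. ennreal ((cmod (through P b (m, x)))\<^sup>2)) \<partial>freq)"
  proof (rule L2f_norm2_freq)
    show "(\<lambda>x. \<Sum>m<N. ennreal ((cmod (through P b (m, x)))\<^sup>2)) \<in> borel_measurable borel"
      by measurable
    show "AE x in freq. quad_form (f x) (b x) = (\<Sum>m<N. ennreal ((cmod (through P b (m, x)))\<^sup>2))"
      using adm factor
    proof eventually_elim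
      case (elim x)
      have "quad_form (f x) (b x) = ennreal (\<Sum>m<N. (cmod (\<Sum>k. b x k * P x k m))\<^sup>2)"
        by (rule quad_form_factor) (use elim in auto)
      then show ?case by (simp add: through_def sum_ennreal)
    qed
  qed
  also have "(\<integral>\<^sup>+x. (\<Sum>m<N. ennreal ((cmod (through P b (m, x)))\<^sup>2)) \<partial>freq) =
      (\<Sum>m<N. \<integral>\<^sup>+x. ennreal ((cmod (through P b (m, x)))\<^sup>2) \<partial>freq)"
    by (intro nn_integral_sum) simp
  also have "\<dots> = (\<integral>\<^sup>+p. ennreal ((cmod (through P b p))\<^sup>2) \<partial>channels N)"
    by (intro nn_integral_channels[symmetric]) simp
  finally show ?thesis .
qed

lemma L2f_norm2_eq:
  assumes "\<And>k. (\<lambda>x. b x k) \<in> borel_measurable borel" "adm b" "sq_integrable (channels N) (through P b)"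
  shows "L2f_norm2 f b = ennreal (2 * pi * ms_norm2 (channels N) (through P b))"
  using assms by (simp add: L2f_norm2_through nn_integral_cmod_sq ennreal_mult)

lemma L2fI:
  assumes "\<And>k. (\<lambda>x. b x k) \<in> borel_measurable borel" "adm b" "sq_integrable (channels N) (through P b)"
  shows "b \<in> L2f f"
  using assms L2f_norm2_eq[OF assms] by (simp add: L2f_def)

text \<open>Finite norm makes \<open>quad_form\<close> finite almost everywhere. There the series
  for \<open>b^T f\<close> converge, and \<open>quad_form_factor_summable\<close> yields convergence
  of \<open>b^T P\<close>.\<close>

lemma L2fD:
  assumes "b \<in> L2f f"
  shows "(\<lambda>x. b x k) \<in> borel_measurable borel" "adm b" "sq_integrable (channels N) (through P b)"
proof -
  have b [measurable]: "(\<lambda>x. b x k) \<in> borel_measurable borel" for k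
    using assms by (simp add: L2f_def)
  then show "(\<lambda>x. b x k) \<in> borel_measurable borel" .
  \<comment> \<open>\<open>quad_form\<close> branches on the convergence of series. The set of
    convergence is the set where the partial sums are Cauchy, and that set is measurable.\<close>
  have summable_pred: "Measurable.pred borel (\<lambda>x. summable (\<lambda>k. g k x))"
    if [measurable]: "\<And>k. g k \<in> borel_measurable borel" for g :: "nat \<Rightarrow> real \<Rightarrow> complex"
  proof -
    have "{x \<in> space borel. Cauchy (\<lambda>n. \<Sum>k<n. g k x)} \<in> sets borel" by measurable
    then show ?thesis
      by (simp add: pred_def summable_iff_convergent Cauchy_convergent_iff)
  qed
  have q [measurable]: "(\<lambda>x. quad_form (f x) (b x)) \<in> borel_measurable borel"
  proof -
    have [measurable]: "Measurable.pred borel (\<lambda>x. summable (\<lambda>k. b x k * f x k n))" for n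
      by (rule summable_pred) measurable
    have [measurable]: "Measurable.pred borel (\<lambda>x. summable (\<lambda>n. (\<Sum>k. b x k * f x k n) * cnj (b x n)))"
      by (rule summable_pred) measurable
    show ?thesis unfolding quad_form_def by measurable
  qed
  have "L2f_norm2 f b = ennreal (2 * pi) * (\<integral>\<^sup>+x. quad_form (f x) (b x) \<partial>freq)"
    by (rule L2f_norm2_freq[OF q]) simp
  moreover have "L2f_norm2 f b < \<infinity>" using assms by (simp add: L2f_def)
  ultimately have "(\<integral>\<^sup>+x. quad_form (f x) (b x) \<partial>freq) \<noteq> \<infinity>"
    by (auto simp: ennreal_mult_eq_top_iff less_top[symmetric])
  then have "AE x in freq. quad_form (f x) (b x) \<noteq> \<infinity>"
    by (intro nn_integral_noteq_infinite) auto
  then show adm: "adm b"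
    using factor left_inverse
  proof eventually_elim
    case (elim x)
    show ?case
    proof (intro allI impI)
      fix m assume "m < N"
      show "summable (\<lambda>k. b x k * P x k m)"
        by (rule quad_form_factor_summable[where F="f x" and P="P x" and Q="Q x" and N=N])
           (use elim \<open>m < N\<close> in auto)
    qed
  qed
  show "sq_integrable (channels N) (through P b)"
  proof (rule sq_integrableI_nn)
    show "through P b \<in> borel_measurable (channels N)" by (rule through_borel[OF b])
    have "ennreal (2 * pi) * (\<integral>\<^sup>+p. ennreal ((cmod (through P b p))\<^sup>2) \<partial>channels N) < \<infinity>"
      using \<open>L2f_norm2 f b < \<infinity>\<close> L2f_norm2_through[OF b adm] by simp
    then show "(\<integral>\<^sup>+p. ennreal ((cmod (through P b p))\<^sup>2) \<partial>channels N) < \<infinity>"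
      by (auto simp: ennreal_mult_less_top less_top[symmetric] ennreal_mult_eq_top_iff)
  qed
qed

lemma adm_diff: "adm b \<Longrightarrow> adm c \<Longrightarrow> adm (\<lambda>x k. b x k - c x k)"
proof (elim AE_mp, rule AE_I2, intro impI allI)
  fix x m
  assume "\<forall>m<N. summable (\<lambda>k. b x k * P x k m)" "\<forall>m<N. summable (\<lambda>k. c x k * P x k m)" "m < N"
  then show "summable (\<lambda>k. (b x k - c x k) * P x k m)"
    using summable_diff[of "\<lambda>k. b x k * P x k m" "\<lambda>k. c x k * P x k m"] by (simp add: left_diff_distrib)
qed

lemma through_diff_AE:
  assumes b: "\<And>k. (\<lambda>x. b x k) \<in> borel_measurable borel" "adm b"
    and c: "\<And>k. (\<lambda>x. c x k) \<in> borel_measurable borel" "adm c"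
  shows "AE p in channels N. through P (\<lambda>x k. b x k - c x k) p = through P b p - through P c p"
proof (rule AE_channels)
  show "through P (\<lambda>x k. b x k - c x k) \<in> borel_measurable (channels N)"
    using b(1) c(1) by (intro through_borel) simp
  show "(\<lambda>p. through P b p - through P c p) \<in> borel_measurable (channels N)"
    using through_borel(1)[of b] through_borel(1)[of c] b(1) c(1) by simp
  fix m assume m: "m < N"
  show "AE x in freq. through P (\<lambda>x k. b x k - c x k) (m, x) = through P b (m, x) - through P c (m, x)"
    using b(2) c(2)
  proof eventually_elim
    case (elim x)
    then show ?case
      using m suminf_diff[of "\<lambda>k. b x k * P x k m" "\<lambda>k. c x k * P x k m"]
      by (simp add: through_def left_diff_distrib)
  qed
qed

lemma L2f_norm2_diff:
  assumes b: "\<And>k. (\<lambda>x. b x k) \<in> borel_measurable borel" "adm b" "sq_integrable (channels N) (through P b)"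
    and c: "\<And>k. (\<lambda>x. c x k) \<in> borel_measurable borel" "adm c" "sq_integrable (channels N) (through P c)"
  shows "L2f_norm2 f (\<lambda>x k. b x k - c x k) =
    ennreal (2 * pi * ms_norm2 (channels N) (\<lambda>p. through P b p - through P c p))"
proof -
  let ?d = "\<lambda>x k. b x k - c x k"
  have meas: "(\<lambda>x. ?d x k) \<in> borel_measurable borel" for k using b(1) c(1) by simp
  note AE = through_diff_AE[OF b(1,2) c(1,2)]
  have sq: "sq_integrable (channels N) (\<lambda>p. through P b p - through P c p)"
    by (rule sq_integrable_diff[OF b(3) c(3)])
  have "sq_integrable (channels N) (through P ?d)"
    by (rule sq_integrable_cong_AE[OF sq through_borel(1)[OF meas]]) (use AE in eventually_elim, simp)
  then show ?thesis
    using L2f_norm2_eq[OF meas adm_diff[OF b(2) c(2)]]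
      ms_norm2_cong_AE[OF AE through_borel(1)[OF meas]] sq by (simp add: sq_integrable_def)
qed

end

definition valid_simple :: "(real set \<times> nat \<times> complex) list \<Rightarrow> bool" where
  "valid_simple xs \<longleftrightarrow> (\<forall>(B, n, c)\<in>set xs. B \<in> sets borel \<and> B \<subseteq> {-pi..<pi})"

context factored_density
begin

lemma col_sq:
  assumes [measurable]: "g \<in> borel_measurable borel" and "\<And>x. cmod (g x) \<le> C"
  shows "sq_integrable (channels N) (col P g n)"
proof (rule sq_integrable_channels)
  fix m assume "m < N"
  have "sq_integrable freq (\<lambda>x. g x * P x n m)"
    by (rule sq_integrable_bounded_mult[OF P_sq[OF \<open>m < N\<close>], where C=C]) (use assms in auto)
  then show "sq_integrable freq (\<lambda>x. col P g n (m, x))" by (simp add: col_def)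
qed

text \<open>Summing the products of entries of \<open>P\<close> over the channels restores
  \<open>f\<close>. Hence these inner products are the covariances of the stochastic measure for
  indicators and those of the sequence for exponentials.\<close>

lemma col_inner:
  assumes [measurable]: "g \<in> borel_measurable borel" "h \<in> borel_measurable borel"
    and g: "\<And>x. cmod (g x) \<le> C" and h: "\<And>x. cmod (h x) \<le> D"
  shows "ms_inner (channels N) (col P g k) (col P h n) =
    of_real (1 / (2 * pi)) * (LINT x:{-pi..<pi}|lborel. g x * cnj (h x) * f x k n)"
proof -
  have sq: "sq_integrable freq (\<lambda>x. col P g k (m, x))" "sq_integrable freq (\<lambda>x. col P h n (m, x))" if "m < N" for m
    using sq_integrable_bounded_mult[OF P_sq[OF that, of k] _ g] sq_integrable_bounded_mult[OF P_sq[OF that, of n] _ h]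
    by (auto simp: col_def)
  have "ms_inner (channels N) (col P g k) (col P h n) =
      (\<Sum>m<N. LINT x|freq. col P g k (m, x) * cnj (col P h n (m, x)))"
    unfolding ms_inner_def[symmetric]
    by (rule ms_inner_channels[OF col_sq[OF assms(1) g] col_sq[OF assms(2) h]])
  also have "\<dots> = (LINT x|freq. (\<Sum>m<N. col P g k (m, x) * cnj (col P h n (m, x))))"
    by (intro Bochner_Integration.integral_sum[symmetric] sq_integrable_mult_cnj) (auto intro: sq)
  also have "\<dots> = (LINT x|freq. g x * cnj (h x) * f x k n)"
  proof (rule integral_cong_AE)
    have [measurable]: "(\<lambda>x. P x k m) \<in> borel_measurable borel" if "m < N" for k m by (rule P_borel[OF that])
    show "(\<lambda>x. \<Sum>m<N. col P g k (m, x) * cnj (col P h n (m, x))) \<in> borel_measurable freq"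
      unfolding col_def by simp
    show "(\<lambda>x. g x * cnj (h x) * f x k n) \<in> borel_measurable freq" by simp
    show "AE x in freq. (\<Sum>m<N. col P g k (m, x) * cnj (col P h n (m, x))) = g x * cnj (h x) * f x k n"
      using factor by eventually_elim (simp add: col_def sum_distrib_left mult_ac)
  qed
  also have "\<dots> = of_real (1 / (2 * pi)) * (LINT x:{-pi..<pi}|lborel. g x * cnj (h x) * f x k n)"
    by (subst integral_freq) (auto simp: scaleR_conv_of_real)
  finally show ?thesis .
qed

lemma trig_vec_through:
  assumes "finite F"
  shows "(\<lambda>x. trig_vec F c x k) \<in> borel_measurable borel"
    and "adm (trig_vec F c)"
    and "through P (trig_vec F c) = (\<lambda>p. \<Sum>(j, n)\<in>F. c (j, n) * col P (\<lambda>x. cis (of_int j * x)) n p)"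
proof -
  have sums: "(\<lambda>k. trig_vec F c x k * P x k m) sums (\<Sum>(j, n)\<in>F. c (j, n) * (cis (of_int j * x) * P x n m))" for x m
  proof -
    have "(\<lambda>k. \<Sum>q\<in>F. if k = snd q then c q * cis (of_int (fst q) * x) * P x k m else 0) sums
        (\<Sum>q\<in>F. c q * cis (of_int (fst q) * x) * P x (snd q) m)"
      by (intro sums_sum sums_single)
    moreover have "trig_vec F c x k * P x k m =
        (\<Sum>q\<in>F. if k = snd q then c q * cis (of_int (fst q) * x) * P x k m else 0)" for k
      unfolding trig_vec_def sum_distrib_right by (intro sum.cong) (auto simp: split_beta)
    ultimately show ?thesis by (simp add: split_beta mult.assoc)
  qed
  show "adm (trig_vec F c)" using sums by (auto simp: sums_iff)
  show "through P (trig_vec F c) = (\<lambda>p. \<Sum>(j, n)\<in>F. c (j, n) * col P (\<lambda>x. cis (of_int j * x)) n p)"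
    using sums by (auto simp: fun_eq_iff through_def col_def sums_iff)
  show "(\<lambda>x. trig_vec F c x k) \<in> borel_measurable borel"
    unfolding trig_vec_def split_beta by (intro borel_measurable_sum) simp
qed

lemma simple_vec_through:
  assumes xs: "valid_simple xs"
  shows "(\<lambda>x. simple_vec xs x k) \<in> borel_measurable borel"
    and "adm (simple_vec xs)"
    and "through P (simple_vec xs) = (\<lambda>p. \<Sum>(B, n, c)\<leftarrow>xs. c * col P (indicator B) n p)"
    and "sq_integrable (channels N) (through P (simple_vec xs))"
proof -
  have sums: "(\<lambda>k. simple_vec xs x k * P x k m) sums (\<Sum>(B, n, c)\<leftarrow>xs. c * (indicator B x * P x n m))" for x m
  proof (induction xs)
    case Nil
    then show ?case by (simp add: simple_vec_def)
  next
    case (Cons t xs)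
    obtain B n c where t: "t = (B, n, c)" by (cases t)
    from sums_add[OF sums_single[of n "\<lambda>k. c * indicator B x * P x k m"] Cons]
    have "(\<lambda>k. (if k = n then c * indicator B x * P x k m else 0) + simple_vec xs x k * P x k m) sums
        (c * indicator B x * P x n m + (\<Sum>(B, n, c)\<leftarrow>xs. c * (indicator B x * P x n m)))" .
    moreover have "simple_vec (t # xs) x k * P x k m =
        (if k = n then c * indicator B x * P x k m else 0) + simple_vec xs x k * P x k m" for k
      by (simp add: simple_vec_def t distrib_right)
    ultimately show ?case by (simp add: t mult.assoc)
  qed
  show "adm (simple_vec xs)" using sums by (auto simp: sums_iff)
  show eq: "through P (simple_vec xs) = (\<lambda>p. \<Sum>(B, n, c)\<leftarrow>xs. c * col P (indicator B) n p)"
    using sums by (auto simp: fun_eq_iff through_def col_def sums_iff)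
  show "(\<lambda>x. simple_vec xs x k) \<in> borel_measurable borel"
    using xs
  proof (induction xs)
    case (Cons t xs)
    obtain B n c where t: "t = (B, n, c)" by (cases t)
    have [measurable]: "B \<in> sets borel" "(\<lambda>x. simple_vec xs x k) \<in> borel_measurable borel"
      using Cons by (auto simp: valid_simple_def t)
    have "(\<lambda>x. simple_vec (t # xs) x k) = (\<lambda>x. (if n = k then c * indicator B x else 0) + simple_vec xs x k)"
      by (simp add: simple_vec_def t)
    then show ?case by simp
  qed (simp add: simple_vec_def)
  show "sq_integrable (channels N) (through P (simple_vec xs))"
    unfolding eq using xs
  proof (induction xs)
    case (Cons t xs)
    obtain B n c where t: "t = (B, n, c)" by (cases t)
    have B [measurable]: "B \<in> sets borel"
      and IH: "sq_integrable (channels N) (\<lambda>p. \<Sum>(B, n, c)\<leftarrow>xs. c * col P (indicator B) n p)"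
      using Cons by (auto simp: valid_simple_def t)
    have "sq_integrable (channels N) (col P (indicator B) n)"
      by (rule col_sq[where C=1]) (auto simp: indicator_def)
    from sq_integrable_add[OF sq_integrable_cmult[OF this, of c] IH] show ?case by (simp add: t)
  qed simp
qed

end

section \<open>Stochastic integration\<close>

locale stochastic_integration = factored_density +
  fixes \<Omega> :: "'w measure" and Z :: "nat \<Rightarrow> real set \<Rightarrow> 'w \<Rightarrow> complex"
  assumes Z_sq: "B \<in> sets borel \<Longrightarrow> B \<subseteq> {-pi..<pi} \<Longrightarrow> sq_integrable \<Omega> (Z k B)"
    and Z_cov: "B \<in> sets borel \<Longrightarrow> C \<in> sets borel \<Longrightarrow> B \<subseteq> {-pi..<pi} \<Longrightarrow> C \<subseteq> {-pi..<pi} \<Longrightarrow>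
      ms_inner \<Omega> (Z k B) (Z n C) = complex_of_real (1 / (2 * pi)) * (LINT x:B \<inter> C|lborel. f x k n)"
begin

abbreviation "step xs \<equiv> through P (simple_vec xs)"
abbreviation "step_int xs \<equiv> simple_stoch_integral Z xs"

lemma Z_gram:
  assumes B: "B \<in> sets borel" "B \<subseteq> {-pi..<pi}" and C: "C \<in> sets borel" "C \<subseteq> {-pi..<pi}"
  shows "ms_inner \<Omega> (Z k B) (Z n C) = ms_inner (channels N) (col P (indicator B) k) (col P (indicator C) n)"
proof -
  have "ms_inner (channels N) (col P (indicator B) k) (col P (indicator C) n) =
      of_real (1 / (2 * pi)) * (LINT x:{-pi..<pi}|lborel. indicator B x * cnj (indicator C x) * f x k n)"
    by (rule col_inner[where C=1 and D=1]) (use B C in \<open>auto simp: indicator_def\<close>)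
  also have "(LINT x:{-pi..<pi}|lborel. indicator B x * cnj (indicator C x) * f x k n) = (LINT x:B \<inter> C|lborel. f x k n)"
    unfolding set_lebesgue_integral_def
    by (intro Bochner_Integration.integral_cong) (use B C in \<open>auto simp: indicator_def\<close>)
  finally show ?thesis using Z_cov[OF B(1) C(1) B(2) C(2)] by simp
qed

lemma step_int_props:
  assumes "valid_simple xs"
  shows "sq_integrable \<Omega> (step_int xs)" and "ms_norm2 \<Omega> (step_int xs) = ms_norm2 (channels N) (step xs)"
proof -
  \<comment> \<open>Positions in the list serve as indices, since the same entry may occur more than
    once.\<close>
  define B where "B i = fst (xs ! i)" for i
  define n where "n i = fst (snd (xs ! i))" for i
  define c where "c i = snd (snd (xs ! i))" for i
  have B: "B i \<in> sets borel" "B i \<subseteq> {-pi..<pi}" if "i \<in> {..<length xs}" for i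
    using assms that nth_mem[of i xs] unfolding valid_simple_def B_def by (auto simp: split_beta)
  have 1: "step_int xs = (\<lambda>w. \<Sum>i\<in>{..<length xs}. c i * Z (n i) (B i) w)"
    by (simp add: fun_eq_iff simple_stoch_integral_def sum_list_sum_nth split_beta B_def n_def c_def lessThan_atLeast0)
  have 2: "step xs = (\<lambda>p. \<Sum>i\<in>{..<length xs}. c i * col P (indicator (B i)) (n i) p)"
    unfolding simple_vec_through(3)[OF assms]
    by (simp add: fun_eq_iff sum_list_sum_nth split_beta B_def n_def c_def lessThan_atLeast0)
  show "sq_integrable \<Omega> (step_int xs)"
    unfolding 1 by (intro sq_integrable_sum sq_integrable_cmult Z_sq B)
  show "ms_norm2 \<Omega> (step_int xs) = ms_norm2 (channels N) (step xs)"
    unfolding 1 2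
  proof (rule ms_norm2_gram)
    show "sq_integrable (channels N) (col P (indicator (B i)) (n i))" if "i \<in> {..<length xs}" for i
      by (rule col_sq[where C=1]) (use B[OF that] in \<open>auto simp: indicator_def\<close>)
  qed (auto intro!: Z_sq Z_gram B)
qed

text \<open>\<open>I\<close> is the stochastic integral of any \<open>b\<close> with \<open>b\<^sup>T P = v\<close>.\<close>
definition integral_of :: "(nat \<times> real \<Rightarrow> complex) \<Rightarrow> ('w \<Rightarrow> complex) \<Rightarrow> bool" where
  "integral_of v I \<longleftrightarrow> sq_integrable (channels N) v \<and> sq_integrable \<Omega> I \<and>
    (\<forall>e>0. \<exists>xs. valid_simple xs \<and> ms_norm2 (channels N) (\<lambda>p. v p - step xs p) < e \<and>
       ms_norm2 \<Omega> (\<lambda>w. I w - step_int xs w) < e)"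

lemma integral_of_sq: "integral_of v I \<Longrightarrow> sq_integrable (channels N) v" "integral_of v I \<Longrightarrow> sq_integrable \<Omega> I"
  by (simp_all add: integral_of_def)

lemma integral_of_sequence:
  assumes "integral_of v I"
  shows "\<exists>xs. (\<forall>r. valid_simple (xs r)) \<and>
    ms_tendsto (channels N) (\<lambda>r. step (xs r)) v sequentially \<and>
    ms_tendsto \<Omega> (\<lambda>r. step_int (xs r)) I sequentially"
proof -
  have "\<exists>xs. valid_simple xs \<and> ms_norm2 (channels N) (\<lambda>p. v p - step xs p) < 1 / real (Suc r) \<and>
       ms_norm2 \<Omega> (\<lambda>w. I w - step_int xs w) < 1 / real (Suc r)" for r
    using assms unfolding integral_of_def by (simp del: of_nat_Suc)
  then obtain xs where xs: "\<And>r. valid_simple (xs r)"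
    "\<And>r. ms_norm2 (channels N) (\<lambda>p. v p - step (xs r) p) < 1 / real (Suc r)"
    "\<And>r. ms_norm2 \<Omega> (\<lambda>w. I w - step_int (xs r) w) < 1 / real (Suc r)"
    by metis
  have "(\<lambda>r. 1 / real (Suc r)) \<longlonglongrightarrow> 0" by (rule LIMSEQ_Suc[OF lim_1_over_n])
  note sandwich = tendsto_sandwich[OF always_eventually always_eventually tendsto_const this]
  show ?thesis
  proof (intro exI[of _ xs] conjI allI xs(1))
    show "ms_tendsto (channels N) (\<lambda>r. step (xs r)) v sequentially"
      by (rule sandwich) (use xs(2) in \<open>auto intro: less_imp_le\<close>)
    show "ms_tendsto \<Omega> (\<lambda>r. step_int (xs r)) I sequentially"
      by (rule sandwich) (use xs(3) in \<open>auto intro: less_imp_le\<close>)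
  qed
qed

lemma integral_ofI:
  assumes "sq_integrable (channels N) v" "sq_integrable \<Omega> I" "\<And>r. valid_simple (xs r)"
    "ms_tendsto (channels N) (\<lambda>r. step (xs r)) v sequentially"
    "ms_tendsto \<Omega> (\<lambda>r. step_int (xs r)) I sequentially"
  shows "integral_of v I"
  unfolding integral_of_def
proof (intro conjI assms(1,2) allI impI)
  fix e :: real assume "e > 0"
  then have "\<forall>\<^sub>F r in sequentially. ms_norm2 (channels N) (\<lambda>p. v p - step (xs r) p) < e \<and>
      ms_norm2 \<Omega> (\<lambda>w. I w - step_int (xs r) w) < e"
    using order_tendstoD(2)[OF assms(4)] order_tendstoD(2)[OF assms(5)] by (simp add: eventually_conj)
  then obtain r where "ms_norm2 (channels N) (\<lambda>p. v p - step (xs r) p) < e \<and> ms_norm2 \<Omega> (\<lambda>w. I w - step_int (xs r) w) < e"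
    by (auto simp: eventually_sequentially)
  then show "\<exists>xs. valid_simple xs \<and> ms_norm2 (channels N) (\<lambda>p. v p - step xs p) < e \<and>
       ms_norm2 \<Omega> (\<lambda>w. I w - step_int xs w) < e"
    using assms(3)[of r] by (intro exI[of _ "xs r"]) simp
qed

text \<open>By the isometry, convergence in \<open>L\<^sub>2(f)\<close> is convergence of the
  images, so the integral depends on \<open>b\<close> only through \<open>b^T P\<close>.\<close>

lemma has_stoch_integral_iff:
  assumes b: "b \<in> L2f f"
  shows "has_stoch_integral \<Omega> f Z b I \<longleftrightarrow> integral_of (through P b) I"
proof -
  have eq: "L2f_norm2 f (\<lambda>x k. b x k - simple_vec xs x k) =
      ennreal (2 * pi * ms_norm2 (channels N) (\<lambda>p. through P b p - step xs p))" if "valid_simple xs" for xs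
    by (rule L2f_norm2_diff[OF L2fD[OF b] simple_vec_through(1,2,4)[OF that]])
  have lim: "(\<lambda>r. L2f_norm2 f (\<lambda>x k. b x k - simple_vec (xs r) x k)) \<longlonglongrightarrow> 0 \<longleftrightarrow>
      ms_tendsto (channels N) (\<lambda>r. step (xs r)) (through P b) sequentially" if "\<And>r. valid_simple (xs r)" for xs
  proof -
    have "(\<lambda>r. L2f_norm2 f (\<lambda>x k. b x k - simple_vec (xs r) x k)) \<longlonglongrightarrow> 0 \<longleftrightarrow>
        (\<lambda>r. 2 * pi * ms_norm2 (channels N) (\<lambda>p. through P b p - step (xs r) p)) \<longlonglongrightarrow> 0"
      unfolding eq[OF that] by (subst tendsto_ennreal_iff[symmetric]) auto
    also have "\<dots> \<longleftrightarrow> ms_tendsto (channels N) (\<lambda>r. step (xs r)) (through P b) sequentially"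
      using tendsto_mult_left_iff[of "2 * pi" "\<lambda>r. ms_norm2 (channels N) (\<lambda>p. through P b p - step (xs r) p)" 0 sequentially]
      by simp
    finally show ?thesis .
  qed
  show ?thesis
  proof
    assume "has_stoch_integral \<Omega> f Z b I"
    then obtain xs :: "nat \<Rightarrow> (real set \<times> nat \<times> complex) list" where
      I: "sq_integrable \<Omega> I" and xs: "\<And>r. valid_simple (xs r)"
      and l: "(\<lambda>r. L2f_norm2 f (\<lambda>x k. b x k - simple_vec (xs r) x k)) \<longlonglongrightarrow> 0"
      and l': "(\<lambda>r. ms_norm2 \<Omega> (\<lambda>w. I w - step_int (xs r) w)) \<longlonglongrightarrow> 0"
      unfolding has_stoch_integral_def valid_simple_def by auto
    show "integral_of (through P b) I"
      by (rule integral_ofI[OF L2fD(3)[OF b] I xs _ l']) (use l lim[OF xs] in simp)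
  next
    assume *: "integral_of (through P b) I"
    obtain xs where xs: "\<And>r. valid_simple (xs r)"
      "ms_tendsto (channels N) (\<lambda>r. step (xs r)) (through P b) sequentially"
      "ms_tendsto \<Omega> (\<lambda>r. step_int (xs r)) I sequentially"
      using integral_of_sequence[OF *] by auto
    show "has_stoch_integral \<Omega> f Z b I"
      unfolding has_stoch_integral_def
    proof (intro conjI exI[of _ xs])
      show "sq_integrable \<Omega> I" by (rule integral_of_sq(2)[OF *])
      show "\<forall>r. \<forall>(B, n, c)\<in>set (xs r). B \<in> sets borel \<and> B \<subseteq> {-pi..<pi}"
        using xs(1) by (simp add: valid_simple_def)
    qed (use b xs lim[OF xs(1)] in simp_all)
  qed
qed

text \<open>The isometry of the stochastic integral: an equality of Gram matrices on step functions,
  passed to the limit.\<close>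

lemma integral_of_norm2:
  assumes "integral_of v I"
  shows "ms_norm2 \<Omega> I = ms_norm2 (channels N) v"
proof -
  obtain xs where xs: "\<And>r. valid_simple (xs r)"
    "ms_tendsto (channels N) (\<lambda>r. step (xs r)) v sequentially"
    "ms_tendsto \<Omega> (\<lambda>r. step_int (xs r)) I sequentially"
    using integral_of_sequence[OF assms] by auto
  have "(\<lambda>r. ms_norm2 (channels N) (step (xs r))) \<longlonglongrightarrow> ms_norm2 (channels N) v"
    by (rule ms_tendsto_norm2[OF xs(2) simple_vec_through(4)[OF xs(1)] integral_of_sq(1)[OF assms]])
  moreover have "(\<lambda>r. ms_norm2 \<Omega> (step_int (xs r))) \<longlonglongrightarrow> ms_norm2 \<Omega> I"
    by (rule ms_tendsto_norm2[OF xs(3) step_int_props(1)[OF xs(1)] integral_of_sq(2)[OF assms]])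
  ultimately show ?thesis
    unfolding step_int_props(2)[OF xs(1)] by (rule LIMSEQ_unique[rotated])
qed

lemma integral_of_add:
  assumes "integral_of v I" "integral_of v' I'"
  shows "integral_of (\<lambda>p. v p + v' p) (\<lambda>w. I w + I' w)"
proof -
  obtain xs where xs: "\<And>r. valid_simple (xs r)"
    "ms_tendsto (channels N) (\<lambda>r. step (xs r)) v sequentially"
    "ms_tendsto \<Omega> (\<lambda>r. step_int (xs r)) I sequentially"
    using integral_of_sequence[OF assms(1)] by auto
  obtain ys where ys: "\<And>r. valid_simple (ys r)"
    "ms_tendsto (channels N) (\<lambda>r. step (ys r)) v' sequentially"
    "ms_tendsto \<Omega> (\<lambda>r. step_int (ys r)) I' sequentially"
    using integral_of_sequence[OF assms(2)] by auto
  have val: "valid_simple (xs r @ ys r)" for r using xs(1)[of r] ys(1)[of r] by (auto simp: valid_simple_def)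
  have 1: "step (xs r @ ys r) = (\<lambda>p. step (xs r) p + step (ys r) p)" for r
    by (simp add: simple_vec_through(3)[OF val] simple_vec_through(3)[OF xs(1)] simple_vec_through(3)[OF ys(1)])
  have 2: "step_int (xs r @ ys r) = (\<lambda>w. step_int (xs r) w + step_int (ys r) w)" for r
    by (simp add: simple_stoch_integral_def fun_eq_iff)
  show ?thesis
  proof (rule integral_ofI[OF _ _ val])
    show "ms_tendsto (channels N) (\<lambda>r. step (xs r @ ys r)) (\<lambda>p. v p + v' p) sequentially"
      unfolding 1 by (intro ms_tendsto_add xs ys simple_vec_through(4) integral_of_sq(1)[OF assms(1)] integral_of_sq(1)[OF assms(2)])
    show "ms_tendsto \<Omega> (\<lambda>r. step_int (xs r @ ys r)) (\<lambda>w. I w + I' w) sequentially"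
      unfolding 2 by (intro ms_tendsto_add xs ys step_int_props(1) integral_of_sq(2)[OF assms(1)] integral_of_sq(2)[OF assms(2)])
    show "sq_integrable (channels N) (\<lambda>p. v p + v' p)"
      by (rule sq_integrable_add[OF integral_of_sq(1)[OF assms(1)] integral_of_sq(1)[OF assms(2)]])
    show "sq_integrable \<Omega> (\<lambda>w. I w + I' w)"
      by (rule sq_integrable_add[OF integral_of_sq(2)[OF assms(1)] integral_of_sq(2)[OF assms(2)]])
  qed
qed

lemma integral_of_cmult:
  assumes "integral_of v I"
  shows "integral_of (\<lambda>p. a * v p) (\<lambda>w. a * I w)"
proof -
  obtain xs where xs: "\<And>r. valid_simple (xs r)"
    "ms_tendsto (channels N) (\<lambda>r. step (xs r)) v sequentially"
    "ms_tendsto \<Omega> (\<lambda>r. step_int (xs r)) I sequentially"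
    using integral_of_sequence[OF assms(1)] by auto
  define ys where "ys r = map (\<lambda>(B, n, c). (B, n, a * c)) (xs r)" for r
  have val: "valid_simple (ys r)" for r using xs(1)[of r] by (auto simp: valid_simple_def ys_def)
  have 1: "step (ys r) = (\<lambda>p. a * step (xs r) p)" for r
    by (simp add: simple_vec_through(3)[OF val] simple_vec_through(3)[OF xs(1)] fun_eq_iff)
       (simp add: ys_def sum_list_const_mult[symmetric] o_def split_beta mult.assoc)
  have 2: "step_int (ys r) = (\<lambda>w. a * step_int (xs r) w)" for r
    by (simp add: simple_stoch_integral_def fun_eq_iff ys_def sum_list_const_mult[symmetric] o_def split_beta mult.assoc)
  show ?thesis
  proof (rule integral_ofI[OF _ _ val])
    show "ms_tendsto (channels N) (\<lambda>r. step (ys r)) (\<lambda>p. a * v p) sequentially"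
      unfolding 1 by (rule ms_tendsto_cmult[OF xs(2)])
    show "ms_tendsto \<Omega> (\<lambda>r. step_int (ys r)) (\<lambda>w. a * I w) sequentially"
      unfolding 2 by (rule ms_tendsto_cmult[OF xs(3)])
  qed (rule sq_integrable_cmult[OF integral_of_sq(1)[OF assms]] sq_integrable_cmult[OF integral_of_sq(2)[OF assms]])+
qed

lemma integral_of_diff:
  assumes "integral_of v I" "integral_of v' I'"
  shows "integral_of (\<lambda>p. v p - v' p) (\<lambda>w. I w - I' w)"
  using integral_of_add[OF assms(1) integral_of_cmult[OF assms(2), of "-1"]] by simp

lemma integral_of_sum:
  assumes "\<And>i. i \<in> J \<Longrightarrow> integral_of (v i) (I i)"
  shows "integral_of (\<lambda>p. \<Sum>i\<in>J. v i p) (\<lambda>w. \<Sum>i\<in>J. I i w)"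
proof -
  have zero: "integral_of (\<lambda>p. 0) (\<lambda>w. 0)"
    by (rule integral_ofI[where xs="\<lambda>_. []"])
       (simp_all add: valid_simple_def through_def simple_vec_def simple_stoch_integral_def split_beta)
  show ?thesis
    using assms
    by (induction J rule: infinite_finite_induct) (simp_all add: zero integral_of_add)
qed

lemma integral_of_limit:
  assumes vI: "\<And>r. integral_of (v r) (I r)"
    and v: "sq_integrable (channels N) v0" "ms_tendsto (channels N) v v0 sequentially"
    and I: "sq_integrable \<Omega> I0" "ms_tendsto \<Omega> I I0 sequentially"
  shows "integral_of v0 I0"
  unfolding integral_of_def
proof (intro conjI v(1) I(1) allI impI)
  fix e :: real assume "e > 0"
  then have e: "0 < e / 4" by simp
  have "\<forall>\<^sub>F r in sequentially. ms_norm2 (channels N) (\<lambda>p. v0 p - v r p) < e / 4 \<and> ms_norm2 \<Omega> (\<lambda>w. I0 w - I r w) < e / 4"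
    using order_tendstoD(2)[OF v(2) e] order_tendstoD(2)[OF I(2) e] by (simp add: eventually_conj)
  then obtain r where r: "ms_norm2 (channels N) (\<lambda>p. v0 p - v r p) < e / 4" "ms_norm2 \<Omega> (\<lambda>w. I0 w - I r w) < e / 4"
    by (auto simp: eventually_sequentially)
  obtain xs where xs: "valid_simple xs" "ms_norm2 (channels N) (\<lambda>p. v r p - step xs p) < e / 4"
    "ms_norm2 \<Omega> (\<lambda>w. I r w - step_int xs w) < e / 4"
    using vI[of r] e unfolding integral_of_def by blast
  have "ms_norm2 (channels N) (\<lambda>p. (v0 p - v r p) + (v r p - step xs p))
      \<le> 2 * ms_norm2 (channels N) (\<lambda>p. v0 p - v r p) + 2 * ms_norm2 (channels N) (\<lambda>p. v r p - step xs p)"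
    by (intro ms_norm2_add_le sq_integrable_diff v(1) integral_of_sq(1)[OF vI] simple_vec_through(4)[OF xs(1)])
  moreover have "ms_norm2 \<Omega> (\<lambda>w. (I0 w - I r w) + (I r w - step_int xs w))
      \<le> 2 * ms_norm2 \<Omega> (\<lambda>w. I0 w - I r w) + 2 * ms_norm2 \<Omega> (\<lambda>w. I r w - step_int xs w)"
    by (intro ms_norm2_add_le sq_integrable_diff I(1) integral_of_sq(2)[OF vI] step_int_props(1)[OF xs(1)])
  ultimately show "\<exists>xs. valid_simple xs \<and> ms_norm2 (channels N) (\<lambda>p. v0 p - step xs p) < e \<and>
       ms_norm2 \<Omega> (\<lambda>w. I0 w - step_int xs w) < e"
    using xs r by (intro exI[of _ xs]) simp
qed

text \<open>Differences of integrals have the norm of the differences of integrands, so converging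
  integrands give Cauchy integrals, and completeness provides the limit.\<close>

lemma integral_of_complete:
  assumes vI: "\<And>r. integral_of (v r) (I r)"
    and v: "sq_integrable (channels N) v0" "ms_tendsto (channels N) v v0 sequentially"
  shows "\<exists>I0. integral_of v0 I0 \<and> sq_integrable \<Omega> I0 \<and> ms_tendsto \<Omega> I I0 sequentially"
proof -
  have "\<exists>n0. \<forall>m\<ge>n0. \<forall>n\<ge>n0. ms_norm2 \<Omega> (\<lambda>w. I m w - I n w) < e" if "e > 0" for e
  proof -
    have "0 < e / 4" using that by simp
    from order_tendstoD(2)[OF v(2) this] obtain n0
      where n0: "\<And>n. n \<ge> n0 \<Longrightarrow> ms_norm2 (channels N) (\<lambda>p. v0 p - v n p) < e / 4"
      by (auto simp: eventually_sequentially)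
    have "ms_norm2 \<Omega> (\<lambda>w. I m w - I n w) < e" if "m \<ge> n0" "n \<ge> n0" for m n
    proof -
      have "ms_norm2 \<Omega> (\<lambda>w. I m w - I n w) = ms_norm2 (channels N) (\<lambda>p. v m p - v n p)"
        by (rule integral_of_norm2[OF integral_of_diff[OF vI vI]])
      also have "\<dots> = ms_norm2 (channels N) (\<lambda>p. (v m p - v0 p) + (v0 p - v n p))" by simp
      also have "\<dots> \<le> 2 * ms_norm2 (channels N) (\<lambda>p. v m p - v0 p) + 2 * ms_norm2 (channels N) (\<lambda>p. v0 p - v n p)"
        by (intro ms_norm2_add_le sq_integrable_diff v(1) integral_of_sq(1)[OF vI])
      also have "\<dots> < e"
        using n0[OF that(1)] n0[OF that(2)] ms_norm2_minus_commute[of "channels N" "v m" v0] by simp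
      finally show ?thesis .
    qed
    then show ?thesis by blast
  qed
  from ms_complete[OF integral_of_sq(2)[OF vI] this] obtain I0
    where "sq_integrable \<Omega> I0" "ms_tendsto \<Omega> I I0 sequentially" by blast
  with integral_of_limit[OF vI v] show ?thesis by blast
qed

end

section \<open>Canonical factorization\<close>

lemma fourier_L2_limit:
  assumes "fourier_L2 c \<sigma> g"
  shows "g \<in> borel_measurable borel" and "sq_integrable freq g"
    and "ms_tendsto freq (\<lambda>U x. \<Sum>u<U. c u * cis (of_int (\<sigma> * int u) * x)) g sequentially"
proof -
  define q where "q U x = (\<Sum>u<U. c u * cis (of_int (\<sigma> * int u) * x))" for U x
  show g [measurable]: "g \<in> borel_measurable borel" using assms by (simp add: fourier_L2_def)
  have q_sq: "sq_integrable freq (q U)" for U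
    unfolding q_def by (intro sq_integrable_sum sq_integrable_cmult sq_integrable_cis_freq)
  have q_borel [measurable]: "q U \<in> borel_measurable borel" for U
    using q_sq[of U] by (simp add: sq_integrable_def)
  have "(\<lambda>U. \<integral>\<^sup>+x\<in>{-pi..<pi}. ennreal ((cmod (g x - q U x))\<^sup>2) \<partial>lborel) \<longlonglongrightarrow> 0"
    using assms by (simp add: fourier_L2_def q_def)
  then have "(\<lambda>U. ennreal (1 / (2 * pi)) * (\<integral>\<^sup>+x\<in>{-pi..<pi}. ennreal ((cmod (g x - q U x))\<^sup>2) \<partial>lborel))
      \<longlonglongrightarrow> ennreal (1 / (2 * pi)) * 0"
    by (intro ennreal_tendsto_cmult) auto
  moreover have "ennreal (1 / (2 * pi)) * (\<integral>\<^sup>+x\<in>{-pi..<pi}. ennreal ((cmod (g x - q U x))\<^sup>2) \<partial>lborel) =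
      (\<integral>\<^sup>+x. ennreal ((cmod (g x - q U x))\<^sup>2) \<partial>freq)" for U
    by (rule nn_integral_freq[symmetric]) measurable
  ultimately have lim: "(\<lambda>U. \<integral>\<^sup>+x. ennreal ((cmod (g x - q U x))\<^sup>2) \<partial>freq) \<longlonglongrightarrow> 0" by simp
  \<comment> \<open>\<open>g\<close> is so far only measurable. A single finite distance to a
    trigonometric polynomial makes it square integrable.\<close>
  then have "\<forall>\<^sub>F U in sequentially. (\<integral>\<^sup>+x. ennreal ((cmod (g x - q U x))\<^sup>2) \<partial>freq) < \<infinity>"
    by (rule order_tendstoD(2)) simp
  then obtain U where U: "(\<integral>\<^sup>+x. ennreal ((cmod (g x - q U x))\<^sup>2) \<partial>freq) < \<infinity>"
    by (auto simp: eventually_sequentially)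
  have "sq_integrable freq (\<lambda>x. g x - q U x)"
    by (rule sq_integrableI_nn[OF _ U]) simp
  from sq_integrable_add[OF this q_sq[of U]] show sq: "sq_integrable freq g" by simp
  have "ms_tendsto freq q g sequentially"
    using lim unfolding nn_integral_cmod_sq[OF sq_integrable_diff[OF sq q_sq]]
    by (subst (asm) ennreal_0[symmetric], subst (asm) tendsto_ennreal_iff) auto
  then show "ms_tendsto freq (\<lambda>U x. \<Sum>u<U. c u * cis (of_int (\<sigma> * int u) * x)) g sequentially"
    by (simp add: q_def)
qed

text \<open>The coefficient of the partial sums at \<open>l\<close> is constant for
  \<open>U > |l|\<close>, and the inner product is continuous. The sign \<open>\<sigma>\<close> is
  \<open>-1\<close> for \<open>P\<close> and \<open>1\<close> for \<open>S\<close>.\<close>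

lemma fourier_L2_coeff:
  assumes c: "fourier_L2 c \<sigma> g" and \<sigma>: "\<sigma> = 1 \<or> \<sigma> = -1"
  shows "ms_inner freq g (\<lambda>x. cis (of_int l * x)) = (if 0 \<le> \<sigma> * l then c (nat (\<sigma> * l)) else 0)"
proof -
  define q where "q U x = (\<Sum>u<U. c u * cis (of_int (\<sigma> * int u) * x))" for U x
  have q_sq: "sq_integrable freq (q U)" for U
    unfolding q_def by (intro sq_integrable_sum sq_integrable_cmult sq_integrable_cis_freq)
  have inner: "ms_inner freq (q U) (\<lambda>x. cis (of_int l * x)) = (\<Sum>u<U. if \<sigma> * int u = l then c u else 0)" for U
  proof -
    have "ms_inner freq (q U) (\<lambda>x. cis (of_int l * x)) =
        (\<Sum>u<U. c u * ms_inner freq (\<lambda>x. cis (of_int (\<sigma> * int u) * x)) (\<lambda>x. cis (of_int l * x)))"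
      unfolding q_def
      by (subst ms_inner_sum_left) (auto intro: sq_integrable_cmult sq_integrable_cis_freq simp: ms_inner_cmult_left)
    then show ?thesis unfolding cis_freq_orthonormal by (simp add: if_distrib cong: if_cong)
  qed
  have "(\<lambda>U. ms_inner freq (q U) (\<lambda>x. cis (of_int l * x))) \<longlonglongrightarrow> ms_inner freq g (\<lambda>x. cis (of_int l * x))"
    using fourier_L2_limit[OF c] q_sq unfolding q_def by (intro ms_tendsto_inner sq_integrable_cis_freq) auto
  moreover have "(\<lambda>U. ms_inner freq (q U) (\<lambda>x. cis (of_int l * x))) \<longlonglongrightarrow> (if 0 \<le> \<sigma> * l then c (nat (\<sigma> * l)) else 0)"
  proof (rule tendsto_eventually)
    have "(\<Sum>u<U. if \<sigma> * int u = l then c u else 0) = (if 0 \<le> \<sigma> * l then c (nat (\<sigma> * l)) else 0)"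
      if "nat \<bar>l\<bar> < U" for U
    proof -
      have "(\<Sum>u<U. if \<sigma> * int u = l then c u else 0) =
          (\<Sum>u<U. if u = nat (\<sigma> * l) then (if 0 \<le> \<sigma> * l then c u else 0) else 0)"
        by (rule sum.cong) (use \<sigma> in auto)
      then show ?thesis using that \<sigma> by auto
    qed
    then show "\<forall>\<^sub>F U in sequentially. ms_inner freq (q U) (\<lambda>x. cis (of_int l * x)) = (if 0 \<le> \<sigma> * l then c (nat (\<sigma> * l)) else 0)"
      unfolding inner eventually_sequentially by (intro exI[of _ "Suc (nat \<bar>l\<bar>)"]) auto
  qed
  ultimately show ?thesis by (rule LIMSEQ_unique)
qed

lemma fourier_L2_norm2:
  assumes c: "fourier_L2 c \<sigma> g" and \<sigma>: "\<sigma> = 1 \<or> \<sigma> = -1"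
  shows "(\<lambda>u. (cmod (c u))\<^sup>2) sums ms_norm2 freq g"
proof -
  define e where "e u = (\<lambda>x. cis (of_int (\<sigma> * int u) * x))" for u
  have "ms_norm2 freq (\<lambda>x. \<Sum>u<U. c u * e u x) = (\<Sum>u<U. (cmod (c u))\<^sup>2)" for U
  proof (rule orthonormal_combination_norm2)
    show "ms_inner freq (e i) (e j) = (if i = j then 1 else 0)" for i j
      unfolding e_def cis_freq_orthonormal using \<sigma> by auto
  qed (auto simp: e_def intro: sq_integrable_cis_freq)
  moreover have "(\<lambda>U. ms_norm2 freq (\<lambda>x. \<Sum>u<U. c u * e u x)) \<longlonglongrightarrow> ms_norm2 freq g"
    using fourier_L2_limit[OF c] unfolding e_def
    by (intro ms_tendsto_norm2 sq_integrable_sum sq_integrable_cmult sq_integrable_cis_freq) auto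
  ultimately show ?thesis by (simp add: sums_def)
qed

lemma inner_trig_unit:
  assumes g: "sq_integrable (channels N) g" and m: "m < N"
  shows "ms_inner (channels N) g (trig_unit u m) = ms_inner freq (\<lambda>x. g (m, x)) (\<lambda>x. cis (of_int u * x))"
proof -
  have "ms_inner (channels N) g (trig_unit u m) =
      (\<Sum>n<N. ms_inner freq (\<lambda>x. g (n, x)) (\<lambda>x. trig_unit u m (n, x)))"
    by (rule ms_inner_channels[OF g sq_integrable_trig_unit])
  also have "\<dots> = (\<Sum>n<N. if n = m then ms_inner freq (\<lambda>x. g (n, x)) (\<lambda>x. cis (of_int u * x)) else 0)"
    by (rule sum.cong) (auto simp: trig_unit_def)
  finally show ?thesis using m by simp
qed

lemma trig_unit_orthonormal:
  assumes "m < N" "n < N"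
  shows "ms_inner (channels N) (trig_unit u m) (trig_unit v n) = (if m = n \<and> u = v then 1 else 0)"
  unfolding inner_trig_unit[OF sq_integrable_trig_unit assms(2)]
  by (cases "n = m") (simp_all add: trig_unit_def cis_freq_orthonormal)

definition trig_units :: "nat \<Rightarrow> int set \<Rightarrow> (nat \<times> real \<Rightarrow> complex) set" where
  "trig_units N L = {trig_unit l m |l m. l \<in> L \<and> m < N}"

lemma trig_units_sq: "X \<in> trig_units N L \<Longrightarrow> sq_integrable (channels N) X"
  by (auto simp: trig_units_def sq_integrable_trig_unit)

text \<open>There are finitely many channels, so mean square convergence of the Fourier series in
  each of them is convergence in the sum.\<close>

lemma closed_span_trig_unitsI:
  assumes lim: "\<And>m. m < N \<Longrightarrow> ms_tendsto freq (\<lambda>U x. \<Sum>u<U. c u m * cis (of_int (e u) * x)) (\<lambda>x. v (m, x)) sequentially"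
    and v: "\<And>m. m < N \<Longrightarrow> sq_integrable freq (\<lambda>x. v (m, x))"
    and e: "\<And>u. e u \<in> L"
  shows "v \<in> closed_span (channels N) (trig_units N L)"
proof (rule closed_span_limit[where F=sequentially and G="trig_units N L"])
  define X where "X U = (\<lambda>p. \<Sum>m<N. \<Sum>u<U. c u m * trig_unit (e u) m p)" for U :: nat
  show "X U \<in> closed_span (channels N) (trig_units N L)" for U
    unfolding X_def using e
    by (intro closed_span_sum closed_span_cmult closed_span_base sq_integrable_trig_unit trig_units_sq)
       (auto simp: trig_units_def)
  show sqv: "sq_integrable (channels N) v" by (rule sq_integrable_channels[OF v])
  have sqX: "sq_integrable (channels N) (X U)" for U
    unfolding X_def by (intro sq_integrable_sum sq_integrable_cmult sq_integrable_trig_unit)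
  have "ms_norm2 (channels N) (\<lambda>p. v p - X U p) =
      (\<Sum>m<N. ms_norm2 freq (\<lambda>x. v (m, x) - (\<Sum>u<U. c u m * cis (of_int (e u) * x))))" for U
  proof -
    have "X U (m, x) = (\<Sum>u<U. c u m * cis (of_int (e u) * x))" if "m < N" for m x
    proof -
      have "X U (m, x) = (\<Sum>n<N. if n = m then (\<Sum>u<U. c u n * cis (of_int (e u) * x)) else 0)"
        unfolding X_def by (rule sum.cong) (auto simp: trig_unit_def)
      then show ?thesis using that by simp
    qed
    then show ?thesis
      by (simp add: ms_norm2_channels[OF sq_integrable_diff[OF sqv sqX]])
  qed
  moreover have "(\<lambda>U. \<Sum>m<N. ms_norm2 freq (\<lambda>x. v (m, x) - (\<Sum>u<U. c u m * cis (of_int (e u) * x)))) \<longlonglongrightarrow> (\<Sum>m<N. 0)"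
    by (intro tendsto_sum lim) simp
  ultimately show "ms_tendsto (channels N) X v sequentially" by simp
qed (auto intro: trig_units_sq)

text \<open>
  If \<open>v\<close> is split into \<open>s\<close> and a rest that is orthogonal to the nonnegative frequencies, then the
  distance of \<open>v\<close> to a trigonometric polynomial is at least the distance of the rest to its
  negative part.
\<close>
lemma closed_span_trig_units_split:
  assumes v: "v \<in> closed_span (channels N) (trig_units N UNIV)"
    and s: "s \<in> closed_span (channels N) (trig_units N {0..})"
    and orth: "\<And>l m. 0 \<le> l \<Longrightarrow> m < N \<Longrightarrow> ms_inner (channels N) (\<lambda>p. v p - s p) (trig_unit l m) = 0"
  shows "(\<lambda>p. v p - s p) \<in> closed_span (channels N) (trig_units N {..<0})"
proof (rule closed_span_closed[where G="trig_units N {..<0}"])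
  note sq = closed_span_sq[OF v] closed_span_sq[OF s]
  show sqd: "sq_integrable (channels N) (\<lambda>p. v p - s p)" by (rule sq_integrable_diff[OF sq])
  fix e :: real assume "e > 0"
  from closed_span_approx[OF v this] obtain F c where F: "finite F" "F \<subseteq> trig_units N UNIV"
    "ms_norm2 (channels N) (\<lambda>p. v p - (\<Sum>X\<in>F. c X * X p)) < e" .
  define F0 where "F0 = F \<inter> trig_units N {..<0}"
  define F1 where "F1 = F - F0"
  have F0: "finite F0" "F0 \<subseteq> trig_units N {..<0}" using F by (auto simp: F0_def)
  have F1: "finite F1" "F1 \<subseteq> trig_units N {0..}"
  proof -
    show "finite F1" using F by (simp add: F1_def)
    show "F1 \<subseteq> trig_units N {0..}"
    proof
      fix X assume X: "X \<in> F1"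
      then have "X \<in> trig_units N UNIV" using F(2) by (auto simp: F1_def)
      then obtain l m where lm: "X = trig_unit l m" "m < N" unfolding trig_units_def by blast
      have "\<not> l < 0" using X lm F(2) unfolding F1_def F0_def trig_units_def by auto
      then show "X \<in> trig_units N {0..}" unfolding trig_units_def using lm
        by (intro CollectI exI[of _ l] exI[of _ m]) simp
    qed
  qed
  define X0 where "X0 = (\<lambda>p. \<Sum>X\<in>F0. c X * X p)"
  define X1 where "X1 = (\<lambda>p. \<Sum>X\<in>F1. c X * X p)"
  have split: "(\<Sum>X\<in>F. c X * X p) = X0 p + X1 p" for p
    unfolding X0_def X1_def F1_def using F(1) by (subst sum.subset_diff[of F0 F]) (auto simp: F0_def)
  have X0: "X0 \<in> closed_span (channels N) (trig_units N {..<0})"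
    unfolding X0_def using F0
    by (intro closed_span_sum closed_span_cmult closed_span_base trig_units_sq) auto
  have X1: "X1 \<in> closed_span (channels N) (trig_units N {0..})"
    unfolding X1_def using F1
    by (intro closed_span_sum closed_span_cmult closed_span_base trig_units_sq) auto
  \<comment> \<open>\<open>E + D\<close> is the difference of \<open>v\<close> and the approximating
    polynomial. \<open>E\<close> has nonnegative frequencies only and \<open>D\<close> is orthogonal
    to all of these, so by Pythagoras \<open>D\<close> is no longer than the difference.\<close>
  define D where "D = (\<lambda>p. v p - s p - X0 p)"
  define E where "E = (\<lambda>p. s p - X1 p)"
  have sqD: "sq_integrable (channels N) D" unfolding D_def by (rule sq_integrable_diff[OF sqd closed_span_sq[OF X0]])
  have E: "E \<in> closed_span (channels N) (trig_units N {0..})"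
  proof -
    have "(\<lambda>p. s p + (-1) * X1 p) \<in> closed_span (channels N) (trig_units N {0..})"
      by (rule closed_span_add[OF trig_units_sq s closed_span_cmult[OF X1]])
    then show ?thesis by (simp add: E_def)
  qed
  have "ms_inner (channels N) E D = 0"
  proof (rule closed_span_orthogonal[OF trig_units_sq sqD _ E])
    fix X assume "X \<in> trig_units N {0..}"
    then obtain l m where lm: "X = trig_unit l m" "0 \<le> l" "m < N" by (auto simp: trig_units_def)
    have "ms_inner (channels N) X0 X = 0"
    proof (rule closed_span_orthogonal[OF trig_units_sq _ _ X0])
      show "sq_integrable (channels N) X" by (simp add: lm sq_integrable_trig_unit)
      show "ms_inner (channels N) Y X = 0" if "Y \<in> trig_units N {..<0}" for Y
        using that lm by (auto simp: trig_units_def trig_unit_orthonormal)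
    qed
    then have "ms_inner (channels N) D X = 0"
      unfolding D_def lm using orth[OF lm(2,3)]
      by (simp add: ms_inner_diff_left[OF sqd closed_span_sq[OF X0] sq_integrable_trig_unit])
    then show "ms_inner (channels N) X D = 0" using ms_inner_cnj[of "channels N" X D] by simp
  qed
  then have "ms_norm2 (channels N) (\<lambda>p. E p + D p) = ms_norm2 (channels N) E + ms_norm2 (channels N) D"
    using ms_norm2_add_expand[OF closed_span_sq[OF E] sqD] by simp
  moreover have "(\<lambda>p. E p + D p) = (\<lambda>p. v p - (\<Sum>X\<in>F. c X * X p))"
    by (simp add: E_def D_def split fun_eq_iff)
  ultimately have "ms_norm2 (channels N) E + ms_norm2 (channels N) D < e"
    using F(3) by simp
  then have "ms_norm2 (channels N) D < e"
    using ms_norm2_nonneg[of "channels N" E] by linarith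
  then show "\<exists>X\<in>closed_span (channels N) (trig_units N {..<0}). ms_norm2 (channels N) (\<lambda>p. v p - s p - X p) < e"
    using X0 by (intro bexI[of _ X0]) (simp_all add: D_def)
qed (rule trig_units_sq)

text \<open>The two sides that are compared: random variables \<open>z\<close> and
  \<open>\<epsilon>\<close>, and their counterparts \<open>harmonic\<close> and
  \<open>trig_unit\<close> in the space of vector functions.\<close>

locale canonical_model = stochastic_integration f P Q N \<Omega> Z
  for f P Q N and \<Omega> :: "'w measure" and Z +
  fixes z \<epsilon> :: "nat \<Rightarrow> int \<Rightarrow> 'w \<Rightarrow> complex" and d :: "nat \<Rightarrow> nat \<Rightarrow> nat \<Rightarrow> complex"
  assumes z_sq: "sq_integrable \<Omega> (z k j)"
    and z_cov: "ms_inner \<Omega> (z k l) (z n j) =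
      complex_of_real (1 / (2 * pi)) * (LINT x:{-pi..<pi}|lborel. cis (of_int (l - j) * x) * f x k n)"
    and z_int: "integral_of (col P (\<lambda>x. cis (of_int j * x)) k) (z k j)"
    and \<epsilon>_sq: "m < N \<Longrightarrow> sq_integrable \<Omega> (\<epsilon> m u)"
    and \<epsilon>_orthonormal: "m < N \<Longrightarrow> n < N \<Longrightarrow> ms_inner \<Omega> (\<epsilon> m u) (\<epsilon> n v) = (if m = n \<and> u = v then 1 else 0)"
    and \<epsilon>_z: "m < N \<Longrightarrow> ms_inner \<Omega> (z k j) (\<epsilon> m u) = (if u \<le> j then d (nat (j - u)) k m else 0)"
    and P_fourier: "m < N \<Longrightarrow> fourier_L2 (\<lambda>u. d u k m) (- 1) (\<lambda>x. P x k m)"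
    and canonical: "closed_span \<Omega> {\<epsilon> m u |m u. m < N \<and> u \<le> - 1} = closed_span \<Omega> {z k j |k j. j \<le> - 1}"
begin

text \<open>The counterpart of \<open>z k j\<close>: the image of the vector function with the
  single component \<open>cis (j x)\<close> at \<open>k\<close>.\<close>

definition "harmonic j k = col P (\<lambda>x. cis (of_int j * x)) k"

abbreviation "past \<equiv> {harmonic j k |j k. j < 0}"

lemma harmonic_sq: "sq_integrable (channels N) (harmonic j k)"
  unfolding harmonic_def by (rule col_sq[where C=1]) auto

lemma harmonic_gram: "ms_inner \<Omega> (z k l) (z n j) = ms_inner (channels N) (harmonic l k) (harmonic j n)"
proof -
  have "cis (of_int l * x) * cnj (cis (of_int j * x)) = cis (of_int (l - j) * x)" for x
    by (simp add: cis_cnj cis_mult algebra_simps)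
  then show ?thesis
    unfolding z_cov harmonic_def by (subst col_inner[where C=1 and D=1]) auto
qed

lemma z_norm2: "ms_norm2 \<Omega> (z k j) = (\<Sum>m<N. ms_norm2 freq (\<lambda>x. P x k m))"
proof -
  have "ms_norm2 \<Omega> (z k j) = ms_norm2 (channels N) (harmonic j k)"
    unfolding harmonic_def by (rule integral_of_norm2[OF z_int])
  also have "\<dots> = (\<Sum>m<N. ms_norm2 freq (\<lambda>x. P x k m))"
    unfolding ms_norm2_channels[OF harmonic_sq]
    by (simp add: harmonic_def col_def ms_norm2_def norm_mult)
  finally show ?thesis .
qed

text \<open>These are the numbers of \<open>\<epsilon>_z\<close>. Together with
  \<open>harmonic_gram\<close> and the two orthonormality statements, all Gram matrices of the two
  sides agree.\<close>

lemma harmonic_trig_unit: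
  assumes "m < N"
  shows "ms_inner (channels N) (harmonic j k) (trig_unit u m) = (if u \<le> j then d (nat (j - u)) k m else 0)"
proof -
  have eq: "cis (of_int j * x) * P x k m * cnj (cis (of_int u * x)) = P x k m * cnj (cis (of_int (u - j) * x))" for x
    by (simp add: cis_cnj cis_mult[symmetric] algebra_simps) (simp add: cis_mult algebra_simps)
  have "ms_inner (channels N) (harmonic j k) (trig_unit u m) = ms_inner freq (\<lambda>x. P x k m) (\<lambda>x. cis (of_int (u - j) * x))"
    unfolding inner_trig_unit[OF harmonic_sq assms] by (simp only: ms_inner_def harmonic_def col_def prod.case eq)
  also have "\<dots> = (if u \<le> j then d (nat (j - u)) k m else 0)"
    by (subst fourier_L2_coeff[OF P_fourier[OF assms]]) auto
  finally show ?thesis .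
qed

text \<open>Multiplication by \<open>cis (j x)\<close> shifts the one-sided Fourier series of the
  columns of \<open>P\<close> to the frequencies \<open>j\<close>, \<open>j - 1\<close> and so
  on.\<close>

lemma harmonic_span: "harmonic j k \<in> closed_span (channels N) (trig_units N {..j})"
proof (rule closed_span_trig_unitsI[where c="\<lambda>u m. d u k m" and e="\<lambda>u. j - int u"])
  fix m assume m: "m < N"
  have "ms_norm2 freq (\<lambda>x. harmonic j k (m, x) - (\<Sum>u<U. d u k m * cis (of_int (j - int u) * x))) =
      ms_norm2 freq (\<lambda>x. P x k m - (\<Sum>u<U. d u k m * cis (of_int (- 1 * int u) * x)))" for U
  proof -
    have "harmonic j k (m, x) - (\<Sum>u<U. d u k m * cis (of_int (j - int u) * x)) =
        cis (of_int j * x) * (P x k m - (\<Sum>u<U. d u k m * cis (of_int (- 1 * int u) * x)))" for x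
      by (simp add: harmonic_def col_def right_diff_distrib sum_distrib_left mult.left_commute cis_mult algebra_simps)
    then show ?thesis by (simp add: ms_norm2_def norm_mult)
  qed
  then show "ms_tendsto freq (\<lambda>U x. \<Sum>u<U. d u k m * cis (of_int (j - int u) * x)) (\<lambda>x. harmonic j k (m, x)) sequentially"
    using fourier_L2_limit(3)[OF P_fourier[OF m, of k]] by simp
  show "sq_integrable freq (\<lambda>x. harmonic j k (m, x))"
    using sq_integrable_bounded_mult[OF P_sq[OF m, of k], of "\<lambda>x. cis (of_int j * x)" 1]
    by (simp add: harmonic_def col_def)
qed auto

text \<open>Here canonicity enters. The innovation \<open>\<epsilon> m u\<close> is approximated by
  combinations of past observations, and since the Gram matrices agree, the same coefficients
  approximate \<open>trig_unit u m\<close> by harmonics with the same error.\<close>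

lemma trig_unit_past:
  assumes m: "m < N" and u: "u < 0"
  shows "trig_unit u m \<in> closed_span (channels N) past"
proof (rule closed_span_closed[where G=past])
  show "sq_integrable (channels N) X" if "X \<in> past" for X using that by (auto intro: harmonic_sq)
  show "sq_integrable (channels N) (trig_unit u m)" by (rule sq_integrable_trig_unit)
  fix e :: real assume "e > 0"
  have "\<epsilon> m u \<in> closed_span \<Omega> {\<epsilon> m u |m u. m < N \<and> u \<le> - 1}"
    using m u by (intro closed_span_base \<epsilon>_sq CollectI exI[of _ m] exI[of _ u]) auto
  then have "\<epsilon> m u \<in> closed_span \<Omega> {z k j |k j. j \<le> - 1}" unfolding canonical .
  from closed_span_approx[OF this \<open>e > 0\<close>] obtain F c where F: "finite F" "F \<subseteq> {z k j |k j. j \<le> - 1}"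
    "ms_norm2 \<Omega> (\<lambda>w. \<epsilon> m u w - (\<Sum>X\<in>F. c X * X w)) < e" .
  have "\<exists>k j. X = z k j \<and> j \<le> - 1" if "X \<in> F" for X using that F(2) by blast
  \<comment> \<open>\<open>F\<close> is a set of random variables; each one needs a choice of
    indices before its counterpart can be named.\<close>
  then obtain ki ji where idx: "\<And>X. X \<in> F \<Longrightarrow> X = z (ki X) (ji X)" "\<And>X. X \<in> F \<Longrightarrow> ji X \<le> - 1"
    by metis
  \<comment> \<open>\<open>None\<close> stands for the innovation and \<open>Some X\<close> for an
    observation. This keeps the two apart even if \<open>\<epsilon> m u\<close> is itself an element
    of \<open>F\<close>.\<close>
  define I where "I = insert None (Some ` F)"
  define g where "g = case_option (\<epsilon> m u) (\<lambda>X. X)"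
  define g' where "g' = case_option (trig_unit u m) (\<lambda>X. harmonic (ji X) (ki X))"
  define b where "b = case_option 1 (\<lambda>X. - c X)"
  have zX: "ms_inner \<Omega> X (\<epsilon> m u) = ms_inner (channels N) (harmonic (ji X) (ki X)) (trig_unit u m)" if "X \<in> F" for X
    by (subst idx(1)[OF that]) (simp add: \<epsilon>_z[OF m] harmonic_trig_unit[OF m])
  have "ms_norm2 \<Omega> (\<lambda>w. \<Sum>i\<in>I. b i * g i w) = ms_norm2 (channels N) (\<lambda>p. \<Sum>i\<in>I. b i * g' i p)"
  proof (rule ms_norm2_gram)
    fix i assume i: "i \<in> I"
    have "sq_integrable \<Omega> X" if "X \<in> F" for X by (subst idx(1)[OF that]) (rule z_sq)
    then show "sq_integrable \<Omega> (g i)" using i by (auto simp: I_def g_def \<epsilon>_sq[OF m])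
    show "sq_integrable (channels N) (g' i)" by (auto simp: g'_def harmonic_sq sq_integrable_trig_unit split: option.split)
    fix j assume j: "j \<in> I"
    have XY: "ms_inner \<Omega> X Y = ms_inner (channels N) (harmonic (ji X) (ki X)) (harmonic (ji Y) (ki Y))"
      if "X \<in> F" "Y \<in> F" for X Y
      by (subst idx(1)[OF that(1)], subst idx(1)[OF that(2)]) (rule harmonic_gram)
    have eX: "ms_inner \<Omega> (\<epsilon> m u) X = ms_inner (channels N) (trig_unit u m) (harmonic (ji X) (ki X))" if "X \<in> F" for X
      using zX[OF that] ms_inner_cnj[of \<Omega> "\<epsilon> m u" X] ms_inner_cnj[of "channels N" "trig_unit u m" "harmonic (ji X) (ki X)"] by simp
    show "ms_inner \<Omega> (g i) (g j) = ms_inner (channels N) (g' i) (g' j)"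
      using i j by (auto simp: I_def g_def g'_def zX eX XY \<epsilon>_orthonormal[OF m m] trig_unit_orthonormal[OF m m])
  qed
  moreover have "(\<lambda>w. \<Sum>i\<in>I. b i * g i w) = (\<lambda>w. \<epsilon> m u w - (\<Sum>X\<in>F. c X * X w))"
    using F(1) by (simp add: I_def b_def g_def sum.reindex sum_negf fun_eq_iff)
  moreover have "(\<lambda>p. \<Sum>i\<in>I. b i * g' i p) = (\<lambda>p. trig_unit u m p - (\<Sum>X\<in>F. c X * harmonic (ji X) (ki X) p))"
    using F(1) by (simp add: I_def b_def g'_def sum.reindex sum_negf fun_eq_iff)
  ultimately have "ms_norm2 (channels N) (\<lambda>p. trig_unit u m p - (\<Sum>X\<in>F. c X * harmonic (ji X) (ki X) p)) < e"
    using F(3) by simp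
  moreover have "(\<lambda>p. \<Sum>X\<in>F. c X * harmonic (ji X) (ki X) p) \<in> closed_span (channels N) past"
  proof (rule closed_span_sum)
    show "sq_integrable (channels N) X" if "X \<in> past" for X using that by (auto intro: harmonic_sq)
    show "(\<lambda>p. c X * harmonic (ji X) (ki X) p) \<in> closed_span (channels N) past" if "X \<in> F" for X
    proof (rule closed_span_cmult, rule closed_span_base[OF _ harmonic_sq])
      have "ji X < 0" using idx(2)[OF that] by simp
      then show "harmonic (ji X) (ki X) \<in> past" by blast
    qed
  qed
  ultimately show "\<exists>X\<in>closed_span (channels N) past. ms_norm2 (channels N) (\<lambda>p. trig_unit u m p - X p) < e"
    by (rule bexI)
qed

lemma negative_frequencies_past:
  "closed_span (channels N) (trig_units N {..<0}) \<subseteq> closed_span (channels N) past"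
proof (rule closed_span_subset)
  show "sq_integrable (channels N) X" if "X \<in> past" for X using that by (auto intro: harmonic_sq)
  show "X \<in> closed_span (channels N) past" if "X \<in> trig_units N {..<0}" for X
  proof -
    from that obtain l m where "X = trig_unit l m" "l < 0" "m < N" unfolding trig_units_def by auto
    then show ?thesis using trig_unit_past[of m l] by simp
  qed
qed

lemma trig_vec_harmonic:
  assumes "finite F"
  shows "through P (trig_vec F c) = (\<lambda>p. \<Sum>(j, n)\<in>F. c (j, n) * harmonic j n p)"
    and "sq_integrable (channels N) (through P (trig_vec F c))"
    and "integral_of (through P (trig_vec F c)) (\<lambda>w. \<Sum>(j, n)\<in>F. c (j, n) * z n j w)"
proof -
  show eq: "through P (trig_vec F c) = (\<lambda>p. \<Sum>(j, n)\<in>F. c (j, n) * harmonic j n p)"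
    unfolding harmonic_def by (rule trig_vec_through(3)[OF assms])
  show "sq_integrable (channels N) (through P (trig_vec F c))"
    unfolding eq split_beta by (intro sq_integrable_sum sq_integrable_cmult harmonic_sq)
  show "integral_of (through P (trig_vec F c)) (\<lambda>w. \<Sum>(j, n)\<in>F. c (j, n) * z n j w)"
    unfolding eq split_beta harmonic_def by (intro integral_of_sum integral_of_cmult z_int)
qed

text \<open>The isometry turns approximation of \<open>h\<close> by \<open>trig_vec\<close> with
  negative frequencies into approximation of its image by past harmonics.\<close>

lemma L2f_minus_iff: "h \<in> L2f_minus f \<longleftrightarrow> h \<in> L2f f \<and> through P h \<in> closed_span (channels N) past"
proof -
  have past_sq: "sq_integrable (channels N) X" if "X \<in> past" for X using that by (auto intro: harmonic_sq)
  have norm: "L2f_norm2 f (\<lambda>x k. h x k - trig_vec F c x k) =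
      ennreal (2 * pi * ms_norm2 (channels N) (\<lambda>p. through P h p - through P (trig_vec F c) p))"
    if "h \<in> L2f f" "finite F" for F c
    by (rule L2f_norm2_diff[OF L2fD[OF that(1)] trig_vec_through(1,2)[OF that(2)] trig_vec_harmonic(2)[OF that(2)]])
  show ?thesis
  proof safe
    assume h: "h \<in> L2f_minus f"
    then show hL: "h \<in> L2f f" by (simp add: L2f_minus_def)
    show "through P h \<in> closed_span (channels N) past"
    proof (rule closed_span_closed[where G=past])
      fix e :: real assume e: "e > 0"
      then have "ennreal (2 * pi * e) > 0" by simp
      with h obtain F c where F: "finite F" "F \<subseteq> {..<0} \<times> UNIV"
        "L2f_norm2 f (\<lambda>x k. h x k - trig_vec F c x k) < ennreal (2 * pi * e)"
        unfolding L2f_minus_def by blast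
      have "ms_norm2 (channels N) (\<lambda>p. through P h p - through P (trig_vec F c) p) < e"
        using F(3) unfolding norm[OF hL F(1)] by (simp add: ennreal_less_iff)
      moreover have "through P (trig_vec F c) \<in> closed_span (channels N) past"
        unfolding trig_vec_harmonic(1)[OF F(1)] split_beta
      proof (rule closed_span_sum[OF past_sq])
        show "(\<lambda>p. c (fst q, snd q) * harmonic (fst q) (snd q) p) \<in> closed_span (channels N) past" if "q \<in> F" for q
        proof (rule closed_span_cmult, rule closed_span_base[OF _ harmonic_sq])
          have "fst q < 0" using that F(2) by auto
          then show "harmonic (fst q) (snd q) \<in> past" by blast
        qed
      qed
      ultimately show "\<exists>X\<in>closed_span (channels N) past. ms_norm2 (channels N) (\<lambda>p. through P h p - X p) < e"
        by (rule bexI)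
    qed (use past_sq L2fD(3)[OF hL] in auto)
  next
    assume hL: "h \<in> L2f f" and h: "through P h \<in> closed_span (channels N) past"
    show "h \<in> L2f_minus f"
      unfolding L2f_minus_def
    proof (intro CollectI conjI hL allI impI)
      fix e :: ennreal assume e: "e > 0"
      \<comment> \<open>The tolerance in \<open>L2f_minus\<close> is an extended real and may be
        infinite; a finite positive one below it is needed.\<close>
      obtain r where r: "0 < r" "ennreal (2 * pi * r) \<le> e"
      proof (cases e)
        case (real s)
        then show thesis using e that[of "s / (2 * pi)"] by simp
      next
        case top
        then show thesis using that[of 1] by simp
      qed
      from closed_span_approx[OF h r(1)] obtain F c where F: "finite F" "F \<subseteq> past"
        "ms_norm2 (channels N) (\<lambda>p. through P h p - (\<Sum>X\<in>F. c X * X p)) < r" .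
      \<comment> \<open>A closed span is indexed by functions and \<open>trig_vec\<close> by pairs
        of time and coordinate. The chosen index determines the function, so the choice is injective
        and the sums can be reindexed.\<close>
      have "\<exists>q. X = harmonic (fst q) (snd q) \<and> fst q < 0" if "X \<in> F" for X
        using that F(2) by fastforce
      then obtain idx where idx: "\<And>X. X \<in> F \<Longrightarrow> X = harmonic (fst (idx X)) (snd (idx X))" "\<And>X. X \<in> F \<Longrightarrow> fst (idx X) < 0"
        by metis
      have inj: "inj_on idx F" by (rule inj_onI) (metis idx(1))
      let ?c = "\<lambda>q. c (harmonic (fst q) (snd q))"
      have "through P (trig_vec (idx ` F) ?c) = (\<lambda>p. \<Sum>X\<in>F. c X * X p)"
        unfolding trig_vec_harmonic(1)[OF finite_imageI[OF F(1)]] sum.reindex[OF inj]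
        by (intro ext sum.cong refl) (simp add: split_beta idx(1)[symmetric])
      then have "L2f_norm2 f (\<lambda>x k. h x k - trig_vec (idx ` F) ?c x k) < ennreal (2 * pi * r)"
        unfolding norm[OF hL finite_imageI[OF F(1)]] using F(3) r(1) by (simp add: ennreal_less_iff)
      then have "L2f_norm2 f (\<lambda>x k. h x k - trig_vec (idx ` F) ?c x k) < e" using r(2) by (rule less_le_trans)
      moreover have "idx ` F \<subseteq> {..<0} \<times> UNIV"
        using idx(2) by (intro image_subsetI) (simp add: mem_Times_iff)
      ultimately show "\<exists>F c. finite F \<and> F \<subseteq> {..<0} \<times> UNIV \<and> L2f_norm2 f (\<lambda>x k. h x k - trig_vec F c x k) < e"
        using F(1) by (intro exI[of _ "idx ` F"] exI[of _ ?c]) simp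
    qed
  qed
qed

end

section \<open>Prediction\<close>

text \<open>The functional is given by its inner products with all \<open>W\<close>, the form in
  which \<open>functional_pairing\<close> provides it. Mean square convergence of its expansion is
  derived in \<open>X_integral\<close>.\<close>

locale prediction = canonical_model f P Q N \<Omega> Z z \<epsilon> d
  for f P Q N and \<Omega> :: "'w measure" and Z z \<epsilon> d +
  fixes a :: "nat \<Rightarrow> nat \<Rightarrow> complex" and S :: "real \<Rightarrow> nat \<Rightarrow> complex" and X :: "'w \<Rightarrow> complex"
  assumes a_l2: "in_l2 (a j)" and a_sum: "summable (\<lambda>j. l2_norm (a j))"
    and P_trace: "m < N \<Longrightarrow> summable (\<lambda>k. ms_norm2 freq (\<lambda>x. P x k m))"
    and S_fourier: "m < N \<Longrightarrow> fourier_L2 (\<lambda>l. \<Sum>u. \<Sum>k. a (l + u) k * d u k m) 1 (\<lambda>x. S x m)"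
    and Q_borel: "m < N \<Longrightarrow> (\<lambda>x. Q x m k) \<in> borel_measurable borel"
    and X_sq: "sq_integrable \<Omega> X"
    and X_inner: "sq_integrable \<Omega> W \<Longrightarrow> (\<lambda>j. \<Sum>k. a j k * ms_inner \<Omega> (z k (int j)) W) sums ms_inner \<Omega> X W"
begin

definition co :: "nat \<Rightarrow> nat \<Rightarrow> complex" where
  "co l m = (\<Sum>u. \<Sum>k. a (l + u) k * d u k m)"

definition A :: "real \<Rightarrow> nat \<Rightarrow> complex" where
  "A x k = (\<Sum>j. a j k * cis (of_nat j * x))"

definition h :: "real \<Rightarrow> nat \<Rightarrow> complex" where
  "h x k = A x k - (\<Sum>m<N. S x m * Q x m k)"

text \<open>Square partial sums of \<open>A^T P\<close>. Being finite combinations of harmonics,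
  they are images of random variables.\<close>

definition part :: "nat \<Rightarrow> nat \<times> real \<Rightarrow> complex" where
  "part n p = (\<Sum>j<n. \<Sum>k<n. a j k * harmonic (int j) k p)"

definition S_vec :: "nat \<times> real \<Rightarrow> complex" where
  "S_vec = (\<lambda>(m, x). S x m)"

text \<open>Squared norm of column \<open>m\<close> at the frequency \<open>x\<close>;
  \<open>a_norm\<close> times its root is the common majorant of the square partial sums.\<close>

definition R :: "nat \<Rightarrow> real \<Rightarrow> real" where
  "R m x = (\<Sum>k. (cmod (P x k m))\<^sup>2)"

definition a_norm :: real where
  "a_norm = (\<Sum>j. l2_norm (a j))"

text \<open>The share of channel \<open>m\<close> in the trace of the covariance operator.\<close>

definition trace :: "nat \<Rightarrow> real" where
  "trace m = (\<Sum>k. ms_norm2 freq (\<lambda>x. P x k m))"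

lemma A_borel: "(\<lambda>x. A x k) \<in> borel_measurable borel"
  unfolding A_def by measurable

lemma S_sq: "m < N \<Longrightarrow> sq_integrable freq (\<lambda>x. S x m)"
  by (rule fourier_L2_limit(2)[OF S_fourier])

lemma S_vec_sq: "sq_integrable (channels N) S_vec"
  by (rule sq_integrable_channels) (simp add: S_vec_def S_sq)

lemma h_borel: "(\<lambda>x. h x k) \<in> borel_measurable borel"
  unfolding h_def
  by (intro borel_measurable_diff A_borel borel_measurable_sum borel_measurable_times Q_borel
      fourier_L2_limit(1)[OF S_fourier]) simp_all

lemma trace_nonneg: "m < N \<Longrightarrow> 0 \<le> trace m"
  unfolding trace_def by (rule suminf_nonneg[OF P_trace]) simp_all

lemma P_summable:
  assumes m: "m < N"
  shows "AE x in freq. summable (\<lambda>k. (cmod (P x k m))\<^sup>2)" and "integrable freq (R m)"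
proof -
  have [measurable]: "(\<lambda>x. P x k m) \<in> borel_measurable borel" for k by (rule P_borel[OF m])
  have "(\<integral>\<^sup>+x. (\<Sum>k. ennreal ((cmod (P x k m))\<^sup>2)) \<partial>freq) = (\<Sum>k. ennreal (ms_norm2 freq (\<lambda>x. P x k m)))"
    by (subst nn_integral_suminf) (simp_all add: nn_integral_cmod_sq[OF P_sq[OF m]])
  also have "\<dots> < \<infinity>"
    by (subst suminf_ennreal2) (simp_all add: P_trace[OF m])
  finally have "AE x in freq. (\<Sum>k. ennreal ((cmod (P x k m))\<^sup>2)) \<noteq> \<infinity>"
    by (intro nn_integral_noteq_infinite) auto
  then show AE: "AE x in freq. summable (\<lambda>k. (cmod (P x k m))\<^sup>2)"
    by eventually_elim (auto intro: summable_suminf_not_top)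
  show "integrable freq (R m)"
    unfolding R_def[abs_def]
  proof (rule integrable_suminf)
    show "integrable freq (\<lambda>x. (cmod (P x k m))\<^sup>2)" for k
      using P_sq[OF m, of k] by (simp add: sq_integrable_def)
    show "AE x in freq. summable (\<lambda>k. norm ((cmod (P x k m))\<^sup>2))" using AE by simp
    show "summable (\<lambda>k. LINT x|freq. norm ((cmod (P x k m))\<^sup>2))"
      using P_trace[OF m] by (simp add: ms_norm2_def)
  qed
qed

lemma part_sq: "sq_integrable (channels N) (part n)"
  unfolding part_def[abs_def] by (intro sq_integrable_sum sq_integrable_cmult harmonic_sq)

text \<open>Almost every column of \<open>P x\<close> is square summable, so
  \<open>l2_double_series\<close> applies to \<open>p j k = cis (j x) * P x k m\<close>: the sum by
  columns is \<open>A^T P\<close>, the sums over squares are \<open>part\<close>, and the bound is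
  the majorant.\<close>

lemma A_series:
  assumes m: "m < N"
  shows "AE x in freq. summable (\<lambda>k. A x k * P x k m) \<and>
    (\<lambda>n. part n (m, x)) \<longlonglongrightarrow> through P A (m, x) \<and> (\<forall>n. cmod (part n (m, x)) \<le> a_norm * sqrt (R m x))"
  using P_summable(1)[OF m]
proof eventually_elim
  case (elim x)
  define p where "p j k = cis (of_nat j * x) * P x k m" for j k :: nat
  have R0: "0 \<le> R m x" unfolding R_def by (rule suminf_nonneg[OF elim]) simp
  have "(\<Sum>k<K. (cmod (p j k))\<^sup>2) \<le> (sqrt (R m x))\<^sup>2" for j K
    using sum_le_suminf[OF elim, of "{..<K}"] R0 by (simp add: p_def norm_mult R_def)
  note ds = l2_double_series[where a=a and p=p, OF a_l2 a_sum this real_sqrt_ge_zero[OF R0]]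
  have part: "part n (m, x) = (\<Sum>j<n. \<Sum>k<n. a j k * p j k)" for n
    by (simp add: part_def harmonic_def col_def p_def)
  have col: "(\<Sum>j. a j k * p j k) = A x k * P x k m" for k
  proof -
    have norm_a: "cmod (a j k) \<le> l2_norm (a j)" for j
      unfolding l2_norm_def using a_l2[of j] sum_le_suminf[of "\<lambda>k. (cmod (a j k))\<^sup>2" "{k}"]
      by (intro real_le_rsqrt) (simp add: in_l2_def)
    have "summable (\<lambda>j. a j k * cis (of_nat j * x))"
      by (rule summable_comparison_test'[OF a_sum, of 0]) (simp add: norm_mult norm_a)
    from suminf_mult2[OF this, of "P x k m"] show ?thesis by (simp add: A_def p_def mult.assoc)
  qed
  have "through P A (m, x) = (\<Sum>j. \<Sum>k. a j k * p j k)"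
    using ds(2) unfolding col by (simp add: through_def sums_iff)
  then show ?case
    using ds(2,3,4) unfolding col part a_norm_def by (simp add: sums_iff)
qed

lemma A_adm: "adm A"
proof -
  have "AE x in freq. \<forall>m\<in>{..<N}. summable (\<lambda>k. A x k * P x k m)"
    using A_series by (intro AE_finite_allI) (auto elim: eventually_mono)
  then show ?thesis by eventually_elim simp
qed

lemma R_nonneg: "m < N \<Longrightarrow> AE x in freq. 0 \<le> R m x"
  using P_summable(1)[of m] by (auto elim!: eventually_mono simp: R_def intro: suminf_nonneg)

lemma through_A_bound:
  assumes m: "m < N"
  shows "AE x in freq. cmod (through P A (m, x)) \<le> a_norm * sqrt (R m x)"
  using A_series[OF m]
proof eventually_elim
  case (elim x)
  then have "(\<lambda>n. cmod (part n (m, x))) \<longlonglongrightarrow> cmod (through P A (m, x))" by (intro tendsto_norm) simp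
  then show ?case by (rule LIMSEQ_le_const2) (use elim in blast)
qed

lemma through_A_sq: "m < N \<Longrightarrow> sq_integrable freq (\<lambda>x. through P A (m, x))"
  unfolding sq_integrable_def
proof (intro conjI)
  assume m: "m < N"
  have [measurable]: "(\<lambda>x. through P A (m, x)) \<in> borel_measurable borel" by (rule through_borel(2)[OF A_borel m])
  show "(\<lambda>x. through P A (m, x)) \<in> borel_measurable freq" by simp
  show "integrable freq (\<lambda>x. (cmod (through P A (m, x)))\<^sup>2)"
  proof (rule Bochner_Integration.integrable_bound)
    show "integrable freq (\<lambda>x. a_norm\<^sup>2 * R m x)" using P_summable(2)[OF m] by simp
    show "AE x in freq. norm ((cmod (through P A (m, x)))\<^sup>2) \<le> norm (a_norm\<^sup>2 * R m x)"
      using through_A_bound[OF m] R_nonneg[OF m]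
    proof eventually_elim
      case (elim x)
      have "(cmod (through P A (m, x)))\<^sup>2 \<le> (a_norm * sqrt (R m x))\<^sup>2" by (rule power_mono[OF elim(1)]) simp
      then show ?case using elim(2) by (simp add: power_mult_distrib)
    qed
  qed simp
qed

lemma through_A_channels: "sq_integrable (channels N) (through P A)"
  by (rule sq_integrable_channels[OF through_A_sq])

text \<open>Dominated convergence in each channel. Limit and partial sum are both bounded by
  \<open>a_norm * sqrt (R m x)\<close>, which explains the 4 in the majorant of the squared
  difference.\<close>

lemma part_tendsto: "ms_tendsto (channels N) part (through P A) sequentially"
proof -
  have "(\<lambda>n. ms_norm2 freq (\<lambda>x. through P A (m, x) - part n (m, x))) \<longlonglongrightarrow> (LINT x|freq. 0)" if m: "m < N" for m
    unfolding ms_norm2_def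
  proof (rule integral_dominated_convergence)
    have [measurable]: "(\<lambda>x. through P A (m, x)) \<in> borel_measurable borel" by (rule through_borel(2)[OF A_borel m])
    have [measurable]: "(\<lambda>x. P x k m) \<in> borel_measurable borel" for k by (rule P_borel[OF m])
    show "(\<lambda>x. (cmod (through P A (m, x) - part n (m, x)))\<^sup>2) \<in> borel_measurable freq" for n
      unfolding part_def[abs_def] harmonic_def col_def by simp
    show "integrable freq (\<lambda>x. 4 * a_norm\<^sup>2 * R m x)" using P_summable(2)[OF m] by simp
    show "AE x in freq. (\<lambda>n. (cmod (through P A (m, x) - part n (m, x)))\<^sup>2) \<longlonglongrightarrow> 0"
      using A_series[OF m]
    proof eventually_elim
      case (elim x)
      then have "(\<lambda>n. part n (m, x)) \<longlonglongrightarrow> through P A (m, x)" by simp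
      from tendsto_power[OF tendsto_norm[OF tendsto_diff[OF tendsto_const[of "through P A (m, x)"] this]], of 2]
      show ?case by simp
    qed
    show "AE x in freq. norm ((cmod (through P A (m, x) - part n (m, x)))\<^sup>2) \<le> 4 * a_norm\<^sup>2 * R m x" for n
      using A_series[OF m] through_A_bound[OF m] R_nonneg[OF m]
    proof eventually_elim
      case (elim x)
      from elim(1) have "cmod (part n (m, x)) \<le> a_norm * sqrt (R m x)" by blast
      with norm_triangle_ineq4[of "through P A (m, x)" "part n (m, x)"] elim(2)
      have "cmod (through P A (m, x) - part n (m, x)) \<le> 2 * (a_norm * sqrt (R m x))" by simp
      then have "(cmod (through P A (m, x) - part n (m, x)))\<^sup>2 \<le> (2 * (a_norm * sqrt (R m x)))\<^sup>2"
        by (rule power_mono) simp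
      then show ?case using elim(3) by (simp add: power_mult_distrib)
    qed
  qed simp
  then have "(\<lambda>n. \<Sum>m<N. ms_norm2 freq (\<lambda>x. through P A (m, x) - part n (m, x))) \<longlonglongrightarrow> (\<Sum>m<N. 0)"
    by (intro tendsto_sum) simp
  then show ?thesis
    by (simp add: ms_norm2_channels[OF sq_integrable_diff[OF through_A_channels part_sq]])
qed

text \<open>The random variables that correspond to \<open>part n\<close> converge in mean square to
  some \<open>L\<close> with integrand \<open>A^T P\<close>, by completeness. Testing with every
  \<open>W\<close> identifies \<open>L\<close> with the functional.\<close>

lemma X_integral: "integral_of (through P A) X"
proof -
  define Y where "Y n = (\<lambda>w. \<Sum>j<n. \<Sum>k<n. a j k * z k (int j) w)" for n
  have int: "integral_of (part n) (Y n)" for n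
    unfolding part_def[abs_def] Y_def harmonic_def by (intro integral_of_sum integral_of_cmult z_int)
  from integral_of_complete[OF int through_A_channels part_tendsto] obtain L
    where L: "integral_of (through P A) L" "sq_integrable \<Omega> L" "ms_tendsto \<Omega> Y L sequentially" by blast
  have "ms_inner \<Omega> X W = ms_inner \<Omega> L W" if W: "sq_integrable \<Omega> W" for W
  proof -
    define p where "p j k = ms_inner \<Omega> (z k (int j)) W" for j k
    \<comment> \<open>Cauchy--Schwarz bounds the squared product of \<open>z k j\<close> and
      \<open>W\<close> by the variance of \<open>z k j\<close> times the squared norm of
      \<open>W\<close>; the variances sum to the trace over all channels.\<close>
    define C where "C = sqrt ((\<Sum>m<N. trace m) * ms_norm2 \<Omega> W)"
    have tr: "0 \<le> (\<Sum>m<N. trace m)" by (intro sum_nonneg trace_nonneg) simp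
    have p_le: "(\<Sum>k<K. (cmod (p j k))\<^sup>2) \<le> C\<^sup>2" for j K
    proof -
      have "(\<Sum>k<K. (cmod (p j k))\<^sup>2) \<le> (\<Sum>k<K. (\<Sum>m<N. ms_norm2 freq (\<lambda>x. P x k m)) * ms_norm2 \<Omega> W)"
        unfolding p_def z_norm2[symmetric, of _ "int j"] by (intro sum_mono ms_Cauchy_Schwarz z_sq W)
      also have "\<dots> = (\<Sum>m<N. \<Sum>k<K. ms_norm2 freq (\<lambda>x. P x k m)) * ms_norm2 \<Omega> W"
        unfolding sum_distrib_right[symmetric] by (subst sum.swap) simp
      also have "\<dots> \<le> (\<Sum>m<N. trace m) * ms_norm2 \<Omega> W"
        unfolding trace_def by (intro mult_right_mono sum_mono sum_le_suminf P_trace) auto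
      finally show ?thesis using tr by (simp add: C_def)
    qed
    have C0: "0 \<le> C" using tr by (simp add: C_def)
    have "(\<lambda>n. \<Sum>j<n. \<Sum>k<n. a j k * p j k) \<longlonglongrightarrow> (\<Sum>j. \<Sum>k. a j k * p j k)"
      by (rule l2_double_series(3)[where a=a and p=p, OF a_l2 a_sum p_le C0])
    also have "(\<Sum>j. \<Sum>k. a j k * p j k) = ms_inner \<Omega> X W"
      using X_inner[OF W] by (simp add: p_def sums_iff)
    finally have "(\<lambda>n. \<Sum>j<n. \<Sum>k<n. a j k * p j k) \<longlonglongrightarrow> ms_inner \<Omega> X W" .
    moreover have "ms_inner \<Omega> (Y n) W = (\<Sum>j<n. \<Sum>k<n. a j k * p j k)" for n
      unfolding Y_def p_def
      by (simp add: ms_inner_sum_left W z_sq sq_integrable_sum sq_integrable_cmult ms_inner_cmult_left)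
    moreover have "(\<lambda>n. ms_inner \<Omega> (Y n) W) \<longlonglongrightarrow> ms_inner \<Omega> L W"
      by (rule ms_tendsto_inner[OF L(3) integral_of_sq(2)[OF int] L(2) W])
    ultimately show ?thesis by (simp add: LIMSEQ_unique)
  qed
  \<comment> \<open>The test element is the difference \<open>X - L\<close> itself.\<close>
  from this[OF sq_integrable_diff[OF X_sq L(2)]]
  have "ms_inner \<Omega> (\<lambda>w. X w - L w) (\<lambda>w. X w - L w) = 0"
    by (simp add: ms_inner_diff_left[OF X_sq L(2) sq_integrable_diff[OF X_sq L(2)]])
  then have "ms_norm2 \<Omega> (\<lambda>w. X w - L w) = 0" by (simp add: ms_inner_self)
  then show ?thesis
    by (intro integral_of_limit[where v="\<lambda>_. through P A" and I="\<lambda>_. L", OF L(1) through_A_channels _ X_sq])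
       simp_all
qed

text \<open>A harmonic of index \<open>j\<close> has no frequency above \<open>j\<close>, so only
  the rows with \<open>j >= l\<close> contribute; the substitution \<open>j = u + l\<close> gives
  \<open>co\<close>.\<close>

lemma A_coeff:
  assumes m: "m < N"
  shows "ms_inner (channels N) (through P A) (trig_unit (int l) m) = co l m"
proof -
  define p where "p j k = ms_inner (channels N) (harmonic (int j) k) (trig_unit (int l) m)" for j k
  have p: "p j k = (if l \<le> j then d (j - l) k m else 0)" for j k
    unfolding p_def harmonic_trig_unit[OF m] by (auto simp: nat_diff_distrib)
  have "(\<Sum>k<K. (cmod (p j k))\<^sup>2) \<le> (sqrt (trace m))\<^sup>2" for j K
  proof -
    have "(cmod (p j k))\<^sup>2 \<le> ms_norm2 freq (\<lambda>x. P x k m)" for k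
    proof (cases "l \<le> j")
      case True
      have s: "(\<lambda>u. (cmod (d u k m))\<^sup>2) sums ms_norm2 freq (\<lambda>x. P x k m)"
        by (rule fourier_L2_norm2[OF P_fourier[OF m]]) simp
      have "(\<Sum>u\<in>{j - l}. (cmod (d u k m))\<^sup>2) \<le> (\<Sum>u. (cmod (d u k m))\<^sup>2)"
        by (rule sum_le_suminf) (use s in \<open>auto simp: sums_iff\<close>)
      then show ?thesis using True s by (simp add: p sums_iff)
    qed (simp add: p)
    then have "(\<Sum>k<K. (cmod (p j k))\<^sup>2) \<le> (\<Sum>k<K. ms_norm2 freq (\<lambda>x. P x k m))" by (rule sum_mono)
    also have "\<dots> \<le> trace m" unfolding trace_def by (rule sum_le_suminf[OF P_trace[OF m]]) auto
    finally show ?thesis using trace_nonneg[OF m] by simp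
  qed
  note ds = l2_double_series[where a=a and p=p, OF a_l2 a_sum this real_sqrt_ge_zero[OF trace_nonneg[OF m]]]
  have "ms_inner (channels N) (part n) (trig_unit (int l) m) = (\<Sum>j<n. \<Sum>k<n. a j k * p j k)" for n
    unfolding part_def[abs_def] p_def
    by (simp add: ms_inner_sum_left harmonic_sq sq_integrable_trig_unit sq_integrable_sum sq_integrable_cmult ms_inner_cmult_left)
  then have "(\<lambda>n. \<Sum>j<n. \<Sum>k<n. a j k * p j k) \<longlonglongrightarrow> ms_inner (channels N) (through P A) (trig_unit (int l) m)"
    using ms_tendsto_inner[OF part_tendsto part_sq through_A_channels sq_integrable_trig_unit, of "int l" m] by simp
  then have "ms_inner (channels N) (through P A) (trig_unit (int l) m) = (\<Sum>j. \<Sum>k. a j k * p j k)"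
    using ds(3) by (rule LIMSEQ_unique)
  also have "\<dots> = (\<Sum>u. \<Sum>k. a (u + l) k * p (u + l) k)"
    using suminf_split_initial_segment[OF ds(1), of l] by (simp add: p)
  also have "\<dots> = co l m" by (simp add: p co_def add.commute)
  finally show ?thesis .
qed

lemma S_coeff:
  assumes m: "m < N"
  shows "ms_inner (channels N) S_vec (trig_unit (int l) m) = co l m"
  unfolding inner_trig_unit[OF S_vec_sq m]
  using fourier_L2_coeff[OF S_fourier[OF m], of "int l"] by (simp add: S_vec_def co_def)

lemma S_span: "S_vec \<in> closed_span (channels N) (trig_units N {0..})"
proof (rule closed_span_trig_unitsI[where c="\<lambda>l m. co l m" and e=int])
  show "ms_tendsto freq (\<lambda>U x. \<Sum>u<U. co u m * cis (of_int (int u) * x)) (\<lambda>x. S_vec (m, x)) sequentially" if "m < N" for m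
    using fourier_L2_limit(3)[OF S_fourier[OF that]] by (simp add: S_vec_def co_def)
qed (auto simp: S_vec_def S_sq)

text \<open>\<open>A^T P\<close> and \<open>S\<close> have the same coefficients at all nonnegative
  frequencies. Hence the difference has only negative ones, and these belong to the past by
  canonicity.\<close>

lemma remainder_past: "(\<lambda>p. through P A p - S_vec p) \<in> closed_span (channels N) past"
proof -
  have "harmonic j k \<in> closed_span (channels N) (trig_units N UNIV)" for j k
  proof -
    have "trig_units N {..j} \<subseteq> trig_units N UNIV" unfolding trig_units_def by blast
    from subsetD[OF closed_span_mono[OF this] harmonic_span] show ?thesis .
  qed
  then have part_span: "part n \<in> closed_span (channels N) (trig_units N UNIV)" for n
    unfolding part_def[abs_def] by (intro closed_span_sum closed_span_cmult) (auto intro: trig_units_sq)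
  have "through P A \<in> closed_span (channels N) (trig_units N UNIV)"
    by (rule closed_span_limit[where G="trig_units N UNIV", OF _ part_span through_A_channels part_tendsto])
       (simp_all add: trig_units_sq)
  moreover have "ms_inner (channels N) (\<lambda>p. through P A p - S_vec p) (trig_unit l m) = 0" if "0 \<le> l" "m < N" for l m
    using A_coeff[OF that(2), of "nat l"] S_coeff[OF that(2), of "nat l"] that(1)
    by (simp add: ms_inner_diff_left[OF through_A_channels S_vec_sq sq_integrable_trig_unit])
  ultimately have "(\<lambda>p. through P A p - S_vec p) \<in> closed_span (channels N) (trig_units N {..<0})"
    using S_span by (intro closed_span_trig_units_split)
  then show ?thesis using negative_frequencies_past by blast
qed

text \<open>\<open>Q P = I\<close> turns \<open>S Q P\<close> back into \<open>S\<close>; the sum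
  over the channels is finite, so it may be taken outside the series in \<open>k\<close>.\<close>

lemma h_sums:
  "AE x in freq. \<forall>m<N. (\<lambda>k. h x k * P x k m) sums (through P A (m, x) - S x m)"
  using A_adm left_inverse
proof eventually_elim
  case (elim x)
  show ?case
  proof (intro allI impI)
    fix n assume n: "n < N"
    have "(\<lambda>k. \<Sum>m<N. S x m * (Q x m k * P x k n)) sums (\<Sum>m<N. S x m * (if m = n then 1 else 0))"
      using elim n by (intro sums_sum sums_mult) simp
    also have "(\<Sum>m<N. S x m * (if m = n then 1 else 0)) = S x n"
      using n by (simp add: if_distrib cong: if_cong)
    finally have "(\<lambda>k. \<Sum>m<N. S x m * (Q x m k * P x k n)) sums S x n" .
    moreover have "(\<lambda>k. A x k * P x k n) sums through P A (n, x)"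
      unfolding through_def using elim(1) n by (simp add: summable_sums)
    ultimately have "(\<lambda>k. A x k * P x k n - (\<Sum>m<N. S x m * (Q x m k * P x k n))) sums (through P A (n, x) - S x n)"
      by (intro sums_diff)
    moreover have "A x k * P x k n - (\<Sum>m<N. S x m * (Q x m k * P x k n)) = h x k * P x k n" for k
      by (simp add: h_def left_diff_distrib sum_distrib_right mult.assoc)
    ultimately show "(\<lambda>k. h x k * P x k n) sums (through P A (n, x) - S x n)" by simp
  qed
qed

lemma h_adm: "adm h"
  using h_sums by eventually_elim (auto simp: sums_iff)

lemma through_h_AE: "AE p in channels N. through P A p - S_vec p = through P h p"
proof (rule AE_channels)
  show "(\<lambda>p. through P A p - S_vec p) \<in> borel_measurable (channels N)"
    using sq_integrable_diff[OF through_A_channels S_vec_sq] by (simp add: sq_integrable_def)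
  show "through P h \<in> borel_measurable (channels N)" by (rule through_borel(1)[OF h_borel])
  fix m assume m: "m < N"
  show "AE x in freq. through P A (m, x) - S_vec (m, x) = through P h (m, x)"
    using h_sums by eventually_elim (use m in \<open>auto simp: through_def S_vec_def sums_iff\<close>)
qed

lemma through_h_sq: "sq_integrable (channels N) (through P h)"
  by (rule sq_integrable_cong_AE[OF sq_integrable_diff[OF through_A_channels S_vec_sq] through_borel(1)[OF h_borel] through_h_AE])

lemma h_L2f_minus: "h \<in> L2f_minus f"
  unfolding L2f_minus_iff
proof
  show "h \<in> L2f f" by (rule L2fI[OF h_borel h_adm through_h_sq])
  show "through P h \<in> closed_span (channels N) past"
  proof (rule closed_span_closed[where G=past])
    show "sq_integrable (channels N) X" if "X \<in> past" for X using that by (auto intro: harmonic_sq)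
    fix e :: real assume "e > 0"
    \<comment> \<open>Closed spans consist of functions, so almost everywhere equality with a member
      is used as an approximation at distance zero.\<close>
    have "ms_norm2 (channels N) (\<lambda>p. through P h p - (through P A p - S_vec p)) = ms_norm2 (channels N) (\<lambda>p. 0)"
      using through_h_AE sq_integrable_diff[OF through_h_sq sq_integrable_diff[OF through_A_channels S_vec_sq]]
      by (intro ms_norm2_cong_AE) (auto elim: eventually_mono simp: sq_integrable_def)
    then show "\<exists>X\<in>closed_span (channels N) past. ms_norm2 (channels N) (\<lambda>p. through P h p - X p) < e"
      using remainder_past \<open>e > 0\<close> by (intro bexI[of _ "\<lambda>p. through P A p - S_vec p"]) simp_all
  qed (rule through_h_sq)
qed

text \<open>A past harmonic has frequencies at most \<open>j < 0\<close>, and \<open>S\<close> is a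
  limit of polynomials with nonnegative frequencies.\<close>

lemma S_orthogonal_past:
  assumes "Y \<in> closed_span (channels N) past"
  shows "ms_inner (channels N) Y S_vec = 0"
proof (rule closed_span_orthogonal[OF _ S_vec_sq _ assms])
  show "sq_integrable (channels N) X" if "X \<in> past" for X using that by (auto intro: harmonic_sq)
  fix G assume "G \<in> past"
  then obtain j k where G: "G = harmonic j k" "j < 0" by blast
  have "ms_inner (channels N) S_vec G = 0"
  proof (rule closed_span_orthogonal[OF trig_units_sq _ _ S_span])
    show "sq_integrable (channels N) G" by (simp add: G harmonic_sq)
    show "ms_inner (channels N) T G = 0" if "T \<in> trig_units N {0..}" for T
    proof -
      from that obtain l m where T: "T = trig_unit l m" "0 \<le> l" "m < N" by (auto simp: trig_units_def)
      show ?thesis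
        using harmonic_trig_unit[OF T(3), of j k l] T G ms_inner_cnj[of "channels N" T G] by simp
    qed
  qed
  then show "ms_inner (channels N) G S_vec = 0" using ms_inner_cnj[of "channels N" G S_vec] by simp
qed

text \<open>Pythagoras: the error is the sum of \<open>S\<close> and the image of
  \<open>h - g\<close>, and the latter lies in the past, to which \<open>S\<close> is
  orthogonal.\<close>

lemma error_norm2:
  assumes g: "g \<in> L2f_minus f"
  shows "ms_norm2 (channels N) (\<lambda>p. through P A p - through P g p) =
    ms_norm2 (channels N) S_vec + ms_norm2 (channels N) (\<lambda>p. through P h p - through P g p)"
proof -
  have gL: "g \<in> L2f f" and gs: "through P g \<in> closed_span (channels N) past" using g L2f_minus_iff by auto
  have hs: "through P h \<in> closed_span (channels N) past" using h_L2f_minus L2f_minus_iff by auto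
  note g_sq = L2fD(3)[OF gL]
  have sqd: "sq_integrable (channels N) (\<lambda>p. through P h p - through P g p)"
    by (rule sq_integrable_diff[OF through_h_sq g_sq])
  have "(\<lambda>p. through P h p + (-1) * through P g p) \<in> closed_span (channels N) past"
    by (rule closed_span_add[OF _ hs closed_span_cmult[OF gs]]) (auto intro: harmonic_sq)
  then have orth: "ms_inner (channels N) (\<lambda>p. through P h p - through P g p) S_vec = 0"
    using S_orthogonal_past by simp
  have "ms_norm2 (channels N) (\<lambda>p. through P A p - through P g p) =
      ms_norm2 (channels N) (\<lambda>p. (through P h p - through P g p) + S_vec p)"
    using through_h_AE sq_integrable_diff[OF through_A_channels g_sq] sq_integrable_add[OF sqd S_vec_sq]
    by (intro ms_norm2_cong_AE) (auto elim!: eventually_mono simp: sq_integrable_def algebra_simps)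
  also have "\<dots> = ms_norm2 (channels N) S_vec + ms_norm2 (channels N) (\<lambda>p. through P h p - through P g p)"
    by (simp add: ms_norm2_add_expand[OF sqd S_vec_sq] orth)
  finally show ?thesis .
qed

lemma mse_eq:
  assumes g: "g \<in> L2f_minus f"
  shows "mse f A g = ennreal (ms_norm2 (channels N) S_vec + ms_norm2 (channels N) (\<lambda>p. through P h p - through P g p))"
proof -
  have gL: "g \<in> L2f f" using g L2f_minus_iff by auto
  show ?thesis
    unfolding mse_def L2f_norm2_diff[OF A_borel A_adm through_A_channels L2fD[OF gL]] error_norm2[OF g]
    by (simp add: ennreal_mult[symmetric])
qed

lemma S_norm2: "(\<lambda>l. \<Sum>m<N. (cmod (co l m))\<^sup>2) sums ms_norm2 (channels N) S_vec"
proof -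
  have "(\<lambda>l. \<Sum>m<N. (cmod (co l m))\<^sup>2) sums (\<Sum>m<N. ms_norm2 freq (\<lambda>x. S x m))"
    unfolding co_def by (intro sums_sum fourier_L2_norm2[OF S_fourier]) auto
  then show ?thesis unfolding ms_norm2_channels[OF S_vec_sq] by (simp add: S_vec_def)
qed

lemma h_spectral_characteristic: "spectral_characteristic f A h"
  unfolding spectral_characteristic_def
  using h_L2f_minus mse_eq by (auto intro!: ennreal_leI)

text \<open>A second minimiser has the same error as \<open>h\<close>, which leaves zero for the
  second summand of \<open>mse_eq\<close>. Equality holds in the sense of
  \<open>L\<^sub>2(f)\<close>.\<close>

lemma spectral_characteristic_unique:
  assumes "spectral_characteristic f A g"
  shows "L2f_norm2 f (\<lambda>x k. g x k - h x k) = 0"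
proof -
  have g: "g \<in> L2f_minus f" and le: "mse f A g \<le> mse f A h"
    using assms h_L2f_minus by (auto simp: spectral_characteristic_def)
  have gL: "g \<in> L2f f" using g L2f_minus_iff by auto
  have "ms_norm2 (channels N) S_vec + ms_norm2 (channels N) (\<lambda>p. through P h p - through P g p)
      \<le> ms_norm2 (channels N) S_vec"
    using le unfolding mse_eq[OF g] mse_eq[OF h_L2f_minus] by (simp add: ennreal_le_iff)
  then have "ms_norm2 (channels N) (\<lambda>p. through P g p - through P h p) = 0"
    using ms_norm2_nonneg[of "channels N" "\<lambda>p. through P h p - through P g p"]
    by (simp add: ms_norm2_minus_commute[of _ "through P g"])
  then show ?thesis
    unfolding L2f_norm2_diff[OF L2fD[OF gL] h_borel h_adm through_h_sq] by simp
qed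

text \<open>\<open>h\<close> is a limit of vector trigonometric polynomials, whose stochastic
  integrals are finite combinations of the \<open>z k j\<close>; \<open>integral_of_complete\<close>
  gives the integral of the limit.\<close>

lemma h_integral_exists: "\<exists>Y. has_stoch_integral \<Omega> f Z h Y"
proof -
  have hL: "h \<in> L2f f" using h_L2f_minus L2f_minus_iff by auto
  have "\<exists>F c. finite F \<and> L2f_norm2 f (\<lambda>x k. h x k - trig_vec F c x k) < ennreal (2 * pi * (1 / real (Suc r)))" for r
  proof -
    have "0 < ennreal (2 * pi * (1 / real (Suc r)))" by simp
    then show ?thesis using h_L2f_minus unfolding L2f_minus_def by blast
  qed
  then obtain F c where F: "\<And>r. finite (F r)"
    "\<And>r. L2f_norm2 f (\<lambda>x k. h x k - trig_vec (F r) (c r) x k) < ennreal (2 * pi * (1 / real (Suc r)))"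
    by metis
  define v where "v r = through P (trig_vec (F r) (c r))" for r
  have "ms_norm2 (channels N) (\<lambda>p. through P h p - v r p) < 1 / real (Suc r)" for r
  proof -
    have "ennreal (2 * pi * ms_norm2 (channels N) (\<lambda>p. through P h p - v r p)) < ennreal (2 * pi * (1 / real (Suc r)))"
      using F(2)[of r] unfolding v_def
        L2f_norm2_diff[OF L2fD[OF hL] trig_vec_through(1,2)[OF F(1)] trig_vec_harmonic(2)[OF F(1)]] .
    then have "2 * pi * ms_norm2 (channels N) (\<lambda>p. through P h p - v r p) < 2 * pi * (1 / real (Suc r))"
      by (subst (asm) ennreal_less_iff) auto
    then show ?thesis by (subst (asm) mult_less_cancel_left_pos) auto
  qed
  then have "ms_tendsto (channels N) v (through P h) sequentially"
    by (intro tendsto_sandwich[OF always_eventually always_eventually tendsto_const LIMSEQ_Suc[OF lim_1_over_n]])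
       (auto intro: less_imp_le)
  from integral_of_complete[OF trig_vec_harmonic(3)[OF F(1)] through_h_sq this[unfolded v_def]]
  show ?thesis using has_stoch_integral_iff[OF hL] by blast
qed

text \<open>The difference of functional and estimate is the stochastic integral of the difference
  of the integrands, so the isometry reduces the claim to \<open>error_norm2\<close>.\<close>

lemma estimate_error:
  assumes g: "g \<in> L2f_minus f" and Y: "has_stoch_integral \<Omega> f Z g Y"
  shows "ms_norm2 \<Omega> (\<lambda>w. X w - Y w) =
    ms_norm2 (channels N) S_vec + ms_norm2 (channels N) (\<lambda>p. through P h p - through P g p)"
proof -
  have gL: "g \<in> L2f f" using g L2f_minus_iff by auto
  show ?thesis
    unfolding error_norm2[OF g, symmetric]
    by (rule integral_of_norm2[OF integral_of_diff[OF X_integral iffD1[OF has_stoch_integral_iff[OF gL] Y]]])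
qed

lemma h_estimate:
  assumes Y: "has_stoch_integral \<Omega> f Z h Y"
  shows "optimal_linear_estimate \<Omega> f Z X Y" and "ms_norm2 \<Omega> (\<lambda>w. X w - Y w) = ms_norm2 (channels N) S_vec"
proof -
  show eq: "ms_norm2 \<Omega> (\<lambda>w. X w - Y w) = ms_norm2 (channels N) S_vec"
    using estimate_error[OF h_L2f_minus Y] by simp
  show "optimal_linear_estimate \<Omega> f Z X Y"
    unfolding optimal_linear_estimate_def linear_estimate_def eq
    using h_L2f_minus Y estimate_error by auto
qed

end

section \<open>From the hypotheses to the finite model\<close>

lemma canonical_moving_average_inner:
  assumes ma: "canonical_moving_average \<Omega> z (enat N) d \<epsilon>" and z: "sq_integrable \<Omega> (z k j)" and m: "m < N"
  shows "ms_inner \<Omega> (z k j) (\<epsilon> m u) = (if u \<le> j then d (nat (j - u)) k m else 0)"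
proof -
  define D where "D = {..j} \<times> {..<N}"
  define g where "g = (\<lambda>(u, m). \<epsilon> m u)"
  define c where "c = (\<lambda>(u, m). d (nat (j - u)) k m)"
  \<comment> \<open>Intersection with \<open>D\<close> makes every \<open>Y F\<close> square
    integrable, as \<open>ms_tendsto_inner\<close> demands for all indices of the net and not only
    eventually; for finite subsets of \<open>D\<close> nothing changes.\<close>
  define Y where "Y F = (\<lambda>w. \<Sum>q\<in>F \<inter> D. c q * g q w)" for F
  let ?F = "finite_subsets_at_top D"
  have \<epsilon>: "sq_integrable \<Omega> (\<epsilon> m u)" if "m < N" for m u
    using ma that by (simp add: canonical_moving_average_def)
  have orth: "ms_inner \<Omega> (\<epsilon> m u) (\<epsilon> n v) = (if m = n \<and> u = v then 1 else 0)" if "m < N" "n < N" for m n u v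
    using ma that by (simp add: canonical_moving_average_def)
  have Y_sq: "sq_integrable \<Omega> (Y F)" for F
    unfolding Y_def by (intro sq_integrable_sum sq_integrable_cmult) (auto simp: g_def D_def \<epsilon>)
  have D_eq: "{..j} \<times> {m. enat m < enat N} = D" by (auto simp: D_def)
  have "((\<lambda>F. ms_norm2 \<Omega> (\<lambda>w. z k j w - (\<Sum>(u, m)\<in>F. d (nat (j - u)) k m * \<epsilon> m u w))) \<longlongrightarrow> 0) ?F"
    unfolding D_eq[symmetric] using ma unfolding canonical_moving_average_def by blast
  then have "((\<lambda>F. ms_norm2 \<Omega> (\<lambda>w. z k j w - Y F w)) \<longlongrightarrow> 0) ?F"
  proof (rule Lim_transform_eventually)
    show "\<forall>\<^sub>F F in ?F. ms_norm2 \<Omega> (\<lambda>w. z k j w - (\<Sum>(u, m)\<in>F. d (nat (j - u)) k m * \<epsilon> m u w)) =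
        ms_norm2 \<Omega> (\<lambda>w. z k j w - Y F w)"
    proof (rule eventually_finite_subsets_at_top_weakI)
      fix F assume "finite F" "F \<subseteq> D"
      then have "F \<inter> D = F" by blast
      then show "ms_norm2 \<Omega> (\<lambda>w. z k j w - (\<Sum>(u, m)\<in>F. d (nat (j - u)) k m * \<epsilon> m u w)) =
        ms_norm2 \<Omega> (\<lambda>w. z k j w - Y F w)"
        by (simp add: Y_def c_def g_def split_beta)
    qed
  qed
  from ms_tendsto_inner[OF this Y_sq z \<epsilon>[OF m]]
  have "((\<lambda>F. ms_inner \<Omega> (Y F) (\<epsilon> m u)) \<longlongrightarrow> ms_inner \<Omega> (z k j) (\<epsilon> m u)) ?F" .
  moreover have "((\<lambda>F. ms_inner \<Omega> (Y F) (\<epsilon> m u)) \<longlongrightarrow> (if u \<le> j then d (nat (j - u)) k m else 0)) ?F"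
  proof (rule tendsto_eventually)
    \<comment> \<open>Once \<open>F\<close> contains \<open>(u, m)\<close>, orthonormality leaves
      exactly that term. The intersection with \<open>D\<close> also covers \<open>u > j\<close>,
      where the pair is not an index and the value is zero from the start.\<close>
    have "\<forall>\<^sub>F F in ?F. finite F \<and> {(u, m)} \<inter> D \<subseteq> F \<and> F \<subseteq> D"
      unfolding eventually_finite_subsets_at_top by (intro exI[of _ "{(u, m)} \<inter> D"]) auto
    then show "\<forall>\<^sub>F F in ?F. ms_inner \<Omega> (Y F) (\<epsilon> m u) = (if u \<le> j then d (nat (j - u)) k m else 0)"
    proof eventually_elim
      case (elim F)
      then have F: "finite F" "F \<inter> D = F" by blast+
      have "ms_inner \<Omega> (Y F) (\<epsilon> m u) = (\<Sum>q\<in>F. c q * ms_inner \<Omega> (g q) (\<epsilon> m u))"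
        unfolding Y_def F(2) using elim
        by (subst ms_inner_sum_left)
           (auto simp: g_def D_def \<epsilon> m ms_inner_cmult_left intro!: sq_integrable_cmult)
      also have "\<dots> = (\<Sum>q\<in>F. if q = (u, m) then c q else 0)"
      proof (rule sum.cong[OF refl])
        fix q assume "q \<in> F"
        then have "snd q < N" using elim by (auto simp: D_def)
        from orth[OF this m, of "fst q" u]
        show "c q * ms_inner \<Omega> (g q) (\<epsilon> m u) = (if q = (u, m) then c q else 0)"
          by (cases q) (auto simp: g_def)
      qed
      also have "\<dots> = (if (u, m) \<in> F then c (u, m) else 0)" using F(1) by simp
      also have "\<dots> = (if u \<le> j then d (nat (j - u)) k m else 0)"
        using elim m by (auto simp: c_def D_def)
      finally show ?case .
    qed
  qed
  ultimately show ?thesis by (rule tendsto_unique[OF finite_subsets_at_top_neq_bot])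
qed

text \<open>At almost every frequency the minimality condition provides a trace class inverse, so
  \<open>finite_factor_of_trace_class_inverse\<close> applies with the columns of \<open>P\<close>
  indexed below \<open>M\<close>.\<close>

lemma finite_multiplicity:
  assumes "spectral_density \<Omega> z f" "minimality f" "canonical_factorization \<Omega> z f M d P"
    and Q: "AE x in lborel. x \<in> {-pi..<pi} \<longrightarrow>
           (\<forall>m n. enat m < M \<longrightarrow> enat n < M \<longrightarrow>
              (\<lambda>k. Q x m k * P x k n) sums (if m = n then 1 else 0))"
  obtains N where "M = enat N"
proof -
  interpret prob_space freq by (rule prob_space_freq)
  have 1: "AE x in freq. pos_trace_class (f x)"
    using assms(1) unfolding spectral_density_def AE_freq by blast
  obtain G where 2: "AE x in freq. pos_trace_class (G x) \<and> mp_inverse (f x) (G x)"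
    using assms(2) unfolding minimality_def AE_freq by blast
  have 3: "AE x in freq. \<forall>k n. ((\<lambda>m. P x k m * cnj (P x n m)) has_sum f x k n) {m. enat m < M}"
    using assms(3) unfolding canonical_factorization_def AE_freq by blast
  have 4: "AE x in freq. \<forall>m n. enat m < M \<longrightarrow> enat n < M \<longrightarrow> (\<lambda>k. Q x m k * P x k n) sums (if m = n then 1 else 0)"
    using Q unfolding AE_freq .
  have "AE x in freq. finite {m. enat m < M}"
    using 1 2 3 4
  proof eventually_elim
    case (elim x)
    show ?case
      by (rule finite_factor_of_trace_class_inverse[where F="f x" and G="G x" and P="P x" and Q="Q x"])
         (use elim in \<open>auto simp: mp_inverse_def\<close>)
  qed
  \<comment> \<open>The statement does not depend on \<open>x\<close>, and a probability measure has
    no empty almost everywhere statements.\<close>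
  then have fin: "finite {m. enat m < M}" by simp
  show thesis
  proof (cases M)
    case (enat N)
    then show thesis by (rule that)
  next
    case infinity
    then show thesis using fin by simp
  qed
qed

theorem theorem3p4:
  fixes \<Omega> :: "'w measure"
    and T :: real
    and \<zeta> :: "real \<Rightarrow> 'w \<Rightarrow> complex"
    and z :: "nat \<Rightarrow> int \<Rightarrow> 'w \<Rightarrow> complex"
    and f :: "real \<Rightarrow> nat \<Rightarrow> nat \<Rightarrow> complex"
    and M :: enat
    and d :: "nat \<Rightarrow> nat \<Rightarrow> nat \<Rightarrow> complex"
    and P Q :: "real \<Rightarrow> nat \<Rightarrow> nat \<Rightarrow> complex"
    and a :: "real \<Rightarrow> complex"
    and A\<zeta> :: "'w \<Rightarrow> complex"
    and S h :: "real \<Rightarrow> nat \<Rightarrow> complex"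
    and Z :: "nat \<Rightarrow> real set \<Rightarrow> 'w \<Rightarrow> complex"
  assumes "prob_space \<Omega>" and "0 < T"
    and "pc_process \<Omega> T \<zeta>"
    and "generated_sequence \<Omega> T \<zeta> z"
    and "spectral_density \<Omega> z f"
    and "minimality f"
    and "canonical_factorization \<Omega> z f M d P"
    and "stochastic_measure \<Omega> z f Z"
    and "set_integrable lborel {0..} a"
    and "has_ms_integral \<Omega> (\<lambda>t w. indicator {0..} t * a t * \<zeta> t w) A\<zeta>"
    and "\<And>j. in_l2 (avec T a j)"
    and "summable (\<lambda>j. l2_norm (avec T a j))"
    and "summable (\<lambda>j. real (j + 1) * (l2_norm (avec T a j))\<^sup>2)"
    and "\<And>m. enat m < M \<Longrightarrow> fourier_L2 (\<lambda>l. Ad T a d l m) 1 (\<lambda>x. S x m)"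
    and "\<And>m k. enat m < M \<Longrightarrow> (\<lambda>x. Q x m k) \<in> borel_measurable lborel"
    and "AE x in lborel. x \<in> {-pi..<pi} \<longrightarrow>
           (\<forall>m n. enat m < M \<longrightarrow> enat n < M \<longrightarrow>
              (\<lambda>k. Q x m k * P x k n) sums (if m = n then 1 else 0))"
    and "\<And>x k. h x k = A_fun T a x k - (\<Sum>\<^sub>\<infinity>m\<in>{m. enat m < M}. S x m * Q x m k)"
  shows "spectral_characteristic f (A_fun T a) h \<and>
         (\<forall>g. spectral_characteristic f (A_fun T a) g \<longrightarrow> L2f_norm2 f (\<lambda>x k. g x k - h x k) = 0) \<and>
         summable (Ad_norm2 T a d M) \<and>
         mse f (A_fun T a) h = ennreal (\<Sum>l. Ad_norm2 T a d M l) \<and>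
         (\<exists>Y. has_stoch_integral \<Omega> f Z h Y) \<and>
         (\<forall>Y. has_stoch_integral \<Omega> f Z h Y \<longrightarrow>
            optimal_linear_estimate \<Omega> f Z A\<zeta> Y \<and>
            ms_norm2 \<Omega> (\<lambda>w. A\<zeta> w - Y w) = (\<Sum>l. Ad_norm2 T a d M l))"
proof -
  note prob = assms(1) and T = assms(2) and pc = assms(3) and gen = assms(4) and dens = assms(5)
    and mini = assms(6) and fac = assms(7) and stoch = assms(8) and a_int = assms(9) and A\<zeta> = assms(10)
    and l2 = assms(11) and a_sum = assms(12) and S = assms(14) and Qb = assms(15) and QP = assms(16) and h = assms(17)
  \<comment> \<open>The locales take a natural number of columns, so the multiplicity is made finite
    before they are entered.\<close>
  obtain N where N: "M = enat N" using finite_multiplicity[OF dens mini fac QP] .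
  have ind: "{m. enat m < M} = {..<N}" by (auto simp: N)
  obtain \<epsilon> where ma: "canonical_moving_average \<Omega> z (enat N) d \<epsilon>"
    using fac unfolding canonical_factorization_def N by blast
  have Pf: "fourier_L2 (\<lambda>u. d u k m) (- 1) (\<lambda>x. P x k m)" if "m < N" for k m
    using fac that unfolding canonical_factorization_def N by simp
  interpret factored_density f P Q N
  proof
    show "(\<lambda>x. f x k n) \<in> borel_measurable borel" for k n
      using dens by (simp add: spectral_density_def)
    show "(\<lambda>x. P x k m) \<in> borel_measurable borel" if "m < N" for k m
      by (rule fourier_L2_limit(1)[OF Pf[OF that]])
    show "sq_integrable freq (\<lambda>x. P x k m)" if "m < N" for k m
      by (rule fourier_L2_limit(2)[OF Pf[OF that]])
    have "AE x in freq. \<forall>k n. ((\<lambda>m. P x k m * cnj (P x n m)) has_sum f x k n) {..<N}"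
      using fac unfolding canonical_factorization_def ind AE_freq by blast
    then show "AE x in freq. \<forall>k n. f x k n = (\<Sum>m<N. P x k m * cnj (P x n m))"
      by eventually_elim (metis finite_lessThan has_sum_finite has_sum_unique)
    show "AE x in freq. \<forall>m n. m < N \<longrightarrow> n < N \<longrightarrow> (\<lambda>k. Q x m k * P x k n) sums (if m = n then 1 else 0)"
      using QP unfolding N AE_freq by simp
  qed
  interpret stochastic_integration f P Q N \<Omega> Z
  proof
    show "sq_integrable \<Omega> (Z k B)" if "B \<in> sets borel" "B \<subseteq> {-pi..<pi}" for B k
      using stoch that unfolding stochastic_measure_def by blast
    show "ms_inner \<Omega> (Z k B) (Z n C) = complex_of_real (1 / (2 * pi)) * (LINT x:B \<inter> C|lborel. f x k n)"
      if "B \<in> sets borel" "C \<in> sets borel" "B \<subseteq> {-pi..<pi}" "C \<subseteq> {-pi..<pi}" for B C k n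
      using stoch that unfolding stochastic_measure_def by blast
  qed
  have z_stoch: "has_stoch_integral \<Omega> f Z (\<lambda>x n. if n = k then cis (of_int j * x) else 0) (z k j)" for k j
    using stoch unfolding stochastic_measure_def by blast
  have z_sq: "sq_integrable \<Omega> (z k j)" for k j
    using z_stoch[of k j] by (simp add: has_stoch_integral_def)
  interpret canonical_model f P Q N \<Omega> Z z \<epsilon> d
  proof
    show "sq_integrable \<Omega> (z k j)" for k j by (rule z_sq)
    show "ms_inner \<Omega> (z k l) (z n j) =
      complex_of_real (1 / (2 * pi)) * (LINT x:{-pi..<pi}|lborel. cis (of_int (l - j) * x) * f x k n)" for k l n j
      using dens unfolding spectral_density_def by blast
    \<comment> \<open>The spectral representation of \<open>z k j\<close>, rewritten through
      \<open>through P\<close>: only the coordinate \<open>k\<close> of the integrand is nonzero, so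
      the series reduces to one term.\<close>
    show "integral_of (col P (\<lambda>x. cis (of_int j * x)) k) (z k j)" for j k
    proof -
      have "(\<Sum>n. (if n = k then cis (of_int j * x) else 0) * P x n m) = cis (of_int j * x) * P x k m" for x m
        using sums_single[of k "\<lambda>n. cis (of_int j * x) * P x n m"]
        by (simp add: sums_iff if_distrib[of "\<lambda>y. y * _"] cong: if_cong)
      then have "through P (\<lambda>x n. if n = k then cis (of_int j * x) else 0) = col P (\<lambda>x. cis (of_int j * x)) k"
        by (simp add: through_def col_def)
      moreover have "(\<lambda>x n. if n = k then cis (of_int j * x) else 0) \<in> L2f f"
        using z_stoch[of k j] by (simp add: has_stoch_integral_def)
      ultimately show ?thesis using z_stoch[of k j] has_stoch_integral_iff by metis
    qed
    show "sq_integrable \<Omega> (\<epsilon> m u)" if "m < N" for m u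
      using ma that by (simp add: canonical_moving_average_def)
    show "ms_inner \<Omega> (\<epsilon> m u) (\<epsilon> n v) = (if m = n \<and> u = v then 1 else 0)" if "m < N" "n < N" for m n u v
      using ma that by (simp add: canonical_moving_average_def)
    show "ms_inner \<Omega> (z k j) (\<epsilon> m u) = (if u \<le> j then d (nat (j - u)) k m else 0)" if "m < N" for m k j u
      by (rule canonical_moving_average_inner[OF ma z_sq that])
    show "fourier_L2 (\<lambda>u. d u k m) (- 1) (\<lambda>x. P x k m)" if "m < N" for m k by (rule Pf[OF that])
    have "closed_span \<Omega> {z k j |k j. j \<le> - 1} = closed_span \<Omega> {\<epsilon> m u |m u. enat m < enat N \<and> u \<le> - 1}"
      using ma unfolding canonical_moving_average_def by blast
    then show "closed_span \<Omega> {\<epsilon> m u |m u. m < N \<and> u \<le> - 1} = closed_span \<Omega> {z k j |k j. j \<le> - 1}"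
      by simp
  qed
  interpret pr: prediction f P Q N \<Omega> Z z \<epsilon> d "avec T a" S A\<zeta>
  proof
    show "in_l2 (avec T a j)" for j by (rule l2)
    show "summable (\<lambda>j. l2_norm (avec T a j))" by (rule a_sum)
    \<comment> \<open>The variance of \<open>z k 0\<close> is the sum of these norms over all
      channels, and the variances are summable by the moving average representation.\<close>
    show "summable (\<lambda>k. ms_norm2 freq (\<lambda>x. P x k m))" if "m < N" for m
    proof (rule summable_comparison_test'[where N=0])
      have "(\<lambda>k. ms_norm2 \<Omega> (z k 0)) summable_on UNIV"
        using ma by (simp add: canonical_moving_average_def)
      then show "summable (\<lambda>k. ms_norm2 \<Omega> (z k 0))" by (rule summable_on_imp_summable)
      fix k
      have "(\<Sum>m\<in>{m}. ms_norm2 freq (\<lambda>x. P x k m)) \<le> (\<Sum>m<N. ms_norm2 freq (\<lambda>x. P x k m))"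
        using that by (intro sum_mono2) auto
      then show "norm (ms_norm2 freq (\<lambda>x. P x k m)) \<le> ms_norm2 \<Omega> (z k 0)"
        by (simp add: z_norm2)
    qed
    show "fourier_L2 (\<lambda>l. \<Sum>u. \<Sum>k. avec T a (l + u) k * d u k m) 1 (\<lambda>x. S x m)" if "m < N" for m
      using S[of m] that by (simp add: N Ad_def)
    show "(\<lambda>x. Q x m k) \<in> borel_measurable borel" if "m < N" for m k
      using Qb[of m k] that by (simp add: N)
    show "sq_integrable \<Omega> A\<zeta>" using A\<zeta> by (simp add: has_ms_integral_def)
    show "(\<lambda>j. \<Sum>k. avec T a j k * ms_inner \<Omega> (z k (int j)) W) sums ms_inner \<Omega> A\<zeta> W"
      if "sq_integrable \<Omega> W" for W
      by (rule functional_pairing[OF T pc gen a_int A\<zeta> l2 that])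
  qed
  have A: "A_fun T a = pr.A" by (simp add: fun_eq_iff A_fun_def pr.A_def)
  have h_eq: "h = pr.h" by (simp add: fun_eq_iff h ind A pr.h_def)
  have Ad: "Ad_norm2 T a d M = (\<lambda>l. \<Sum>m<N. (cmod (pr.co l m))\<^sup>2)"
    by (simp add: fun_eq_iff Ad_norm2_def ind Ad_def pr.co_def)
  have total: "summable (Ad_norm2 T a d M)" "(\<Sum>l. Ad_norm2 T a d M l) = ms_norm2 (channels N) pr.S_vec"
    using pr.S_norm2 unfolding Ad by (simp_all add: sums_iff)
  have "mse f pr.A pr.h = ennreal (ms_norm2 (channels N) pr.S_vec)"
    using pr.mse_eq[OF pr.h_L2f_minus] by simp
  then show ?thesis
    unfolding A h_eq total(2)
    using total(1) pr.h_spectral_characteristic pr.spectral_characteristic_unique pr.h_integral_exists pr.h_estimate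
    by blast
qed

end
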